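(* Let $p>0$, $s>0$, and let $\varphi\in L^1(\mathbb R)$ satisfy $\int_{\mathbb R}\varphi=1$ and the conditions (M1) and (M2) of the context with this $s$. Let $f,g\in L^2(0,\infty)$ with $g=Lf$ and $Vf\in H^p(\mathbb R)$, let $w\in L^2(0,\infty)$ be such that $f=f_p(\bar L^*\bar L)w$, and let $\rho=\|w\|$. For each $\delta>0$ let $g^\delta\in L^2(0,\infty)$ satisfy $\|g-g^\delta\|\le\delta$, and for $\beta>0$ let $$f_\beta^\delta=\mathop{\mathrm{argmin}}_{h\in L^2(0,\infty)}\ \|g^\delta-Lh\|^2+\|(I-C_\beta)Vh\|^2 .$$ For the selection rule $\beta(\delta)=c\,\delta^{\theta/s}$ with constants $c>0$ and $\theta\in(0,1)$, there exist constants $K,C>0$ independent of $\delta$ such that $$\|f-f^\delta_{\beta(\delta)}\|\le K\rho\, f_p(\delta^{2\theta})(1+o(1))+C\,\delta^{1-\theta}=\mathcal O\left(f_p(\delta^2)\right)\quad\text{as }\delta\to0.$$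
   Context: $\|\cdot\|$ is the $L^2$-norm on $(0,\infty)$ or on $\mathbb R$. $L:L^2(0,\infty)\to L^2(0,\infty)$, $Lf(z)=\int_0^\infty e^{-z\tau}f(\tau)\,d\tau$ ($z>0$), is the real Laplace transform; it is bounded, self-adjoint, injective, with $\|L\|=\sqrt\pi$. $V:L^2(0,\infty)\to L^2(\mathbb R)$ is the unitary operator $(Vf)(u)=e^{u/2}f(e^u)$. The Fourier transform is $\widehat f(\xi)=\frac1{\sqrt{2\pi}}\int_{\mathbb R}e^{-i\xi t}f(t)\,dt$, and $\|v\|_{H^p}^2=\int_{\mathbb R}(1+|\xi|^2)^p|\widehat v(\xi)|^2\,d\xi$. For $\varphi\in L^1(\mathbb R)$ with unit integral and $\beta>0$, $\varphi_\beta(t)=\frac1\beta\varphi(t/\beta)$, and $C_\beta:L^2(\mathbb R)\to L^2(\mathbb R)$, $C_\beta v=\varphi_\beta*v$. Conditions on $\varphi$ (where $\widehat\varphi$ is real-valued): (M1) $\widehat\varphi(\xi)<1/\sqrt{2\pi}$ for every $\xi\ne0$; (M2) $\widehat\varphi(\xi)$ decreases as $|\xi|$ increases (i.e. is a non-increasing function of $|\xi|$) and $|1-\sqrt{2\pi}\,\widehat\varphi(\xi)|\sim|\xi|^s$ as $\xi\to0$. The minimizer $f_\beta^\delta$ exists and is unique. $\bar L=L/\sqrt{\pi e}$, so $\|\bar L^*\bar L\|\le e^{-1}$; $f_p(\lambda)=(-\ln\lambda)^{-p}$ for $\lambda\in(0,1)$, and $f_p(\bar L^*\bar L)$ is defined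 by functional calculus (with $f_p(0)=0$). The condition $Vf\in H^p(\mathbb R)$ is equivalent to the existence of a (unique) $w\in L^2(0,\infty)$ with $f=f_p(\bar L^*\bar L)w$. *)

theory Defs
  imports
    "HOL-Analysis.Analysis"
    "HOL-Library.Landau_Symbols"
    "HOL-Computational_Algebra.Polynomial"
begin

section \<open>Square-integrable functions\<close>

text \<open>
  The elements of \<open>L\<^sup>2(M)\<close> are represented by complex-valued functions, two of which stand for
  the same element if they agree almost everywhere.  All notions below that are used
  with \<open>L\<^sup>2\<close> functions depend only on the class of a function.
\<close>

definition L2 :: "'a measure \<Rightarrow> ('a \<Rightarrow> complex) set" where
  "L2 M = {f. f \<in> borel_measurable M \<and> integrable M (\<lambda>x. (cmod (f x))\<^sup>2)}"

definition L2_norm :: "'a measure \<Rightarrow> ('a \<Rightarrow> complex) \<Rightarrow> real" where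
  "L2_norm M f = sqrt (LINT x|M. (cmod (f x))\<^sup>2)"

definition L2_inner :: "'a measure \<Rightarrow> ('a \<Rightarrow> complex) \<Rightarrow> ('a \<Rightarrow> complex) \<Rightarrow> complex" where
  "L2_inner M f h = (LINT x|M. f x * cnj (h x))"

definition L2_adjoint ::
  "'a measure \<Rightarrow> 'b measure \<Rightarrow> (('a \<Rightarrow> complex) \<Rightarrow> ('b \<Rightarrow> complex)) \<Rightarrow> ('b \<Rightarrow> complex) \<Rightarrow> ('a \<Rightarrow> complex)"
where
  "L2_adjoint M N T = (SOME S. (\<forall>h\<in>L2 N. S h \<in> L2 M) \<and>
     (\<forall>f\<in>L2 M. \<forall>h\<in>L2 N. L2_inner N (T f) h = L2_inner M f (S h)))"

abbreviation halfline :: "real measure" where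
  "halfline \<equiv> restrict_space lborel {0<..}"

section \<open>The Laplace transform and the transfer to the real line\<close>

definition laplace :: "(real \<Rightarrow> complex) \<Rightarrow> real \<Rightarrow> complex" where
  "laplace f z = (LINT \<tau>|halfline. of_real (exp (- z * \<tau>)) * f \<tau>)"

definition laplace_bar :: "(real \<Rightarrow> complex) \<Rightarrow> real \<Rightarrow> complex" where
  "laplace_bar f z = laplace f z / of_real (sqrt (pi * exp 1))"

definition laplace_normal :: "(real \<Rightarrow> complex) \<Rightarrow> real \<Rightarrow> complex" where
  "laplace_normal f = L2_adjoint halfline halfline laplace_bar (laplace_bar f)"

definition to_line :: "(real \<Rightarrow> complex) \<Rightarrow> real \<Rightarrow> complex" where
  "to_line f u = of_real (exp (u / 2)) * f (exp u)"

section \<open>Fourier transform and Sobolev spaces\<close>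

definition fourier :: "(real \<Rightarrow> complex) \<Rightarrow> real \<Rightarrow> complex" where
  "fourier f \<xi> = (LINT t|lborel. exp (- \<i> * of_real (\<xi> * t)) * f t) / of_real (sqrt (2 * pi))"

text \<open>
  The integral above need not converge for square-integrable functions; their Fourier
  transform is the \<open>L\<^sup>2\<close> limit of the transforms of the truncations to \<open>[-n,n]\<close>.
\<close>

definition has_L2_fourier :: "(real \<Rightarrow> complex) \<Rightarrow> (real \<Rightarrow> complex) \<Rightarrow> bool" where
  "has_L2_fourier v vh \<longleftrightarrow> v \<in> L2 lborel \<and> vh \<in> L2 lborel \<and>
     (\<lambda>n. L2_norm lborel
        (\<lambda>\<xi>. fourier (\<lambda>t. indicator {- real n..real n} t * v t) \<xi> - vh \<xi>)) \<longlonglongrightarrow> 0"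

definition sobolev :: "real \<Rightarrow> (real \<Rightarrow> complex) set" where
  "sobolev p = {v. \<exists>vh. has_L2_fourier v vh \<and>
     integrable lborel (\<lambda>\<xi>. (1 + \<bar>\<xi>\<bar>\<^sup>2) powr p * (cmod (vh \<xi>))\<^sup>2)}"

section \<open>Mollifiers\<close>

definition dilate :: "(real \<Rightarrow> complex) \<Rightarrow> real \<Rightarrow> real \<Rightarrow> complex" where
  "dilate \<phi> \<beta> t = \<phi> (t / \<beta>) / of_real \<beta>"

definition convolution :: "(real \<Rightarrow> complex) \<Rightarrow> (real \<Rightarrow> complex) \<Rightarrow> real \<Rightarrow> complex" where
  "convolution k v t = (LINT r|lborel. k (t - r) * v r)"

definition mollify :: "(real \<Rightarrow> complex) \<Rightarrow> real \<Rightarrow> (real \<Rightarrow> complex) \<Rightarrow> real \<Rightarrow> complex" where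
  "mollify \<phi> \<beta> v = convolution (dilate \<phi> \<beta>) v"

text \<open>
  Both conditions are meant for \<open>\<phi>\<close> with real-valued Fourier transform, hence the use of \<^term>\<open>Re\<close>.
\<close>

definition cond_M1 :: "(real \<Rightarrow> complex) \<Rightarrow> bool" where
  "cond_M1 \<phi> \<longleftrightarrow> (\<forall>\<xi>. \<xi> \<noteq> 0 \<longrightarrow> Re (fourier \<phi> \<xi>) < 1 / sqrt (2 * pi))"

definition cond_M2 :: "real \<Rightarrow> (real \<Rightarrow> complex) \<Rightarrow> bool" where
  "cond_M2 s \<phi> \<longleftrightarrow>
     (\<forall>\<xi> \<eta>. \<bar>\<xi>\<bar> \<le> \<bar>\<eta>\<bar> \<longrightarrow> Re (fourier \<phi> \<eta>) \<le> Re (fourier \<phi> \<xi>)) \<and>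
     (\<lambda>\<xi>. \<bar>1 - sqrt (2 * pi) * Re (fourier \<phi> \<xi>)\<bar>) \<sim>[at 0] (\<lambda>\<xi>. \<bar>\<xi>\<bar> powr s)"

definition objective ::
  "(real \<Rightarrow> complex) \<Rightarrow> real \<Rightarrow> (real \<Rightarrow> complex) \<Rightarrow> (real \<Rightarrow> complex) \<Rightarrow> real"
where
  "objective \<phi> \<beta> g h =
     (L2_norm halfline (\<lambda>z. g z - laplace h z))\<^sup>2 +
     (L2_norm lborel (\<lambda>u. to_line h u - mollify \<phi> \<beta> (to_line h) u))\<^sup>2"

section \<open>Functional calculus\<close>

definition poly_op ::
  "real poly \<Rightarrow> (('a \<Rightarrow> complex) \<Rightarrow> ('a \<Rightarrow> complex)) \<Rightarrow> ('a \<Rightarrow> complex) \<Rightarrow> 'a \<Rightarrow> complex"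
where
  "poly_op q T w x = (\<Sum>i\<le>degree q. of_real (coeff q i) * (T ^^ i) w x)"

text \<open>
  Continuous functional calculus: \<open>u = F(T) w\<close> for a self-adjoint operator \<open>T\<close> on \<open>L\<^sup>2(M)\<close> with
  \<open>0 \<le> T \<le> b\<close> and a function \<open>F\<close> that is continuous on \<open>[0,b]\<close>, where \<open>F(T)\<close> is the limit of \<open>q\<^sub>n(T)\<close>
  for polynomials \<open>q\<^sub>n\<close> converging to \<open>F\<close> uniformly on \<open>[0,b]\<close>.  The limit does not depend on
  the choice of the \<open>q\<^sub>n\<close> nor on \<open>b\<close>, because the norm of \<open>q(T)\<close> is at most the supremum of \<open>|q|\<close>
  on the spectrum of \<open>T\<close>, a subset of \<open>[0,b]\<close>.
\<close>

definition is_fun_calc ::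
  "'a measure \<Rightarrow> (('a \<Rightarrow> complex) \<Rightarrow> ('a \<Rightarrow> complex)) \<Rightarrow> real \<Rightarrow> (real \<Rightarrow> real) \<Rightarrow>
    ('a \<Rightarrow> complex) \<Rightarrow> ('a \<Rightarrow> complex) \<Rightarrow> bool"
where
  "is_fun_calc M T b F w u \<longleftrightarrow> w \<in> L2 M \<and> u \<in> L2 M \<and>
     (\<exists>q :: nat \<Rightarrow> real poly. uniform_limit {0..b} (\<lambda>n. poly (q n)) F sequentially \<and>
        (\<lambda>n. L2_norm M (\<lambda>x. poly_op (q n) T w x - u x)) \<longlonglongrightarrow> 0)"

definition log_source :: "real \<Rightarrow> real \<Rightarrow> real" where
  "log_source p x = (if x = 0 then 0 else (- ln x) powr (- p))"

end

theory Submission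
  imports "HOL-Probability.Characteristic_Functions" Defs
begin

text \<open>
  In the coordinate \<open>u = ln \<tau>\<close> the products \<open>z \<tau>\<close> become sums, so the unitary operator \<open>V\<close> turns \<open>L\<close> into
  reflection followed by convolution with \<open>\<ell>(u) = exp (u/2 - exp u)\<close>.  The transform of \<open>\<ell>\<close> is a Gamma
  function on the critical line, and Euler's reflection formula gives the multiplier
  \<open>m(\<xi>) = |\<Gamma>(1/2 - i\<xi>)|\<^sup>2 = \<pi> / cosh (\<pi>\<xi>)\<close> of \<open>L\<^sup>* L\<close>.  The mollifier is a convolution on the same line,
  so the Fourier transform diagonalizes both terms of the functional; the penalty has the symbol
  \<open>\<sigma>(\<xi>) = |1 - (2\<pi>)\<^sup>1\<^sup>/\<^sup>2 \<phi>^(\<beta>\<xi>)|\<^sup>2\<close>.  If \<open>e\<close> is the reconstruction error, \<open>u\<close> the exact solution and \<open>\<eta>\<close> the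
  data noise, all three transferred to the line, the normal equation of the minimizer reads
  \<open>(m + \<sigma>)(\<xi>) e^(\<xi>) = \<Gamma>(1/2 - i\<xi>) \<eta>^(-\<xi>) - \<sigma>(\<xi>) u^(\<xi>)\<close> (\<open>fourier_residual\<close>, \<open>minimizer_gradient_zero\<close>).
  The error is therefore the sum of a noise and a bias term with explicit symbols
  (\<open>error_estimate\<close>).

  The noise symbol \<open>m\<^sup>1\<^sup>/\<^sup>2 / (m + \<sigma>)\<close> is bounded for \<open>|\<xi>| \<le> 1\<close> because \<open>m\<close> is bounded below there.  For
  \<open>|\<xi>| \<ge> 1\<close> it is at most \<open>\<sigma>\<^sup>-\<^sup>1\<^sup>/\<^sup>2 / 2\<close>, and the monotonicity in (M2) yields \<open>\<sigma>(\<xi>) \<ge> \<beta>\<^sup>2\<^sup>s / 4\<close> for small \<open>\<beta>\<close>.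
  With \<open>\<beta> = c \<delta>\<close> to the power \<open>\<theta>/s\<close> the noise contributes at most a multiple of \<open>\<delta>\<close> to the power
  \<open>1 - \<theta>\<close> (\<open>noise_symbol_bound\<close>).

  The bias symbol is \<open>\<sigma> / (m + \<sigma>) \<le> 1\<close>.  The frequency axis is cut at \<open>R = (\<theta>/\<pi>) |ln \<delta>|\<close>.  Beyond \<open>R\<close> the Sobolev
  weight supplies the factor \<open>R\<close> to the power \<open>-p\<close>.  Below \<open>R\<close>, \<open>\<sigma>\<close> is at most \<open>4 (\<beta>R)\<^sup>2\<^sup>s\<close>, which is of order
  \<open>\<delta>\<^sup>2\<^sup>\<theta> R\<^sup>2\<^sup>s\<close>, whereas \<open>m\<close> is at least of order \<open>exp (-\<pi>R) = \<delta>\<^sup>\<theta>\<close>; the quotient is of order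
  \<open>\<delta>\<^sup>\<theta> R\<^sup>2\<^sup>s\<close> and eventually smaller than any power of \<open>1/R\<close> (\<open>bias_symbol_bound\<close>).  Since \<open>R\<close> to the power
  \<open>-p\<close> is \<open>(2\<pi>)\<^sup>p\<close> times \<open>log_source p\<close> at \<open>\<delta>\<^sup>2\<^sup>\<theta>\<close>, this is the logarithmic rate.

  The estimate is first proved for functions in \<open>L\<^sup>1\<close> and \<open>L\<^sup>2\<close>, where the Fourier integral converges
  and \<open>Plancherel\<close> holds, and is then extended by truncation.  The factor \<open>\<rho>\<close> in the bound is
  obtained by absorbing the Sobolev norm of \<open>V f\<close> into \<open>K\<close> if \<open>\<rho> > 0\<close>; if \<open>\<rho> = 0\<close> the source condition
  forces \<open>f = 0\<close> (\<open>fun_calc_null\<close>) and there is no bias.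
\<close>

section \<open>Square-integrable functions\<close>

lemma borel_measurable_cnj [measurable (raw)]:
  "f \<in> borel_measurable M \<Longrightarrow> (\<lambda>x. cnj (f x)) \<in> borel_measurable M"
  by (rule borel_measurable_continuous_on[of cnj]) (auto intro!: continuous_intros)

lemma L2_measurable: "f \<in> L2 M \<Longrightarrow> f \<in> borel_measurable M"
  and L2_integrable_sq: "f \<in> L2 M \<Longrightarrow> integrable M (\<lambda>x. (cmod (f x))\<^sup>2)"
  by (auto simp: L2_def)

lemma L2_norm_nonneg [simp]: "0 \<le> L2_norm M f"
  by (simp add: L2_norm_def)

lemma L2_norm_power2: "(L2_norm M f)\<^sup>2 = (LINT x|M. (cmod (f x))\<^sup>2)"
  by (simp add: L2_norm_def)

lemma L2_norm_cong: "(\<And>x. x \<in> space M \<Longrightarrow> cmod (f x) = cmod (g x)) \<Longrightarrow> L2_norm M f = L2_norm M g"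
  unfolding L2_norm_def by (auto intro!: arg_cong[where f = sqrt] Bochner_Integration.integral_cong)

lemma L2_dominated:
  assumes g: "g \<in> L2 M" and [measurable]: "f \<in> borel_measurable M" and C: "C \<ge> 0"
    and le: "AE x in M. cmod (f x) \<le> C * cmod (g x)"
  shows "f \<in> L2 M" and "L2_norm M f \<le> C * L2_norm M g"
proof -
  note [measurable] = L2_measurable[OF g]
  have i: "integrable M (\<lambda>x. C\<^sup>2 * (cmod (g x))\<^sup>2)"
    using L2_integrable_sq[OF g] by simp
  have le': "AE x in M. (cmod (f x))\<^sup>2 \<le> C\<^sup>2 * (cmod (g x))\<^sup>2"
    using le by eventually_elim (metis norm_ge_zero power_mono power_mult_distrib)
  have j: "integrable M (\<lambda>x. (cmod (f x))\<^sup>2)"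
    by (rule Bochner_Integration.integrable_bound[OF i]) (use le' in auto)
  then show "f \<in> L2 M" by (simp add: L2_def)
  have "(L2_norm M f)\<^sup>2 \<le> (C * L2_norm M g)\<^sup>2"
    unfolding power_mult_distrib L2_norm_power2
    using integral_mono_AE[OF j i le'] by simp
  then show "L2_norm M f \<le> C * L2_norm M g"
    using C by (meson L2_norm_nonneg mult_nonneg_nonneg power2_le_imp_le)
qed

lemma L2_dominated1:
  assumes "g \<in> L2 M" "f \<in> borel_measurable M" "AE x in M. cmod (f x) \<le> cmod (g x)"
  shows "f \<in> L2 M" and "L2_norm M f \<le> L2_norm M g"
  using L2_dominated[of g M f 1] assms by auto

lemma L2_cong_AE:
  assumes "g \<in> L2 M" "f \<in> borel_measurable M" "AE x in M. f x = g x"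
  shows "f \<in> L2 M" and "L2_norm M f = L2_norm M g"
proof -
  show f: "f \<in> L2 M"
    by (rule L2_dominated1[OF assms(1,2)]) (use assms(3) in auto)
  show "L2_norm M f = L2_norm M g"
  proof (rule antisym)
    show "L2_norm M f \<le> L2_norm M g"
      by (rule L2_dominated1(2)[OF assms(1,2)]) (use assms(3) in auto)
    show "L2_norm M g \<le> L2_norm M f"
      by (rule L2_dominated1(2)[OF f L2_measurable[OF assms(1)]]) (use assms(3) in auto)
  qed
qed

lemma L2_zero [simp]: "(\<lambda>x. 0) \<in> L2 M" and L2_norm_zero [simp]: "L2_norm M (\<lambda>x. 0) = 0"
  by (auto simp: L2_def L2_norm_def)

lemma L2_scale:
  assumes "f \<in> L2 M"
  shows "(\<lambda>x. c * f x) \<in> L2 M"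
  by (rule L2_dominated[OF assms, of _ "cmod c"]) (use L2_measurable[OF assms] in \<open>auto simp: norm_mult\<close>)

lemma L2_norm_scale: "L2_norm M (\<lambda>x. c * f x) = cmod c * L2_norm M f"
  by (simp add: L2_norm_def norm_mult power_mult_distrib real_sqrt_mult)

lemma L2_add:
  assumes f: "f \<in> L2 M" and g: "g \<in> L2 M"
  shows "(\<lambda>x. f x + g x) \<in> L2 M"
proof -
  note [measurable] = L2_measurable[OF f] L2_measurable[OF g]
  have le: "(cmod (a + b))\<^sup>2 \<le> 2 * (cmod a)\<^sup>2 + 2 * (cmod b)\<^sup>2" for a b :: complex
  proof -
    have "(cmod (a + b))\<^sup>2 \<le> (cmod a + cmod b)\<^sup>2"
      by (intro power_mono norm_triangle_ineq) auto
    also have "\<dots> \<le> 2 * (cmod a)\<^sup>2 + 2 * (cmod b)\<^sup>2"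
      using sum_squares_bound[of "cmod a" "cmod b"] by (simp add: power2_sum)
    finally show ?thesis .
  qed
  have "integrable M (\<lambda>x. 2 * (cmod (f x))\<^sup>2 + 2 * (cmod (g x))\<^sup>2)"
    using L2_integrable_sq[OF f] L2_integrable_sq[OF g] by simp
  then have "integrable M (\<lambda>x. (cmod (f x + g x))\<^sup>2)"
    by (rule Bochner_Integration.integrable_bound) (auto intro!: AE_I2 order_trans[OF le])
  then show ?thesis by (simp add: L2_def)
qed

lemma L2_diff:
  assumes f: "f \<in> L2 M" and g: "g \<in> L2 M"
  shows "(\<lambda>x. f x - g x) \<in> L2 M"
  using L2_add[OF f L2_scale[OF g, of "-1"]] by simp

lemma L2_prod_integrable:
  assumes f: "f \<in> L2 M" and g: "g \<in> L2 M"
  shows "integrable M (\<lambda>x. cmod (f x) * cmod (g x))" and "integrable M (\<lambda>x. f x * g x)"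
    and "integrable M (\<lambda>x. f x * cnj (g x))"
proof -
  note [measurable] = L2_measurable[OF f] L2_measurable[OF g]
  have le: "a * b \<le> a\<^sup>2 + b\<^sup>2" if "a \<ge> 0" "b \<ge> 0" for a b :: real
    using sum_squares_bound[of a b] mult_nonneg_nonneg[OF that] by linarith
  have i: "integrable M (\<lambda>x. (cmod (f x))\<^sup>2 + (cmod (g x))\<^sup>2)"
    using L2_integrable_sq[OF f] L2_integrable_sq[OF g] by simp
  show j: "integrable M (\<lambda>x. cmod (f x) * cmod (g x))"
    by (rule Bochner_Integration.integrable_bound[OF i]) (auto intro!: AE_I2 le)
  show "integrable M (\<lambda>x. f x * g x)" "integrable M (\<lambda>x. f x * cnj (g x))"
    by (auto intro!: Bochner_Integration.integrable_bound[OF j] simp: norm_mult)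
qed

lemma L2_Cauchy_Schwarz:
  assumes f: "f \<in> L2 M" and g: "g \<in> L2 M"
  shows "(LINT x|M. cmod (f x) * cmod (g x)) \<le> L2_norm M f * L2_norm M g"
proof -
  note [measurable] = L2_measurable[OF f] L2_measurable[OF g]
  have *: "(\<integral>\<^sup>+x. ennreal (cmod (f x)) * ennreal (cmod (g x)) \<partial>M)\<^sup>2
      \<le> (\<integral>\<^sup>+x. ennreal (cmod (f x)) ^ 2 \<partial>M) * (\<integral>\<^sup>+x. ennreal (cmod (g x)) ^ 2 \<partial>M)"
    by (rule Cauchy_Schwarz_nn_integral) auto
  have sq: "(\<integral>\<^sup>+x. ennreal (cmod (h x)) ^ 2 \<partial>M) = ennreal ((L2_norm M h)\<^sup>2)" if "h \<in> L2 M" for h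
    unfolding L2_norm_power2
    using nn_integral_eq_integral[OF L2_integrable_sq[OF that]] by (simp add: ennreal_power)
  have "(\<integral>\<^sup>+x. ennreal (cmod (f x)) * ennreal (cmod (g x)) \<partial>M) = ennreal (LINT x|M. cmod (f x) * cmod (g x))"
    using nn_integral_eq_integral[OF L2_prod_integrable(1)[OF f g]] by (simp add: ennreal_mult)
  then have "ennreal ((LINT x|M. cmod (f x) * cmod (g x))\<^sup>2) \<le> ennreal ((L2_norm M f)\<^sup>2) * ennreal ((L2_norm M g)\<^sup>2)"
    using * sq[OF f] sq[OF g] by (simp add: ennreal_power)
  also have "\<dots> = ennreal ((L2_norm M f * L2_norm M g)\<^sup>2)"
    by (simp add: ennreal_mult power_mult_distrib)
  finally have "(LINT x|M. cmod (f x) * cmod (g x))\<^sup>2 \<le> (L2_norm M f * L2_norm M g)\<^sup>2"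
    by simp
  then show ?thesis
    by (rule power2_le_imp_le) simp
qed

lemma L2_norm_triangle:
  assumes f: "f \<in> L2 M" and g: "g \<in> L2 M"
  shows "L2_norm M (\<lambda>x. f x + g x) \<le> L2_norm M f + L2_norm M g"
proof -
  note [measurable] = L2_measurable[OF f] L2_measurable[OF g]
  note i = L2_integrable_sq[OF f] L2_integrable_sq[OF g] L2_prod_integrable(1)[OF f g]
  have "(L2_norm M (\<lambda>x. f x + g x))\<^sup>2 \<le>
      (LINT x|M. (cmod (f x))\<^sup>2 + (cmod (g x))\<^sup>2 + 2 * (cmod (f x) * cmod (g x)))"
    unfolding L2_norm_power2
  proof (rule integral_mono[OF L2_integrable_sq[OF L2_add[OF f g]]])
    fix x
    have "(cmod (f x + g x))\<^sup>2 \<le> (cmod (f x) + cmod (g x))\<^sup>2"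
      by (intro power_mono norm_triangle_ineq) auto
    then show "(cmod (f x + g x))\<^sup>2 \<le> (cmod (f x))\<^sup>2 + (cmod (g x))\<^sup>2 + 2 * (cmod (f x) * cmod (g x))"
      by (simp add: power2_sum)
  qed (use i in auto)
  also have "\<dots> = (L2_norm M f)\<^sup>2 + (L2_norm M g)\<^sup>2 + 2 * (LINT x|M. cmod (f x) * cmod (g x))"
    unfolding L2_norm_power2 using i by simp
  also have "\<dots> \<le> (L2_norm M f)\<^sup>2 + (L2_norm M g)\<^sup>2 + 2 * (L2_norm M f * L2_norm M g)"
    using L2_Cauchy_Schwarz[OF f g] by simp
  also have "\<dots> = (L2_norm M f + L2_norm M g)\<^sup>2"
    by (simp add: power2_sum)
  finally show ?thesis
    by (rule power2_le_imp_le) simp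
qed

lemma L2_norm_minus_commute: "L2_norm M (\<lambda>x. f x - g x) = L2_norm M (\<lambda>x. g x - f x)"
  by (intro L2_norm_cong) (simp add: norm_minus_commute)

lemma L2_norm_triangle_diff:
  assumes f: "f \<in> L2 M" and g: "g \<in> L2 M"
  shows "L2_norm M (\<lambda>x. f x - g x) \<le> L2_norm M f + L2_norm M g"
  using L2_norm_triangle[OF f L2_scale[OF g, of "-1"]] L2_norm_scale[of M "-1" g] by simp

lemma L2_norm_reverse_triangle:
  assumes f: "f \<in> L2 M" and g: "g \<in> L2 M"
  shows "\<bar>L2_norm M f - L2_norm M g\<bar> \<le> L2_norm M (\<lambda>x. f x - g x)"
  using L2_norm_triangle[OF L2_diff[OF f g] g] L2_norm_triangle[OF L2_diff[OF g f] f]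
    L2_norm_minus_commute[of M f g] by simp

lemma L2_norm_tendsto:
  assumes "\<And>n. F n \<in> L2 M" "f \<in> L2 M" "(\<lambda>n. L2_norm M (\<lambda>x. F n x - f x)) \<longlonglongrightarrow> 0"
  shows "(\<lambda>n. L2_norm M (F n)) \<longlonglongrightarrow> L2_norm M f"
proof -
  have "(\<lambda>n. L2_norm M (F n) - L2_norm M f) \<longlonglongrightarrow> 0"
    by (rule Lim_null_comparison[OF _ assms(3)])
       (auto intro!: always_eventually L2_norm_reverse_triangle assms(1,2))
  then show ?thesis by (simp add: LIM_zero_iff)
qed

lemma L2_norm_eq_0:
  assumes "f \<in> L2 M" "L2_norm M f = 0"
  shows "AE x in M. f x = 0"
proof -
  have "(LINT x|M. (cmod (f x))\<^sup>2) = 0" using assms(2) L2_norm_power2[of M f] by simp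
  then show ?thesis
    using integral_nonneg_eq_0_iff_AE[OF L2_integrable_sq[OF assms(1)]] by simp
qed

text \<open>
  This expansion along a ray yields the first-order optimality condition of the minimizer.
\<close>

lemma L2_norm_diff_scale:
  fixes t :: real
  assumes f: "f \<in> L2 M" and g: "g \<in> L2 M"
  shows "(L2_norm M (\<lambda>x. f x - of_real t * g x))\<^sup>2 =
     (L2_norm M f)\<^sup>2 - 2 * t * Re (L2_inner M f g) + t\<^sup>2 * (L2_norm M g)\<^sup>2"
proof -
  note i = L2_integrable_sq[OF f] L2_integrable_sq[OF g] integrable_Re[OF L2_prod_integrable(3)[OF f g]]
  have "(L2_norm M (\<lambda>x. f x - of_real t * g x))\<^sup>2 =
      (LINT x|M. (cmod (f x))\<^sup>2 - 2 * t * Re (f x * cnj (g x)) + t\<^sup>2 * (cmod (g x))\<^sup>2)"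
    unfolding L2_norm_power2 cmod_power2
    by (intro Bochner_Integration.integral_cong refl) (simp add: power2_eq_square algebra_simps)
  also have "\<dots> = (LINT x|M. (cmod (f x))\<^sup>2) - 2 * t * (LINT x|M. Re (f x * cnj (g x)))
      + t\<^sup>2 * (LINT x|M. (cmod (g x))\<^sup>2)"
    using i by simp
  finally show ?thesis
    unfolding L2_norm_power2 L2_inner_def
    using integral_Re[OF L2_prod_integrable(3)[OF f g]] by simp
qed

lemma L2_inner_commute: "L2_inner M g f = cnj (L2_inner M f g)"
  unfolding L2_inner_def by (subst Bochner_Integration.integral_cnj[symmetric]) (simp add: mult.commute)

lemma L2_inner_self: "L2_inner M f f = of_real ((L2_norm M f)\<^sup>2)"
proof -
  have "L2_inner M f f = (LINT x|M. of_real ((cmod (f x))\<^sup>2))"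
    unfolding L2_inner_def by (simp only: complex_norm_square)
  also have "\<dots> = of_real (LINT x|M. (cmod (f x))\<^sup>2)"
  proof (cases "integrable M (\<lambda>x. (cmod (f x))\<^sup>2)")
    case False
    then have *: "\<not> integrable M (\<lambda>x. complex_of_real ((cmod (f x))\<^sup>2))"
      using integrable_Re by fastforce
    show ?thesis
      unfolding not_integrable_integral_eq[OF False] not_integrable_integral_eq[OF *] by simp
  qed (rule integral_of_real)
  finally show ?thesis by (simp only: L2_norm_power2)
qed

lemma L2_inner_diff_left:
  assumes "f \<in> L2 M" "g \<in> L2 M" "h \<in> L2 M"
  shows "L2_inner M (\<lambda>x. f x - g x) h = L2_inner M f h - L2_inner M g h"
  unfolding L2_inner_def using L2_prod_integrable(3)[OF assms(1,3)] L2_prod_integrable(3)[OF assms(2,3)]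
  by (simp add: left_diff_distrib)

lemma L2_inner_add_left:
  assumes "f \<in> L2 M" "g \<in> L2 M" "h \<in> L2 M"
  shows "L2_inner M (\<lambda>x. f x + g x) h = L2_inner M f h + L2_inner M g h"
  unfolding L2_inner_def using L2_prod_integrable(3)[OF assms(1,3)] L2_prod_integrable(3)[OF assms(2,3)]
  by (simp add: distrib_right)

lemma L2_inner_diff_right:
  assumes "f \<in> L2 M" "g \<in> L2 M" "h \<in> L2 M"
  shows "L2_inner M h (\<lambda>x. f x - g x) = L2_inner M h f - L2_inner M h g"
  by (simp only: L2_inner_commute[of M h] L2_inner_diff_left[OF assms] complex_cnj_diff)

lemma L2_norm_eq_nn_integral:
  "f \<in> L2 M \<Longrightarrow> ennreal ((L2_norm M f)\<^sup>2) = (\<integral>\<^sup>+x. ennreal ((cmod (f x))\<^sup>2) \<partial>M)"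
  unfolding L2_norm_power2 by (rule nn_integral_eq_integral[symmetric]) (auto intro: L2_integrable_sq)

lemma L2_norm_le_nn_integral:
  assumes "f \<in> borel_measurable M" "(\<integral>\<^sup>+x. ennreal ((cmod (f x))\<^sup>2) \<partial>M) \<le> ennreal (C\<^sup>2)" "C \<ge> 0"
  shows "f \<in> L2 M" and "L2_norm M f \<le> C"
proof -
  have "integrable M (\<lambda>x. (cmod (f x))\<^sup>2)"
    using assms by (intro integrableI_bounded) (auto intro: le_less_trans)
  then show f: "f \<in> L2 M" using assms(1) by (simp add: L2_def)
  show "L2_norm M f \<le> C"
    using assms(2,3) L2_norm_eq_nn_integral[OF f, symmetric] by (auto intro: power2_le_imp_le)
qed

section \<open>Convolution\<close>

lemma borel_measurable_convolution [measurable]: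
  assumes [measurable]: "k \<in> borel_measurable borel" "v \<in> borel_measurable borel"
  shows "convolution k v \<in> borel_measurable borel"
  unfolding convolution_def by measurable

lemma nn_integral_reflect_shift:
  fixes a :: "real \<Rightarrow> ennreal"
  assumes [measurable]: "a \<in> borel_measurable borel"
  shows "(\<integral>\<^sup>+r. a (t - r) \<partial>lborel) = (\<integral>\<^sup>+r. a r \<partial>lborel)"
    and "(\<integral>\<^sup>+r. a (r - t) \<partial>lborel) = (\<integral>\<^sup>+r. a r \<partial>lborel)"
  using nn_integral_real_affine[of a "-1" t] nn_integral_real_affine[of a 1 "-t"] by simp_all

text \<open>
  Writing \<open>|k| |v|\<close> as \<open>|k|\<^sup>1\<^sup>/\<^sup>2 (|k|\<^sup>1\<^sup>/\<^sup>2 |v|)\<close> and applying the Cauchy--Schwarz inequality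
  reduces the \<open>L\<^sup>1 * L\<^sup>2\<close> case of Young's inequality to Tonelli's theorem.
\<close>

lemma Young_nn_integral:
  fixes a b :: "real \<Rightarrow> real"
  assumes [measurable]: "a \<in> borel_measurable borel" "b \<in> borel_measurable borel"
    and a: "\<And>x. a x \<ge> 0" and b: "\<And>x. b x \<ge> 0"
  shows "(\<integral>\<^sup>+t. (\<integral>\<^sup>+r. ennreal (a (t - r) * b r) \<partial>lborel)\<^sup>2 \<partial>lborel)
     \<le> (\<integral>\<^sup>+t. ennreal (a t) \<partial>lborel)\<^sup>2 * (\<integral>\<^sup>+t. ennreal ((b t)\<^sup>2) \<partial>lborel)"
proof -
  let ?A = "\<integral>\<^sup>+t. ennreal (a t) \<partial>lborel"
  have CS: "(\<integral>\<^sup>+r. ennreal (a (t - r) * b r) \<partial>lborel)\<^sup>2 \<le> ?A * (\<integral>\<^sup>+r. ennreal (a (t - r) * (b r)\<^sup>2) \<partial>lborel)" for t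
  proof -
    have "(\<integral>\<^sup>+r. ennreal (sqrt (a (t - r))) * ennreal (sqrt (a (t - r)) * b r) \<partial>lborel)\<^sup>2
      \<le> (\<integral>\<^sup>+r. ennreal (sqrt (a (t - r))) ^ 2 \<partial>lborel) * (\<integral>\<^sup>+r. ennreal (sqrt (a (t - r)) * b r) ^ 2 \<partial>lborel)"
      by (rule Cauchy_Schwarz_nn_integral) auto
    also have "(\<lambda>r. ennreal (sqrt (a (t - r))) * ennreal (sqrt (a (t - r)) * b r)) = (\<lambda>r. ennreal (a (t - r) * b r))"
      using a b by (auto simp flip: ennreal_mult mult.assoc)
    also have "(\<lambda>r. ennreal (sqrt (a (t - r))) ^ 2) = (\<lambda>r. ennreal (a (t - r)))"
      using a by (auto simp: ennreal_power)
    also have "(\<lambda>r. ennreal (sqrt (a (t - r)) * b r) ^ 2) = (\<lambda>r. ennreal (a (t - r) * (b r)\<^sup>2))"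
      using a b by (auto simp: ennreal_power power_mult_distrib)
    finally show ?thesis
      using nn_integral_reflect_shift(1)[of "\<lambda>x. ennreal (a x)" t] by simp
  qed
  have "(\<integral>\<^sup>+t. (\<integral>\<^sup>+r. ennreal (a (t - r) * b r) \<partial>lborel)\<^sup>2 \<partial>lborel)
      \<le> (\<integral>\<^sup>+t. ?A * (\<integral>\<^sup>+r. ennreal (a (t - r) * (b r)\<^sup>2) \<partial>lborel) \<partial>lborel)"
    by (intro nn_integral_mono CS)
  also have "\<dots> = ?A * (\<integral>\<^sup>+t. (\<integral>\<^sup>+r. ennreal (a (t - r) * (b r)\<^sup>2) \<partial>lborel) \<partial>lborel)"
    by (rule nn_integral_cmult) measurable
  also have "(\<integral>\<^sup>+t. (\<integral>\<^sup>+r. ennreal (a (t - r) * (b r)\<^sup>2) \<partial>lborel) \<partial>lborel)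
      = (\<integral>\<^sup>+r. (\<integral>\<^sup>+t. ennreal (a (t - r) * (b r)\<^sup>2) \<partial>lborel) \<partial>lborel)"
    by (rule lborel_pair.Fubini'[symmetric]) measurable
  also have "\<dots> = (\<integral>\<^sup>+r. ?A * ennreal ((b r)\<^sup>2) \<partial>lborel)"
  proof (rule nn_integral_cong)
    fix r
    have "(\<integral>\<^sup>+t. ennreal (a (t - r) * (b r)\<^sup>2) \<partial>lborel) = (\<integral>\<^sup>+t. ennreal (a (t - r)) \<partial>lborel) * ennreal ((b r)\<^sup>2)"
      using a by (subst nn_integral_multc[symmetric]) (auto simp: ennreal_mult)
    then show "(\<integral>\<^sup>+t. ennreal (a (t - r) * (b r)\<^sup>2) \<partial>lborel) = ?A * ennreal ((b r)\<^sup>2)"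
      using nn_integral_reflect_shift(2)[of "\<lambda>x. ennreal (a x)" r] by simp
  qed
  also have "\<dots> = ?A * (\<integral>\<^sup>+r. ennreal ((b r)\<^sup>2) \<partial>lborel)"
    by (rule nn_integral_cmult) measurable
  finally show ?thesis
    by (simp add: power2_eq_square mult.assoc)
qed

context
  fixes k v :: "real \<Rightarrow> complex"
  assumes k: "integrable lborel k" and v: "v \<in> L2 lborel"
begin

private lemma km [measurable]: "k \<in> borel_measurable borel" and vm [measurable]: "v \<in> borel_measurable borel"
  using borel_measurable_integrable[OF k] L2_measurable[OF v] by simp_all

lemma Young_norm_nn_integral:
  "(\<integral>\<^sup>+t. (\<integral>\<^sup>+r. ennreal (cmod (k (t - r)) * cmod (v r)) \<partial>lborel)\<^sup>2 \<partial>lborel)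
     \<le> ennreal (((LINT t|lborel. cmod (k t)) * L2_norm lborel v)\<^sup>2)"
proof -
  have 1: "(\<integral>\<^sup>+t. ennreal (cmod (k t)) \<partial>lborel) = ennreal (LINT t|lborel. cmod (k t))"
    using k by (intro nn_integral_eq_integral) auto
  have 2: "(\<integral>\<^sup>+t. ennreal ((cmod (v t))\<^sup>2) \<partial>lborel) = ennreal ((L2_norm lborel v)\<^sup>2)"
    unfolding L2_norm_power2 by (intro nn_integral_eq_integral L2_integrable_sq v) auto
  show ?thesis
    using Young_nn_integral[of "\<lambda>x. cmod (k x)" "\<lambda>x. cmod (v x)"]
    by (simp add: 1 2 ennreal_power power_mult_distrib flip: ennreal_mult)
qed

lemma AE_integrable_convolution: "AE t in lborel. integrable lborel (\<lambda>r. k (t - r) * v r)"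
proof -
  have "AE t in lborel. (\<integral>\<^sup>+r. ennreal (cmod (k (t - r)) * cmod (v r)) \<partial>lborel)\<^sup>2 \<noteq> \<infinity>"
  proof (rule nn_integral_PInf_AE)
    show "(\<integral>\<^sup>+t. (\<integral>\<^sup>+r. ennreal (cmod (k (t - r)) * cmod (v r)) \<partial>lborel)\<^sup>2 \<partial>lborel) \<noteq> \<infinity>"
      using Young_norm_nn_integral by (metis ennreal_less_top infinity_ennreal_def leD)
  qed measurable
  then show ?thesis
  proof eventually_elim
    case (elim t)
    then have "(\<integral>\<^sup>+r. ennreal (cmod (k (t - r)) * cmod (v r)) \<partial>lborel) < \<infinity>"
      by (simp add: less_top power_less_top_ennreal)
    then show ?case by (intro integrableI_bounded) (auto simp: norm_mult)
  qed
qed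

lemma convolution_L2: "convolution k v \<in> L2 lborel"
  and L2_norm_convolution: "L2_norm lborel (convolution k v) \<le> (LINT t|lborel. cmod (k t)) * L2_norm lborel v"
proof -
  let ?C = "(LINT t|lborel. cmod (k t)) * L2_norm lborel v"
  have le: "ennreal ((cmod (convolution k v t))\<^sup>2) \<le> (\<integral>\<^sup>+r. ennreal (cmod (k (t - r)) * cmod (v r)) \<partial>lborel)\<^sup>2" for t
  proof (cases "integrable lborel (\<lambda>r. k (t - r) * v r)")
    case True
    have "ennreal (cmod (convolution k v t)) \<le> (\<integral>\<^sup>+r. ennreal (cmod (k (t - r)) * cmod (v r)) \<partial>lborel)"
      using integral_norm_bound_ennreal[OF True] by (simp add: convolution_def norm_mult)
    then have "ennreal (cmod (convolution k v t)) ^ 2 \<le> (\<integral>\<^sup>+r. ennreal (cmod (k (t - r)) * cmod (v r)) \<partial>lborel)\<^sup>2"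
      by (rule power_mono) simp
    then show ?thesis by (simp add: ennreal_power)
  qed (simp add: convolution_def not_integrable_integral_eq)
  have *: "(\<integral>\<^sup>+t. ennreal ((cmod (convolution k v t))\<^sup>2) \<partial>lborel) \<le> ennreal (?C\<^sup>2)"
    by (rule order_trans[OF nn_integral_mono Young_norm_nn_integral]) (rule le)
  then have i: "integrable lborel (\<lambda>t. (cmod (convolution k v t))\<^sup>2)"
    by (intro integrableI_bounded) (auto intro: le_less_trans)
  then show "convolution k v \<in> L2 lborel"
    by (simp add: L2_def)
  have "(L2_norm lborel (convolution k v))\<^sup>2 \<le> ?C\<^sup>2"
    using * nn_integral_eq_integral[OF i] by (simp add: L2_norm_power2)
  then show "L2_norm lborel (convolution k v) \<le> ?C"
    by (rule power2_le_imp_le) simp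
qed

end

lemma convolution_scale: "convolution k (\<lambda>x. c * v x) = (\<lambda>t. c * convolution k v t)"
  by (simp add: convolution_def fun_eq_iff mult.left_commute)

lemma convolution_diff:
  assumes k: "integrable lborel k" and v: "v \<in> L2 lborel" and w: "w \<in> L2 lborel"
  shows "AE t in lborel. convolution k (\<lambda>x. v x - w x) t = convolution k v t - convolution k w t"
  using AE_integrable_convolution[OF k v] AE_integrable_convolution[OF k w]
  by eventually_elim (simp add: convolution_def right_diff_distrib)

lemma convolution_cong_AE:
  assumes "AE x in lborel. v x = w x" "v \<in> borel_measurable borel" "w \<in> borel_measurable borel"
    "k \<in> borel_measurable borel"
  shows "convolution k v = convolution k w"
proof
  fix t
  note [measurable] = assms(2-4)
  show "convolution k v t = convolution k w t"
    unfolding convolution_def by (intro integral_cong_AE) (use assms(1) in auto)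
qed

text \<open>
  Interchanging the integrals moves the convolution to the other factor.  Young's inequality for
  the absolute values, paired with \<open>w\<close>, provides the integrability that Fubini's theorem requires.
\<close>

lemma convolution_adjoint:
  assumes k: "integrable lborel k" and v: "v \<in> L2 lborel" and w: "w \<in> L2 lborel"
  shows "L2_inner lborel (convolution k v) w = L2_inner lborel v (convolution (\<lambda>t. cnj (k (- t))) w)"
proof -
  have [measurable]: "k \<in> borel_measurable borel" "v \<in> borel_measurable borel" "w \<in> borel_measurable borel"
    using borel_measurable_integrable[OF k] L2_measurable[OF v] L2_measurable[OF w] by simp_all
  let ?F = "\<lambda>(t, r). k (t - r) * v r * cnj (w t)"
  let ?N = "\<lambda>t. \<integral>\<^sup>+r. ennreal (cmod (k (t - r)) * cmod (v r)) \<partial>lborel"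
  have "(\<integral>\<^sup>+t. ?N t * ennreal (cmod (w t)) \<partial>lborel)\<^sup>2
      \<le> (\<integral>\<^sup>+t. (?N t)\<^sup>2 \<partial>lborel) * (\<integral>\<^sup>+t. ennreal (cmod (w t)) ^ 2 \<partial>lborel)"
    by (rule Cauchy_Schwarz_nn_integral) auto
  also have "\<dots> \<le> ennreal (((LINT t|lborel. cmod (k t)) * L2_norm lborel v)\<^sup>2) * ennreal ((L2_norm lborel w)\<^sup>2)"
    unfolding L2_norm_power2[of _ w]
    using nn_integral_eq_integral[OF L2_integrable_sq[OF w]]
    by (intro mult_mono Young_norm_nn_integral k v) (simp_all add: ennreal_power)
  also have "\<dots> < \<infinity>"
    by (simp add: ennreal_mult_less_top)
  finally have fin: "(\<integral>\<^sup>+t. ?N t * ennreal (cmod (w t)) \<partial>lborel) < \<infinity>"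
    by (simp add: power_less_top_ennreal)
  have F: "integrable (lborel \<Otimes>\<^sub>M lborel) ?F"
  proof (rule integrableI_bounded)
    have "(\<integral>\<^sup>+x. norm (?F x) \<partial>(lborel \<Otimes>\<^sub>M lborel)) = (\<integral>\<^sup>+t. \<integral>\<^sup>+r. norm (?F (t, r)) \<partial>lborel \<partial>lborel)"
      by (rule lborel.nn_integral_fst[symmetric]) measurable
    also have "\<dots> = (\<integral>\<^sup>+t. ?N t * ennreal (cmod (w t)) \<partial>lborel)"
      by (intro nn_integral_cong, subst nn_integral_multc[symmetric]) (auto simp: norm_mult ennreal_mult)
    finally show "(\<integral>\<^sup>+x. norm (?F x) \<partial>(lborel \<Otimes>\<^sub>M lborel)) < \<infinity>"
      using fin by simp
  qed measurable
  have "L2_inner lborel (convolution k v) w = (LINT t|lborel. LINT r|lborel. ?F (t, r))"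
    by (simp add: L2_inner_def convolution_def)
  also have "\<dots> = (LINT r|lborel. LINT t|lborel. ?F (t, r))"
    using lborel_pair.Fubini_integral[of "\<lambda>t r. ?F (t, r)"] F by (simp add: case_prod_beta')
  also have "\<dots> = L2_inner lborel v (convolution (\<lambda>t. cnj (k (- t))) w)"
  proof -
    have "(LINT t|lborel. ?F (t, r)) = v r * cnj (LINT t|lborel. cnj (k (- (r - t))) * w t)" for r
    proof -
      have "cnj (LINT t|lborel. cnj (k (- (r - t))) * w t) = (LINT t|lborel. cnj (cnj (k (- (r - t))) * w t))"
        by (rule Bochner_Integration.integral_cnj[symmetric])
      also have "v r * \<dots> = (LINT t|lborel. v r * (k (t - r) * cnj (w t)))"
        by simp
      finally have e: "v r * cnj (LINT t|lborel. cnj (k (- (r - t))) * w t) = (LINT t|lborel. v r * (k (t - r) * cnj (w t)))" .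
      show ?thesis unfolding e by (simp add: mult_ac)
    qed
    then show ?thesis by (simp add: L2_inner_def convolution_def)
  qed
  finally show ?thesis .
qed

lemma integrable_convolution_pair:
  assumes k: "integrable lborel k" and v: "integrable lborel v"
  shows "integrable (lborel \<Otimes>\<^sub>M lborel) (\<lambda>(t::real, r). (k (t - r) :: complex) * v r)"
proof (rule integrableI_bounded)
  have [measurable]: "k \<in> borel_measurable borel" "v \<in> borel_measurable borel"
    using borel_measurable_integrable[OF k] borel_measurable_integrable[OF v] by simp_all
  show "(\<lambda>(t::real, r). k (t - r) * v r) \<in> borel_measurable (lborel \<Otimes>\<^sub>M lborel)" by measurable
  have "(\<integral>\<^sup>+x. norm (case x of (t, r) \<Rightarrow> k (t - r) * v r) \<partial>(lborel \<Otimes>\<^sub>M lborel))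
      = (\<integral>\<^sup>+r. \<integral>\<^sup>+t. ennreal (cmod (k (t - r))) * ennreal (cmod (v r)) \<partial>lborel \<partial>lborel)"
    by (subst lborel_pair.nn_integral_snd[symmetric]) (auto simp: norm_mult ennreal_mult)
  also have "\<dots> = (\<integral>\<^sup>+r. (\<integral>\<^sup>+t. ennreal (cmod (k t)) \<partial>lborel) * ennreal (cmod (v r)) \<partial>lborel)"
    by (intro nn_integral_cong, subst nn_integral_multc)
       (auto simp: nn_integral_reflect_shift(2)[of "\<lambda>x. ennreal (cmod (k x))"])
  also have "\<dots> = (\<integral>\<^sup>+t. ennreal (cmod (k t)) \<partial>lborel) * (\<integral>\<^sup>+r. ennreal (cmod (v r)) \<partial>lborel)"
    by (rule nn_integral_cmult) measurable
  also have "\<dots> < \<infinity>"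
    using k v unfolding integrable_iff_bounded by (simp add: ennreal_mult_less_top)
  finally show "(\<integral>\<^sup>+x. norm (case x of (t, r) \<Rightarrow> k (t - r) * v r) \<partial>(lborel \<Otimes>\<^sub>M lborel)) < \<infinity>" .
qed

lemma integrable_convolution:
  assumes k: "integrable lborel k" and v: "integrable lborel v"
  shows "integrable lborel (convolution k v)"
  using lborel_pair.integrable_fst'[OF integrable_convolution_pair[OF assms]]
  by (simp add: convolution_def[abs_def])

text \<open>
  The factor \<open>(2\<pi>)\<^sup>1\<^sup>/\<^sup>2\<close> comes from the unitary normalization of the Fourier transform.
\<close>

lemma fourier_convolution:
  assumes k: "integrable lborel k" and v: "integrable lborel v"
  shows "fourier (convolution k v) \<xi> = of_real (sqrt (2 * pi)) * fourier k \<xi> * fourier v \<xi>"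
proof -
  let ?E = "\<lambda>t. exp (- \<i> * of_real (\<xi> * t))"
  have [measurable]: "k \<in> borel_measurable borel" "v \<in> borel_measurable borel"
    using borel_measurable_integrable[OF k] borel_measurable_integrable[OF v] by simp_all
  have F: "integrable (lborel \<Otimes>\<^sub>M lborel) (\<lambda>(t, r). ?E t * (k (t - r) * v r))"
    by (rule Bochner_Integration.integrable_bound[OF integrable_convolution_pair[OF assms]])
       (auto simp: norm_mult)
  have inner: "(LINT t|lborel. ?E t * k (t - r)) = ?E r * (LINT t|lborel. ?E t * k t)" for r
  proof -
    have "(LINT t|lborel. ?E t * k (t - r)) = (LINT t|lborel. ?E (r + t) * k t)"
      by (subst lborel_integral_real_affine[of 1 _ r]) auto
    also have "(\<lambda>t. ?E (r + t) * k t) = (\<lambda>t. ?E r * (?E t * k t))"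
    proof
      fix t
      have "?E (r + t) = ?E r * ?E t"
        unfolding exp_add[symmetric] by (simp add: distrib_left)
      then show "?E (r + t) * k t = ?E r * (?E t * k t)" by simp
    qed
    finally show ?thesis by simp
  qed
  have "(LINT t|lborel. ?E t * convolution k v t) = (LINT t|lborel. LINT r|lborel. ?E t * (k (t - r) * v r))"
    by (simp add: convolution_def)
  also have "\<dots> = (LINT r|lborel. LINT t|lborel. ?E t * (k (t - r) * v r))"
    using lborel_pair.Fubini_integral[OF F] by simp
  also have "\<dots> = (LINT r|lborel. (LINT t|lborel. ?E t * k (t - r)) * v r)"
    by (simp flip: mult.assoc)
  also have "\<dots> = (LINT r|lborel. (LINT t|lborel. ?E t * k t) * (?E r * v r))"
    unfolding inner by (intro Bochner_Integration.integral_cong refl) (simp only: mult_ac)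
  also have "\<dots> = (LINT t|lborel. ?E t * k t) * (LINT r|lborel. ?E r * v r)"
    by (rule integral_mult_right_zero)
  finally show ?thesis
    by (simp add: fourier_def field_simps flip: of_real_mult)
qed

section \<open>The Fourier transform on \<open>L\<^sup>1\<close>\<close>

abbreviation wave :: "real \<Rightarrow> real \<Rightarrow> complex" where
  "wave \<xi> t \<equiv> exp (- \<i> * of_real (\<xi> * t))"

lemma borel_measurable_fourier [measurable]:
  assumes [measurable]: "v \<in> borel_measurable borel"
  shows "fourier v \<in> borel_measurable borel"
  unfolding fourier_def[abs_def] by measurable

lemma integrable_wave:
  assumes v: "integrable lborel v"
  shows "integrable lborel (\<lambda>t. wave \<xi> t * v t)"
  using borel_measurable_integrable[OF v]
  by (intro Bochner_Integration.integrable_bound[OF v]) (auto simp: norm_mult)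

lemma fourier_diff:
  assumes "integrable lborel v" "integrable lborel w"
  shows "fourier (\<lambda>x. v x - w x) \<xi> = fourier v \<xi> - fourier w \<xi>"
  using assms[THEN integrable_wave] by (simp add: fourier_def right_diff_distrib diff_divide_distrib)

lemma fourier_add:
  assumes "integrable lborel v" "integrable lborel w"
  shows "fourier (\<lambda>x. v x + w x) \<xi> = fourier v \<xi> + fourier w \<xi>"
  using assms[THEN integrable_wave] by (simp add: fourier_def distrib_left add_divide_distrib)

lemma fourier_cnj_reflect: "fourier (\<lambda>t. cnj (v (- t))) \<xi> = cnj (fourier v \<xi>)"
proof -
  have "(LINT t|lborel. wave \<xi> t * cnj (v (- t))) = (LINT t|lborel. cnj (wave \<xi> (- t) * v (- t)))"
    by (simp add: exp_cnj)
  also have "\<dots> = cnj (LINT t|lborel. wave \<xi> (- t) * v (- t))"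
    by (rule Bochner_Integration.integral_cnj)
  also have "(LINT t|lborel. wave \<xi> (- t) * v (- t)) = (LINT t|lborel. wave \<xi> t * v t)"
    using lborel_integral_real_affine[of "-1" "\<lambda>t. wave \<xi> t * v t" 0] by simp
  finally show ?thesis by (simp add: fourier_def)
qed

lemma fourier_reflect: "fourier (\<lambda>t. v (- t)) \<xi> = fourier v (- \<xi>)"
  using lborel_integral_real_affine[of "-1" "\<lambda>t. wave (- \<xi>) t * v t" 0] by (simp add: fourier_def)

lemma fourier_multiplication:
  assumes a: "integrable lborel a" and b: "integrable lborel b"
  shows "(LINT \<xi>|lborel. fourier a \<xi> * b \<xi>) = (LINT t|lborel. a t * fourier b t)"
proof -
  have [measurable]: "a \<in> borel_measurable borel" "b \<in> borel_measurable borel"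
    using borel_measurable_integrable[OF a] borel_measurable_integrable[OF b] by simp_all
  have F: "integrable (lborel \<Otimes>\<^sub>M lborel) (\<lambda>(\<xi>, t). wave \<xi> t * a t * b \<xi>)"
  proof (rule integrableI_bounded)
    have "(\<integral>\<^sup>+x. norm (case x of (\<xi>, t) \<Rightarrow> wave \<xi> t * a t * b \<xi>) \<partial>(lborel \<Otimes>\<^sub>M lborel))
        = (\<integral>\<^sup>+\<xi>. \<integral>\<^sup>+t. ennreal (cmod (a t)) * ennreal (cmod (b \<xi>)) \<partial>lborel \<partial>lborel)"
      by (subst lborel.nn_integral_fst[symmetric]) (auto simp: norm_mult ennreal_mult)
    also have "\<dots> = (\<integral>\<^sup>+\<xi>. (\<integral>\<^sup>+t. ennreal (cmod (a t)) \<partial>lborel) * ennreal (cmod (b \<xi>)) \<partial>lborel)"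
      by (intro nn_integral_cong nn_integral_multc) measurable
    also have "\<dots> = (\<integral>\<^sup>+t. ennreal (cmod (a t)) \<partial>lborel) * (\<integral>\<^sup>+\<xi>. ennreal (cmod (b \<xi>)) \<partial>lborel)"
      by (rule nn_integral_cmult) measurable
    also have "\<dots> < \<infinity>"
      using a b unfolding integrable_iff_bounded by (simp add: ennreal_mult_less_top)
    finally show "(\<integral>\<^sup>+x. norm (case x of (\<xi>, t) \<Rightarrow> wave \<xi> t * a t * b \<xi>) \<partial>(lborel \<Otimes>\<^sub>M lborel)) < \<infinity>" .
  qed measurable
  let ?s = "of_real (sqrt (2 * pi)) :: complex"
  have "(LINT \<xi>|lborel. fourier a \<xi> * b \<xi>) = (LINT \<xi>|lborel. LINT t|lborel. wave \<xi> t * a t * b \<xi>) / ?s"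
    by (simp add: fourier_def)
  also have "(LINT \<xi>|lborel. LINT t|lborel. wave \<xi> t * a t * b \<xi>) = (LINT t|lborel. LINT \<xi>|lborel. wave \<xi> t * a t * b \<xi>)"
    using lborel_pair.Fubini_integral[OF F] by simp
  also have "(\<lambda>t. LINT \<xi>|lborel. wave \<xi> t * a t * b \<xi>) = (\<lambda>t. a t * (LINT \<xi>|lborel. wave t \<xi> * b \<xi>))"
    by (simp add: mult_ac flip: integral_mult_right_zero)
  finally show ?thesis
    by (simp add: fourier_def)
qed

text \<open>
  The standard Gaussian is a fixed point of the Fourier transform; this is its known
  characteristic function.
\<close>

lemma fourier_std_normal_density:
  "fourier (\<lambda>x. of_real (std_normal_density x)) \<xi> = of_real (std_normal_density \<xi>)"
proof -
  have "char std_normal_distribution (- \<xi>) = (LINT x|lborel. std_normal_density x *\<^sub>R iexp (- \<xi> * x))"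
    unfolding char_def by (subst integral_density) auto
  also have "\<dots> = (LINT x|lborel. wave \<xi> x * of_real (std_normal_density x))"
    by (simp add: scaleR_conv_of_real mult_ac)
  finally have "(LINT x|lborel. wave \<xi> x * of_real (std_normal_density x)) = of_real (exp (- (\<xi>\<^sup>2) / 2))"
    by (simp add: char_std_normal_distribution)
  then show ?thesis
    by (simp add: fourier_def std_normal_density_def)
qed

text \<open>
  Inversion at the origin: integrating \<open>fourier a\<close> against the Gaussian of width \<open>n\<close> is
  the same as averaging \<open>a\<close> against the Gaussian of width \<open>1/n\<close>.
\<close>

lemma Gaussian_regularization:
  assumes a: "integrable lborel a" and B: "\<And>t. cmod (a t) \<le> B"
    and cont: "\<And>h. h \<longlonglongrightarrow> 0 \<Longrightarrow> (\<lambda>n::nat. a (h n)) \<longlonglongrightarrow> a 0"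
  shows "(\<lambda>n. LINT \<xi>|lborel. fourier a \<xi> * of_real (std_normal_density (\<xi> / real (Suc n)))) \<longlonglongrightarrow> a 0"
proof -
  have [measurable]: "a \<in> borel_measurable borel"
    using borel_measurable_integrable[OF a] by simp
  have eq: "(LINT \<xi>|lborel. fourier a \<xi> * of_real (std_normal_density (\<xi> / real (Suc n))))
      = (LINT s|lborel. a (s / real (Suc n)) * of_real (std_normal_density s))" for n
  proof -
    let ?m = "real (Suc n)"
    have int: "integrable lborel (\<lambda>\<xi>. of_real (std_normal_density (\<xi> / ?m)) :: complex)"
    proof (rule integrable_of_real)
      have "integrable lborel (\<lambda>\<xi>. std_normal_density (0 + (1 / ?m) * \<xi>))"
        by (rule lborel_integrable_real_affine) auto
      then show "integrable lborel (\<lambda>\<xi>. std_normal_density (\<xi> / ?m))" by simp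
    qed
    have "fourier (\<lambda>\<xi>. of_real (std_normal_density (\<xi> / ?m))) t = of_real ?m * of_real (std_normal_density (?m * t))" for t
    proof -
      have "(LINT x|lborel. wave t x * of_real (std_normal_density (x / ?m)))
          = ?m *\<^sub>R (LINT x|lborel. wave (?m * t) x * of_real (std_normal_density x))"
        by (subst lborel_integral_real_affine[of ?m _ 0]) (simp_all add: mult_ac del: of_nat_Suc)
      then have "fourier (\<lambda>\<xi>. of_real (std_normal_density (\<xi> / ?m))) t
          = of_real ?m * fourier (\<lambda>x. of_real (std_normal_density x)) (?m * t)"
        by (simp only: fourier_def scaleR_conv_of_real times_divide_eq_right)
      then show ?thesis
        by (simp only: fourier_std_normal_density)
    qed
    then have "(LINT \<xi>|lborel. fourier a \<xi> * of_real (std_normal_density (\<xi> / ?m)))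
        = (LINT t|lborel. a t * (of_real ?m * of_real (std_normal_density (?m * t))))"
      using fourier_multiplication[OF a int] by simp
    also have "\<dots> = (LINT s|lborel. a (s / ?m) * of_real (std_normal_density s))"
      by (subst lborel_integral_real_affine[of "1 / ?m" _ 0])
         (simp_all add: scaleR_conv_of_real mult_ac del: of_nat_Suc flip: integral_mult_right_zero)
    finally show ?thesis .
  qed
  have "(\<lambda>n. LINT s|lborel. a (s / real (Suc n)) * of_real (std_normal_density s))
      \<longlonglongrightarrow> (LINT s|lborel. a 0 * of_real (std_normal_density s))"
  proof (rule integral_dominated_convergence)
    show "integrable lborel (\<lambda>s. B * std_normal_density s)" by simp
    have "(\<lambda>n. a (s / real (Suc n))) \<longlonglongrightarrow> a 0" for s
      by (intro cont LIMSEQ_Suc tendsto_divide_0[OF tendsto_const] filterlim_at_top_imp_at_infinity filterlim_real_sequentially)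
    then show "AE s in lborel. (\<lambda>n. a (s / real (Suc n)) * of_real (std_normal_density s)) \<longlonglongrightarrow> a 0 * of_real (std_normal_density s)"
      by (intro AE_I2 tendsto_mult tendsto_const) auto
    show "AE s in lborel. norm (a (s / real (Suc n)) * of_real (std_normal_density s)) \<le> B * std_normal_density s" for n
      by (intro AE_I2) (auto simp: norm_mult intro!: mult_right_mono B)
  qed measurable
  then show ?thesis
    unfolding eq by (simp add: integral_of_real)
qed

section \<open>Plancherel's identity\<close>

text \<open>
  On an open set \<open>U\<close> the shifted indicator is eventually 1, so the mass that leaves \<open>U\<close> vanishes
  by dominated convergence.  Translation invariance makes the mass that enters equal to it, which
  avoids any statement about the boundary of \<open>U\<close>.
\<close>

lemma continuous_translation_indicator_open:
  fixes U :: "real set"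
  assumes U: "open U" and fin: "emeasure lborel U < \<infinity>" and h: "h \<longlonglongrightarrow> 0"
  shows "(\<lambda>n::nat. LINT x|lborel. \<bar>indicator U (x + h n) - indicator U x :: real\<bar>) \<longlonglongrightarrow> 0"
proof -
  have [measurable]: "U \<in> sets borel" using U by auto
  have i: "integrable lborel (indicator U :: real \<Rightarrow> real)" using fin by (simp add: integrable_indicator_iff)
  have it: "integrable lborel (\<lambda>x. indicator U (x + c) :: real)" for c
    using lborel_integrable_real_affine[OF i, of 1 c] by (simp add: add.commute)
  have ii: "(LINT x|lborel. indicator U (x + c) :: real) = (LINT x|lborel. indicator U x)" for c
    using lborel_integral_real_affine[of 1 "indicator U :: real \<Rightarrow> real" c] by (simp add: add.commute)
  have "(\<lambda>n. LINT x|lborel. max 0 (indicator U x - indicator U (x + h n) :: real)) \<longlonglongrightarrow> (LINT x|(lborel :: real measure). 0::real)"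
  proof (rule integral_dominated_convergence)
    show "integrable lborel (indicator U :: real \<Rightarrow> real)" by (rule i)
    show "AE x in lborel. norm (max 0 (indicator U x - indicator U (x + h n) :: real)) \<le> indicator U x" for n
      by (intro AE_I2) (auto split: split_indicator)
    show "AE x in lborel. (\<lambda>n. max 0 (indicator U x - indicator U (x + h n) :: real)) \<longlonglongrightarrow> 0"
    proof (rule AE_I2)
      fix x
      show "(\<lambda>n. max 0 (indicator U x - indicator U (x + h n) :: real)) \<longlonglongrightarrow> 0"
      proof (cases "x \<in> U")
        case True
        have "(\<lambda>n. x + h n) \<longlonglongrightarrow> x" using tendsto_add[OF tendsto_const h, of x] by simp
        then have "\<forall>\<^sub>F n in sequentially. x + h n \<in> U"
          using U True by (auto simp: tendsto_def)
        then have "\<forall>\<^sub>F n in sequentially. max 0 (indicator U x - indicator U (x + h n) :: real) = 0"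
          by eventually_elim (simp add: True)
        then show ?thesis by (rule tendsto_eventually)
      qed simp
    qed
  qed measurable
  then have "(\<lambda>n. 2 * (LINT x|lborel. max 0 (indicator U x - indicator U (x + h n) :: real))) \<longlonglongrightarrow> 2 * 0"
    by (intro tendsto_mult) auto
  also have "(\<lambda>n. 2 * (LINT x|lborel. max 0 (indicator U x - indicator U (x + h n) :: real)))
      = (\<lambda>n. LINT x|lborel. \<bar>indicator U (x + h n) - indicator U x :: real\<bar>)"
  proof
    fix n
    have "(\<lambda>x. \<bar>indicator U (x + h n) - indicator U x :: real\<bar>)
        = (\<lambda>x. 2 * max 0 (indicator U x - indicator U (x + h n)) - (indicator U x - indicator U (x + h n)))"
      by (auto simp: fun_eq_iff split: split_indicator)
    then show "2 * (LINT x|lborel. max 0 (indicator U x - indicator U (x + h n) :: real))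
        = (LINT x|lborel. \<bar>indicator U (x + h n) - indicator U x :: real\<bar>)"
      using i it[of "h n"] ii[of "h n"] by simp
  qed
  finally show ?thesis by simp
qed

definition translation_modulus :: "(real \<Rightarrow> complex) \<Rightarrow> real \<Rightarrow> real" where
  "translation_modulus v h = (LINT x|lborel. cmod (v (x + h) - v x))"

lemma integrable_translate:
  fixes v :: "real \<Rightarrow> complex"
  shows "integrable lborel v \<Longrightarrow> integrable lborel (\<lambda>x. v (x + h))"
  using lborel_integrable_real_affine[of v 1 h] by (simp add: add.commute)

lemma translation_modulus_approx:
  assumes v: "integrable lborel v" and w: "integrable lborel w"
  shows "translation_modulus v h \<le> 2 * (LINT x|lborel. cmod (v x - w x)) + translation_modulus w h"
proof -
  have d: "integrable lborel (\<lambda>x. v x - w x)" using v w by simp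
  have "translation_modulus v h
      \<le> (LINT x|lborel. cmod (v (x + h) - w (x + h)) + cmod (v x - w x) + cmod (w (x + h) - w x))"
    unfolding translation_modulus_def
  proof (rule integral_mono)
    fix x
    have "cmod (a - b + c) \<le> cmod a + cmod b + cmod c" for a b c :: complex
      using norm_triangle_ineq[of "a - b" c] norm_triangle_ineq4[of a b] by linarith
    from this[of "v (x + h) - w (x + h)" "v x - w x" "w (x + h) - w x"]
    show "cmod (v (x + h) - v x) \<le> cmod (v (x + h) - w (x + h)) + cmod (v x - w x) + cmod (w (x + h) - w x)"
      by (simp add: algebra_simps)
  qed (use v w integrable_translate[OF v] integrable_translate[OF w] in auto)
  also have "\<dots> = (LINT x|lborel. cmod (v (x + h) - w (x + h))) + (LINT x|lborel. cmod (v x - w x)) + translation_modulus w h"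
    unfolding translation_modulus_def
    using v w integrable_translate[OF v, of h] integrable_translate[OF w, of h] by simp
  also have "(LINT x|lborel. cmod (v (x + h) - w (x + h))) = (LINT x|lborel. cmod (v x - w x))"
    using lborel_integral_real_affine[of 1 "\<lambda>x. cmod (v x - w x)" h] by (simp add: add.commute)
  finally show ?thesis by simp
qed

lemma translation_modulus_nonneg: "0 \<le> translation_modulus v h"
  by (simp add: translation_modulus_def)

text \<open>
  Translations are isometries of \<open>L\<^sup>1\<close>, so their continuity need only be known on a dense set.
\<close>

lemma translation_modulus_approximable:
  assumes v: "integrable lborel v"
    and approx: "\<And>e. e > 0 \<Longrightarrow> \<exists>w. integrable lborel w \<and> (LINT x|lborel. cmod (v x - w x)) < e \<and>
        (\<lambda>n. translation_modulus w (h n)) \<longlonglongrightarrow> 0"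
  shows "(\<lambda>n::nat. translation_modulus v (h n)) \<longlonglongrightarrow> 0"
proof (rule LIMSEQ_I)
  fix e :: real assume e: "e > 0"
  obtain w where w: "integrable lborel w" "(LINT x|lborel. cmod (v x - w x)) < e / 3"
      "(\<lambda>n. translation_modulus w (h n)) \<longlonglongrightarrow> 0"
    using approx[of "e / 3"] e by auto
  obtain N where N: "\<And>n. n \<ge> N \<Longrightarrow> translation_modulus w (h n) < e / 3"
    using LIMSEQ_D[OF w(3), of "e / 3"] e by (auto simp: translation_modulus_nonneg)
  have "norm (translation_modulus v (h n) - 0) < e" if "n \<ge> N" for n
    using translation_modulus_approx[OF v w(1), of "h n"] N[OF that] w(2) translation_modulus_nonneg[of v "h n"]
    by simp
  then show "\<exists>N. \<forall>n\<ge>N. norm (translation_modulus v (h n) - 0) < e" by blast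
qed

text \<open>
  Outer regularity of Lebesgue measure reduces the claim to indicators of open sets, where
  it follows by dominated convergence.
\<close>

lemma continuous_translation_L1:
  assumes v: "integrable lborel v" and h: "h \<longlonglongrightarrow> 0"
  shows "(\<lambda>n::nat. translation_modulus v (h n)) \<longlonglongrightarrow> 0"
  using v
proof (induction rule: integrable_induct)
  case (base A c)
  then have [measurable]: "A \<in> sets borel" by simp
  have iA: "integrable lborel (\<lambda>x. indicator A x *\<^sub>R c :: complex)"
    using base by (intro integrable_scaleR_left) (simp add: integrable_indicator_iff)
  show ?case
  proof (rule translation_modulus_approximable[OF iA])
    fix e :: real assume e: "e > 0"
    \<comment> \<open>the added 1 keeps the quotient defined for \<open>c = 0\<close> and makes the final inequality strict\<close>
    define d where "d = e / (cmod c + 1)"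
    have d: "d > 0" using e by (simp add: d_def add_nonneg_pos)
    obtain U where U: "open U" "A \<subseteq> U" "emeasure lborel (U - A) < ennreal d"
      using outer_regular_lborel[of A d] d by auto
    have [measurable]: "U \<in> sets borel" using U(1) by auto
    have finD: "emeasure lborel (U - A) < \<infinity>" using U(3) by (auto intro: less_trans)
    have "emeasure lborel U \<le> emeasure lborel A + emeasure lborel (U - A)"
      using emeasure_subadditive[of A lborel "U - A"] U(2) by (simp add: Un_absorb1)
    also have "\<dots> < \<infinity>" using base(2) finD by simp
    finally have finU: "emeasure lborel U < \<infinity>" .
    define w where "w = (\<lambda>x. indicator U x *\<^sub>R c :: complex)"
    have w: "integrable lborel w" unfolding w_def
      using finU by (intro integrable_scaleR_left) (simp add: integrable_indicator_iff)
    have "(\<lambda>x. cmod (indicator A x *\<^sub>R c - w x)) = (\<lambda>x. indicator (U - A) x * cmod c)"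
      using U(2) by (auto simp: w_def fun_eq_iff split: split_indicator)
    then have "(LINT x|lborel. cmod (indicator A x *\<^sub>R c - w x)) = measure lborel (U - A) * cmod c"
      by simp
    also have "\<dots> \<le> d * cmod c"
      using U(3) d finD by (intro mult_right_mono) (auto simp: measure_def enn2real_leI less_imp_le)
    also have "\<dots> < e"
    proof -
      have "d * cmod c < d * (cmod c + 1)" using d by (intro mult_strict_left_mono) auto
      also have "\<dots> = e" unfolding d_def using norm_ge_zero[of c] by (simp add: add_nonneg_eq_0_iff)
      finally show ?thesis .
    qed
    finally have close: "(LINT x|lborel. cmod (indicator A x *\<^sub>R c - w x)) < e" .
    have "translation_modulus w (h n) = (LINT x|lborel. \<bar>indicator U (x + h n) - indicator U x :: real\<bar>) * cmod c" for n
      unfolding translation_modulus_def w_def by (simp flip: scaleR_left_diff_distrib)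
    then have "(\<lambda>n. translation_modulus w (h n)) \<longlonglongrightarrow> 0"
      using tendsto_mult[OF continuous_translation_indicator_open[OF U(1) finU h] tendsto_const[of "cmod c"]] by simp
    then show "\<exists>w. integrable lborel w \<and> (LINT x|lborel. cmod (indicator A x *\<^sub>R c - w x)) < e \<and>
        (\<lambda>n. translation_modulus w (h n)) \<longlonglongrightarrow> 0"
      using w close by blast
  qed
next
  case (add f g)
  have le: "translation_modulus (\<lambda>x. f x + g x) (h n) \<le> translation_modulus f (h n) + translation_modulus g (h n)" for n
  proof -
    note t = integrable_translate[OF add(1), of "h n"] integrable_translate[OF add(2), of "h n"]
    have "translation_modulus (\<lambda>x. f x + g x) (h n)
        \<le> (LINT x|lborel. cmod (f (x + h n) - f x) + cmod (g (x + h n) - g x))"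
      unfolding translation_modulus_def
      by (rule integral_mono) (use add t in \<open>auto simp: add_diff_add intro: norm_triangle_ineq\<close>)
    then show ?thesis
      unfolding translation_modulus_def using add t by simp
  qed
  show ?case
    by (rule Lim_null_comparison[OF _ tendsto_add_zero[OF add(3,4)]])
       (use le in \<open>auto simp: translation_modulus_nonneg\<close>)
next
  case (lim f s)
  note [measurable] = borel_measurable_integrable[OF lim(4)] borel_measurable_integrable[OF lim(1)]
  have "(\<lambda>i. LINT x|lborel. cmod (f x - s i x)) \<longlonglongrightarrow> (LINT x|(lborel::real measure). 0::real)"
  proof (rule integral_dominated_convergence)
    show "integrable lborel (\<lambda>x. 3 * cmod (f x))" using lim(4) by simp
    have "(\<lambda>i. cmod (f x - s i x)) \<longlonglongrightarrow> cmod (f x - f x)" for x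
      by (intro tendsto_intros lim(2)) simp
    then show "AE x in lborel. (\<lambda>i. cmod (f x - s i x)) \<longlonglongrightarrow> 0" by simp
    have "cmod (f x - s i x) \<le> 3 * cmod (f x)" for i x
      using norm_triangle_ineq4[of "f x" "s i x"] lim(3)[of x i] by simp
    then show "AE x in lborel. norm (cmod (f x - s i x)) \<le> 3 * cmod (f x)" for i by simp
  qed measurable
  then have L: "(\<lambda>i. LINT x|lborel. cmod (f x - s i x)) \<longlonglongrightarrow> 0" by simp
  show ?case
  proof (rule translation_modulus_approximable[OF lim(4)])
    fix e :: real assume "e > 0"
    then obtain i where "(LINT x|lborel. cmod (f x - s i x)) < e"
      using order_tendstoD(2)[OF L, of e] by (auto simp: eventually_sequentially)
    then show "\<exists>w. integrable lborel w \<and> (LINT x|lborel. cmod (f x - w x)) < e \<and>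
        (\<lambda>n. translation_modulus w (h n)) \<longlonglongrightarrow> 0"
      using lim(1,5) by blast
  qed
qed

text \<open>
  The autocorrelation \<open>a\<close> of \<open>v\<close> has the nonnegative transform \<open>(2\<pi>)\<^sup>1\<^sup>/\<^sup>2 |fourier v|\<^sup>2\<close> and the value
  \<open>\<parallel>v\<parallel>\<^sup>2\<close> at 0.  Boundedness of \<open>v\<close> makes \<open>a\<close> bounded and, by continuity of translations in \<open>L\<^sup>1\<close>,
  continuous at 0, so \<open>Gaussian_regularization\<close> applies; the Gaussian factors increase to a constant
  and monotone convergence removes them.
\<close>

lemma Plancherel_bounded:
  assumes v: "integrable lborel v" and M: "\<And>x. cmod (v x) \<le> M"
  shows "fourier v \<in> L2 lborel" and "L2_norm lborel (fourier v) = L2_norm lborel v"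
proof -
  have [measurable]: "v \<in> borel_measurable borel" using borel_measurable_integrable[OF v] by simp
  define u where "u = (\<lambda>t. cnj (v (- t)))"
  have [measurable]: "u \<in> borel_measurable borel" unfolding u_def by measurable
  have u: "integrable lborel u"
    unfolding u_def using lborel_integrable_real_affine[OF v, of "-1" 0] by (simp add: integrable_cnj)
  define a where "a = convolution v u"
  have a: "integrable lborel a" unfolding a_def by (rule integrable_convolution[OF v u])
  have a_fourier: "fourier a \<xi> = of_real (sqrt (2 * pi) * (cmod (fourier v \<xi>))\<^sup>2)" for \<xi>
    unfolding a_def fourier_convolution[OF v u] unfolding u_def fourier_cnj_reflect
    by (simp only: of_real_mult complex_norm_square mult.assoc)
  have int: "integrable lborel (\<lambda>r. v (t - r) * u r)" for t
    using M by (intro Bochner_Integration.integrable_bound[OF integrable_mult_right[OF u, of "of_real M"]])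
       (auto simp: norm_mult intro!: mult_right_mono order_trans[OF M])
  have M0: "M \<ge> 0" using order_trans[OF norm_ge_zero M] .
  have bound: "cmod (a t) \<le> M * (LINT r|lborel. cmod (u r))" for t
  proof -
    have "cmod (a t) \<le> (LINT r|lborel. cmod (v (t - r) * u r))"
      unfolding a_def convolution_def by (rule integral_norm_bound)
    also have "\<dots> \<le> (LINT r|lborel. M * cmod (u r))"
      using u by (intro integral_mono integrable_norm[OF int]) (auto simp: norm_mult intro!: mult_right_mono M)
    finally show ?thesis by simp
  qed
  have a0: "a 0 = of_real ((L2_norm lborel v)\<^sup>2)"
  proof -
    have "a 0 = (LINT r|lborel. of_real ((cmod (v (- r)))\<^sup>2))"
      unfolding a_def convolution_def u_def by (simp only: complex_norm_square diff_0)
    also have "\<dots> = of_real (LINT r|lborel. (cmod (v (- r)))\<^sup>2)"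
    proof (rule integral_of_real)
      have "integrable lborel (\<lambda>r. (cmod (v r))\<^sup>2)"
        by (rule Bochner_Integration.integrable_bound[OF integrable_mult_right[OF v, of "of_real M"]])
           (auto simp: norm_mult power2_eq_square M0 intro!: mult_right_mono M)
      from lborel_integrable_real_affine[OF this, of "-1" 0]
      show "integrable lborel (\<lambda>r. (cmod (v (- r)))\<^sup>2)" by simp
    qed
    also have "(LINT r|lborel. (cmod (v (- r)))\<^sup>2) = (LINT r|lborel. (cmod (v r))\<^sup>2)"
      using lborel_integral_real_affine[of "-1" "\<lambda>r. (cmod (v r))\<^sup>2" 0] by simp
    finally show ?thesis by (simp only: L2_norm_power2)
  qed
  have cont: "(\<lambda>n. a (h n)) \<longlonglongrightarrow> a 0" if h: "h \<longlonglongrightarrow> 0" for h :: "nat \<Rightarrow> real"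
  proof -
    have le: "norm (a (h n) - a 0) \<le> M * translation_modulus v (h n)" for n
    proof -
      have i0: "integrable lborel (\<lambda>r. v (h n - r) * u r - v (0 - r) * u r)"
        by (intro Bochner_Integration.integrable_diff int)
      have "a (h n) - a 0 = (LINT r|lborel. v (h n - r) * u r - v (0 - r) * u r)"
        unfolding a_def convolution_def by (intro Bochner_Integration.integral_diff[symmetric] int)
      also have "cmod \<dots> \<le> (LINT r|lborel. cmod (v (h n - r) * u r - v (0 - r) * u r))"
        by (rule integral_norm_bound)
      also have "\<dots> \<le> (LINT r|lborel. M * cmod (v (- r + h n) - v (- r)))"
      proof (rule integral_mono)
        show "integrable lborel (\<lambda>r. M * cmod (v (- r + h n) - v (- r)))"
          using lborel_integrable_real_affine[OF v, of "-1" "h n"] lborel_integrable_real_affine[OF v, of "-1" 0]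
          by (auto simp: algebra_simps)
        fix r
        have "cmod (v (h n - r) * u r - v (0 - r) * u r) = cmod (u r) * cmod (v (- r + h n) - v (- r))"
          by (simp flip: left_diff_distrib add: norm_mult)
        also have "\<dots> \<le> M * cmod (v (- r + h n) - v (- r))"
          by (intro mult_right_mono) (auto simp: u_def M)
        finally show "cmod (v (h n - r) * u r - v (0 - r) * u r) \<le> M * cmod (v (- r + h n) - v (- r))" .
      qed (use i0 in auto)
      also have "\<dots> = M * translation_modulus v (h n)"
        unfolding translation_modulus_def
        using lborel_integral_real_affine[of "-1" "\<lambda>x. cmod (v (x + h n) - v x)" 0] by simp
      finally show ?thesis .
    qed
    have "(\<lambda>n. M * translation_modulus v (h n)) \<longlonglongrightarrow> 0"
      using continuous_translation_L1[OF v h] tendsto_mult_right_zero by blast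
    then have "(\<lambda>n. a (h n) - a 0) \<longlonglongrightarrow> 0"
      by (rule Lim_null_comparison[rotated]) (use le in auto)
    then show ?thesis by (simp add: LIM_zero_iff)
  qed
  define F where "F = (\<lambda>(n::nat) \<xi>. (cmod (fourier v \<xi>))\<^sup>2 * exp (- (\<xi> / real (Suc n))\<^sup>2 / 2))"
  have FG: "complex_of_real (F n \<xi>) = fourier a \<xi> * of_real (std_normal_density (\<xi> / real (Suc n)))" for n \<xi>
  proof -
    have "F n \<xi> = (sqrt (2 * pi) * (cmod (fourier v \<xi>))\<^sup>2) * std_normal_density (\<xi> / real (Suc n))"
      by (simp add: F_def std_normal_density_def)
    then show ?thesis by (simp only: a_fourier of_real_mult)
  qed
  have intF: "integrable lborel (F n)" for n
  proof -
    let ?B = "(LINT x|lborel. cmod (a x)) / sqrt (2 * pi)"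
    have B: "cmod (fourier a \<xi>) \<le> ?B" for \<xi>
    proof -
      have "cmod (LINT t|lborel. wave \<xi> t * a t) \<le> (LINT t|lborel. cmod (wave \<xi> t * a t))"
        by (rule integral_norm_bound)
      then show ?thesis by (simp add: fourier_def norm_mult norm_divide divide_right_mono)
    qed
    have "integrable lborel (\<lambda>\<xi>. std_normal_density (0 + (1 / real (Suc n)) * \<xi>))"
      by (rule lborel_integrable_real_affine) auto
    then have "integrable lborel (\<lambda>\<xi>. ?B * std_normal_density (\<xi> / real (Suc n)))" by simp
    then have "integrable lborel (\<lambda>\<xi>. complex_of_real (F n \<xi>))"
    proof (rule Bochner_Integration.integrable_bound)
      show "AE \<xi> in lborel. norm (complex_of_real (F n \<xi>)) \<le> norm (?B * std_normal_density (\<xi> / real (Suc n)))"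
      proof (rule AE_I2)
        fix \<xi>
        have "norm (complex_of_real (F n \<xi>)) = cmod (fourier a \<xi>) * std_normal_density (\<xi> / real (Suc n))"
          unfolding FG by (simp add: norm_mult)
        also have "\<dots> \<le> ?B * std_normal_density (\<xi> / real (Suc n))"
          by (intro mult_right_mono B) auto
        finally show "norm (complex_of_real (F n \<xi>)) \<le> norm (?B * std_normal_density (\<xi> / real (Suc n)))"
          by (metis abs_ge_self order_trans real_norm_def)
      qed
    qed (simp add: F_def)
    from integrable_Re[OF this] show ?thesis by simp
  qed
  have "(\<lambda>n. LINT \<xi>|lborel. complex_of_real (F n \<xi>)) \<longlonglongrightarrow> of_real ((L2_norm lborel v)\<^sup>2)"
    using Gaussian_regularization[OF a bound cont] unfolding FG a0 .
  then have lim: "(\<lambda>n. LINT \<xi>|lborel. F n \<xi>) \<longlonglongrightarrow> (L2_norm lborel v)\<^sup>2"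
    unfolding integral_of_real[OF intF] tendsto_of_real_iff .
  have mono: "AE \<xi> in lborel. mono (\<lambda>n. F n \<xi>)"
  proof (intro AE_I2 monoI)
    fix \<xi> :: real and m n :: nat assume "m \<le> n"
    then have "\<xi>\<^sup>2 / (real (Suc n))\<^sup>2 \<le> \<xi>\<^sup>2 / (real (Suc m))\<^sup>2"
      by (intro divide_left_mono power_mono) auto
    then show "F m \<xi> \<le> F n \<xi>"
      unfolding F_def by (intro mult_left_mono) (auto simp: power_divide simp del: of_nat_Suc)
  qed
  have ptw: "AE \<xi> in lborel. (\<lambda>n. F n \<xi>) \<longlonglongrightarrow> (cmod (fourier v \<xi>))\<^sup>2"
  proof (rule AE_I2)
    fix \<xi>
    have "(\<lambda>n. \<xi> / real (Suc n)) \<longlonglongrightarrow> 0"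
      by (intro LIMSEQ_Suc tendsto_divide_0[OF tendsto_const] filterlim_at_top_imp_at_infinity filterlim_real_sequentially)
    then have "(\<lambda>n. (cmod (fourier v \<xi>))\<^sup>2 * exp (- (\<xi> / real (Suc n))\<^sup>2 / 2)) \<longlonglongrightarrow> (cmod (fourier v \<xi>))\<^sup>2 * exp (- 0\<^sup>2 / 2)"
      by (intro tendsto_intros) auto
    then show "(\<lambda>n. F n \<xi>) \<longlonglongrightarrow> (cmod (fourier v \<xi>))\<^sup>2" by (simp add: F_def)
  qed
  have meas: "(\<lambda>\<xi>. (cmod (fourier v \<xi>))\<^sup>2) \<in> borel_measurable lborel" by measurable
  note mc = integrable_monotone_convergence[OF intF mono ptw lim meas]
    integral_monotone_convergence[OF intF mono ptw lim meas]
  show "fourier v \<in> L2 lborel"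
    using mc(1) by (simp add: L2_def)
  show "L2_norm lborel (fourier v) = L2_norm lborel v"
    using mc(2) by (simp add: L2_norm_def)
qed

text \<open>
  Unbounded functions are approximated by their truncations in height; Fatou's lemma
  transfers the bound \<open>\<parallel>fourier v\<parallel> \<le> \<parallel>v\<parallel>\<close>, which then applies to the truncation error as well.
\<close>

theorem Plancherel:
  assumes v: "integrable lborel v" and v2: "v \<in> L2 lborel"
  shows "fourier v \<in> L2 lborel" and "L2_norm lborel (fourier v) = L2_norm lborel v"
proof -
  define V where "V = (\<lambda>w (n::nat) (x::real). if cmod (w x) \<le> real n then w x else (0::complex))"
  have V_meas: "V w n \<in> borel_measurable borel" if [measurable]: "w \<in> borel_measurable borel" for w :: "real \<Rightarrow> complex" and n
    unfolding V_def by measurable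
  have V_le: "cmod (V w n x) \<le> cmod (w x)" "cmod (V w n x) \<le> real n" for w :: "real \<Rightarrow> complex" and n x
    by (auto simp: V_def)
  have V_ev: "\<forall>\<^sub>F n in sequentially. V w n x = w x" for w :: "real \<Rightarrow> complex" and x
    using eventually_ge_at_top[of "nat \<lceil>cmod (w x)\<rceil>"]
  proof eventually_elim
    case (elim n)
    then have "cmod (w x) \<le> real n" by linarith
    then show ?case by (simp add: V_def)
  qed
  have V_int: "integrable lborel (V w n)" if w: "integrable lborel w" for w n
    using V_le V_meas[OF borel_measurable_integrable[OF w, simplified]]
    by (intro Bochner_Integration.integrable_bound[OF w]) auto
  have bound: "fourier w \<in> L2 lborel" "L2_norm lborel (fourier w) \<le> L2_norm lborel w"
    if w: "integrable lborel w" and w2: "w \<in> L2 lborel" for w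
  proof -
    have [measurable]: "w \<in> borel_measurable borel" using borel_measurable_integrable[OF w] by simp
    note [measurable] = V_meas[OF this]
    have "(\<lambda>n. LINT x|lborel. wave \<xi> x * V w n x) \<longlonglongrightarrow> (LINT x|lborel. wave \<xi> x * w x)" for \<xi>
    proof (rule integral_dominated_convergence)
      show "integrable lborel (\<lambda>x. cmod (w x))" using w by simp
      show "AE x in lborel. (\<lambda>n. wave \<xi> x * V w n x) \<longlonglongrightarrow> wave \<xi> x * w x"
        by (intro AE_I2 tendsto_mult tendsto_const tendsto_eventually V_ev)
      show "AE x in lborel. norm (wave \<xi> x * V w n x) \<le> cmod (w x)" for n
        using V_le by (simp add: norm_mult)
    qed measurable
    then have "(\<lambda>n. fourier (V w n) \<xi>) \<longlonglongrightarrow> fourier w \<xi>" for \<xi>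
      unfolding fourier_def by (intro tendsto_divide tendsto_const) auto
    then have "(\<lambda>n. ennreal ((cmod (fourier (V w n) \<xi>))\<^sup>2)) \<longlonglongrightarrow> ennreal ((cmod (fourier w \<xi>))\<^sup>2)" for \<xi>
      by (intro tendsto_ennrealI tendsto_intros)
    then have "(\<integral>\<^sup>+\<xi>. ennreal ((cmod (fourier w \<xi>))\<^sup>2) \<partial>lborel)
        = (\<integral>\<^sup>+\<xi>. liminf (\<lambda>n. ennreal ((cmod (fourier (V w n) \<xi>))\<^sup>2)) \<partial>lborel)"
      by (intro nn_integral_cong lim_imp_Liminf[symmetric]) auto
    also have "\<dots> \<le> liminf (\<lambda>n. \<integral>\<^sup>+\<xi>. ennreal ((cmod (fourier (V w n) \<xi>))\<^sup>2) \<partial>lborel)"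
      by (intro nn_integral_liminf) measurable
    also have "\<dots> \<le> ennreal ((L2_norm lborel w)\<^sup>2)"
    proof (rule Liminf_le[OF _ always_eventually[OF allI]])
      fix n
      have "L2_norm lborel (fourier (V w n)) \<le> L2_norm lborel w"
        unfolding Plancherel_bounded(2)[OF V_int[OF w] V_le(2)]
        using V_le by (intro L2_dominated1(2)[OF w2]) auto
      then show "(\<integral>\<^sup>+\<xi>. ennreal ((cmod (fourier (V w n) \<xi>))\<^sup>2) \<partial>lborel) \<le> ennreal ((L2_norm lborel w)\<^sup>2)"
        unfolding L2_norm_eq_nn_integral[OF Plancherel_bounded(1)[OF V_int[OF w] V_le(2)], symmetric]
        by (intro ennreal_leI power_mono) auto
    qed auto
    finally have le: "(\<integral>\<^sup>+\<xi>. ennreal ((cmod (fourier w \<xi>))\<^sup>2) \<partial>lborel) \<le> ennreal ((L2_norm lborel w)\<^sup>2)" .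
    show "fourier w \<in> L2 lborel" "L2_norm lborel (fourier w) \<le> L2_norm lborel w"
      by (rule L2_norm_le_nn_integral[OF _ le]; simp)+
  qed
  have [measurable]: "v \<in> borel_measurable borel" using borel_measurable_integrable[OF v] by simp
  note [measurable] = V_meas[OF this]
  have Vn2: "V v n \<in> L2 lborel" for n
    using V_le by (intro L2_dominated1(1)[OF v2]) auto
  have "(\<lambda>n. LINT x|lborel. (cmod (V v n x - v x))\<^sup>2) \<longlonglongrightarrow> (LINT x|(lborel :: real measure). 0::real)"
  proof (rule integral_dominated_convergence)
    show "integrable lborel (\<lambda>x. (cmod (v x))\<^sup>2)" by (rule L2_integrable_sq[OF v2])
    have "(\<lambda>n. (cmod (V v n x - v x))\<^sup>2) \<longlonglongrightarrow> 0" for x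
      by (rule tendsto_eventually) (use V_ev[of v x] in eventually_elim, simp)
    then show "AE x in lborel. (\<lambda>n. (cmod (V v n x - v x))\<^sup>2) \<longlonglongrightarrow> 0" by simp
    show "AE x in lborel. norm ((cmod (V v n x - v x))\<^sup>2) \<le> (cmod (v x))\<^sup>2" for n
      by (intro AE_I2) (auto simp: V_def)
  qed measurable
  then have V_lim: "(\<lambda>n. L2_norm lborel (\<lambda>x. V v n x - v x)) \<longlonglongrightarrow> 0"
    unfolding L2_norm_def using tendsto_real_sqrt by fastforce
  have "L2_norm lborel (\<lambda>\<xi>. fourier (V v n) \<xi> - fourier v \<xi>) \<le> L2_norm lborel (\<lambda>x. V v n x - v x)" for n
    using bound(2)[OF Bochner_Integration.integrable_diff[OF V_int[OF v, of n] v] L2_diff[OF Vn2[of n] v2]]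
    unfolding fourier_diff[OF V_int[OF v, of n] v, abs_def] .
  then have F_lim: "(\<lambda>n. L2_norm lborel (\<lambda>\<xi>. fourier (V v n) \<xi> - fourier v \<xi>)) \<longlonglongrightarrow> 0"
    by (intro Lim_null_comparison[OF _ V_lim]) auto
  show "fourier v \<in> L2 lborel" by (rule bound(1)[OF v v2])
  have "(\<lambda>n. L2_norm lborel (fourier (V v n))) \<longlonglongrightarrow> L2_norm lborel (fourier v)"
    by (rule L2_norm_tendsto[OF bound(1)[OF V_int[OF v] Vn2] bound(1)[OF v v2] F_lim])
  moreover have "(\<lambda>n. L2_norm lborel (fourier (V v n))) \<longlonglongrightarrow> L2_norm lborel v"
    unfolding Plancherel_bounded(2)[OF V_int[OF v] V_le(2)]
    by (rule L2_norm_tendsto[OF Vn2 v2 V_lim])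
  ultimately show "L2_norm lborel (fourier v) = L2_norm lborel v"
    by (rule LIMSEQ_unique)
qed

section \<open>The half-line in exponential coordinates\<close>

lemma measurable_exp_halfline [measurable]: "exp \<in> measurable borel halfline"
  by (rule measurable_restrict_space2) auto

lemma borel_measurable_halfline_exp:
  "F \<in> borel_measurable halfline \<Longrightarrow> (\<lambda>u. F (exp u)) \<in> borel_measurable borel"
  using measurable_compose[OF measurable_exp_halfline] by blast

text \<open>
  The substitution rule is available on compact intervals; both sides increase to the integrals
  over the full domains.
\<close>

lemma nn_integral_exp_substitution:
  fixes A :: "real set"
  assumes [measurable]: "A \<in> sets borel" and pos: "A \<subseteq> {0<..}"
  shows "emeasure lborel A = (\<integral>\<^sup>+u. ennreal (exp u) * indicator A (exp u) \<partial>lborel)"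
proof -
  let ?f = "indicator A :: real \<Rightarrow> real"
  have eq: "(\<integral>\<^sup>+x. ?f x * indicator {exp (- real n)..exp (real n)} x \<partial>lborel)
      = (\<integral>\<^sup>+u. ?f (exp u) * exp u * indicator {- real n..real n} u \<partial>lborel)" for n
    by (rule nn_integral_substitution)
       (auto intro!: derivative_eq_intros continuous_intros simp: set_borel_measurable_def)
  have "(\<lambda>n. \<integral>\<^sup>+x. ?f x * indicator {exp (- real n)..exp (real n)} x \<partial>lborel) \<longlonglongrightarrow> (\<integral>\<^sup>+x. ?f x \<partial>lborel)"
  proof (rule nn_integral_LIMSEQ)
    show "incseq (\<lambda>n x. ennreal (?f x * indicator {exp (- real n)..exp (real n)} x))"
    proof (rule incseq_SucI, rule le_funI)
      fix n x
      have sub: "{exp (- real n)..exp (real n)} \<subseteq> {exp (- real (Suc n))..exp (real (Suc n))}"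
        by simp
      show "ennreal (?f x * indicator {exp (- real n)..exp (real n)} x) \<le> ennreal (?f x * indicator {exp (- real (Suc n))..exp (real (Suc n))} x)"
      proof (cases "x \<in> {exp (- real n)..exp (real n)}")
        case True
        then show ?thesis
          using subsetD[OF sub True] by (simp only: indicator_simps order_refl)
      next
        case False
        then have "indicator {exp (- real n)..exp (real n)} x = (0 :: real)"
          by (rule indicator_simps(2))
        then show ?thesis by simp
      qed
    qed
    fix x
    show "(\<lambda>n. ennreal (?f x * indicator {exp (- real n)..exp (real n)} x)) \<longlonglongrightarrow> ennreal (?f x)"
    proof (cases "x \<in> A")
      case True
      then have x: "x > 0" using pos by auto
      have "\<forall>\<^sub>F n in sequentially. ennreal (?f x * indicator {exp (- real n)..exp (real n)} x) = ennreal (?f x)"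
        using eventually_ge_at_top[of "nat \<lceil>\<bar>ln x\<bar>\<rceil>"]
      proof eventually_elim
        case (elim n)
        then have "\<bar>ln x\<bar> \<le> real n" by linarith
        then have "- real n \<le> ln x" "ln x \<le> real n" by linarith+
        then have "exp (- real n) \<le> x" "x \<le> exp (real n)"
          using x by (metis exp_le_cancel_iff exp_ln)+
        then show ?case by simp
      qed
      then show ?thesis by (rule tendsto_eventually)
    qed simp
  qed measurable
  moreover have "(\<lambda>n. \<integral>\<^sup>+u. ?f (exp u) * exp u * indicator {- real n..real n} u \<partial>lborel) \<longlonglongrightarrow> (\<integral>\<^sup>+u. ?f (exp u) * exp u \<partial>lborel)"
  proof (rule nn_integral_LIMSEQ)
    show "incseq (\<lambda>n u. ennreal (?f (exp u) * exp u * indicator {- real n..real n} u))"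
      by (rule incseq_SucI, rule le_funI) (auto split: split_indicator)
    fix u
    have "\<forall>\<^sub>F n in sequentially. ennreal (?f (exp u) * exp u * indicator {- real n..real n} u) = ennreal (?f (exp u) * exp u)"
      using eventually_ge_at_top[of "nat \<lceil>\<bar>u\<bar>\<rceil>"]
    proof eventually_elim
      case (elim n)
      then have "\<bar>u\<bar> \<le> real n" by linarith
      then show ?case by (auto split: split_indicator)
    qed
    then show "(\<lambda>n. ennreal (?f (exp u) * exp u * indicator {- real n..real n} u)) \<longlonglongrightarrow> ennreal (?f (exp u) * exp u)"
      by (rule tendsto_eventually)
  qed measurable
  ultimately have "(\<integral>\<^sup>+x. ?f x \<partial>lborel) = (\<integral>\<^sup>+u. ?f (exp u) * exp u \<partial>lborel)"
    unfolding eq by (rule LIMSEQ_unique)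
  then show ?thesis
    by (simp add: ennreal_mult ennreal_indicator mult.commute)
qed

text \<open>
  With this description of the measure, integrals, integrability and null sets on the half-line
  are all transferred to the line by the general facts about image measures and densities.
\<close>

lemma halfline_eq_distr: "halfline = distr (density lborel (\<lambda>u. ennreal (exp u))) halfline exp"
proof (rule measure_eqI)
  fix A assume A: "A \<in> sets halfline"
  then have A': "A \<in> sets borel" "A \<subseteq> {0<..}"
    by (auto simp: sets_restrict_space)
  have m: "exp \<in> measurable (density lborel (\<lambda>u. ennreal (exp u))) halfline"
    using measurable_exp_halfline by simp
  have [measurable]: "exp -` A \<in> sets borel"
    using measurable_sets[OF measurable_exp_halfline A] by simp
  have "emeasure (distr (density lborel (\<lambda>u. ennreal (exp u))) halfline exp) A
      = (\<integral>\<^sup>+u. ennreal (exp u) * indicator (exp -` A) u \<partial>lborel)"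
    using m A by (subst emeasure_distr) (auto simp: emeasure_density)
  also have "\<dots> = (\<integral>\<^sup>+u. ennreal (exp u) * indicator A (exp u) \<partial>lborel)"
    by (intro nn_integral_cong) (auto split: split_indicator)
  also have "\<dots> = emeasure halfline A"
    using nn_integral_exp_substitution[OF A'] A' by (simp add: emeasure_restrict_space)
  finally show "emeasure halfline A = emeasure (distr (density lborel (\<lambda>u. ennreal (exp u))) halfline exp) A" by simp
qed simp

lemma
  fixes F :: "real \<Rightarrow> 'a :: {banach, second_countable_topology}"
  assumes F: "F \<in> borel_measurable halfline"
  shows integrable_halfline_iff: "integrable halfline F \<longleftrightarrow> integrable lborel (\<lambda>u. exp u *\<^sub>R F (exp u))"
    and integral_halfline: "(LINT x|halfline. F x) = (LINT u|lborel. exp u *\<^sub>R F (exp u))"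
proof -
  have m: "exp \<in> measurable (density lborel (\<lambda>u. ennreal (exp u))) halfline"
    using measurable_exp_halfline by simp
  have m': "(\<lambda>u. F (exp u)) \<in> borel_measurable lborel"
    using borel_measurable_halfline_exp[OF F] by simp
  have "integrable halfline F \<longleftrightarrow> integrable (distr (density lborel (\<lambda>u. ennreal (exp u))) halfline exp) F"
    using halfline_eq_distr by simp
  also have "\<dots> \<longleftrightarrow> integrable lborel (\<lambda>u. exp u *\<^sub>R F (exp u))"
    using integrable_distr_eq[OF m F] integrable_density[OF m', of exp] by simp
  finally show "integrable halfline F \<longleftrightarrow> integrable lborel (\<lambda>u. exp u *\<^sub>R F (exp u))" .
  have "(LINT x|halfline. F x) = (LINT x|distr (density lborel (\<lambda>u. ennreal (exp u))) halfline exp. F x)"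
    using halfline_eq_distr by simp
  also have "\<dots> = (LINT u|lborel. exp u *\<^sub>R F (exp u))"
    using integral_distr[OF m F] integral_density[OF m', of exp] by simp
  finally show "(LINT x|halfline. F x) = (LINT u|lborel. exp u *\<^sub>R F (exp u))" .
qed

lemma AE_halfline_exp:
  assumes "AE x in halfline. P x"
  shows "AE u in lborel. P (exp u)"
proof -
  have "AE x in distr (density lborel (\<lambda>u. ennreal (exp u))) halfline exp. P x"
    by (subst halfline_eq_distr[symmetric]) (rule assms)
  then have "AE u in density lborel (\<lambda>u. ennreal (exp u)). P (exp u)"
    by (rule AE_distrD[rotated]) (use measurable_exp_halfline in simp)
  then show ?thesis by (simp add: AE_density)
qed

section \<open>The operator \<open>V\<close>\<close>

text \<open>
  The inverse of \<open>V\<close>.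
\<close>

definition from_line :: "(real \<Rightarrow> complex) \<Rightarrow> real \<Rightarrow> complex" where
  "from_line v x = of_real (exp (- ln x / 2)) * v (ln x)"

lemma to_line_from_line [simp]: "to_line (from_line v) = v"
proof
  fix u
  have "complex_of_real (exp (u / 2)) * of_real (exp (- u / 2)) = 1"
    by (simp flip: of_real_mult exp_add)
  then show "to_line (from_line v) u = v u"
    by (simp add: to_line_def from_line_def flip: mult.assoc)
qed

lemma borel_measurable_to_line:
  assumes "f \<in> borel_measurable halfline"
  shows "to_line f \<in> borel_measurable borel"
proof -
  note [measurable] = borel_measurable_halfline_exp[OF assms]
  show ?thesis unfolding to_line_def[abs_def] by measurable
qed

lemma borel_measurable_from_line:
  assumes [measurable]: "v \<in> borel_measurable borel"
  shows "from_line v \<in> borel_measurable halfline"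
  unfolding from_line_def[abs_def] by (rule measurable_restrict_space1) measurable

lemma cmod_to_line: "(cmod (to_line f u))\<^sup>2 = exp u * (cmod (f (exp u)))\<^sup>2"
proof -
  have "(exp (u / 2))\<^sup>2 = exp u" by (simp flip: exp_double)
  then show ?thesis by (simp add: to_line_def norm_mult power_mult_distrib)
qed

lemma to_line_L2_iff:
  assumes "f \<in> borel_measurable halfline"
  shows "to_line f \<in> L2 lborel \<longleftrightarrow> f \<in> L2 halfline"
  using integrable_halfline_iff[of "\<lambda>x. (cmod (f x))\<^sup>2"] assms borel_measurable_to_line[OF assms]
  by (simp add: L2_def cmod_to_line)

lemma to_line_L2: "f \<in> L2 halfline \<Longrightarrow> to_line f \<in> L2 lborel"
  using to_line_L2_iff[OF L2_measurable] by blast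

lemma from_line_L2: "v \<in> L2 lborel \<Longrightarrow> from_line v \<in> L2 halfline"
  using to_line_L2_iff[OF borel_measurable_from_line, of v] L2_measurable[of v lborel] by simp

lemma L2_norm_halfline:
  assumes "f \<in> borel_measurable halfline"
  shows "L2_norm halfline f = L2_norm lborel (to_line f)"
  using integral_halfline[of "\<lambda>x. (cmod (f x))\<^sup>2"] assms
  by (simp add: L2_norm_def cmod_to_line)

lemma L2_inner_halfline:
  assumes [measurable]: "f \<in> borel_measurable halfline" "g \<in> borel_measurable halfline"
  shows "L2_inner halfline f g = L2_inner lborel (to_line f) (to_line g)"
proof -
  have "to_line f u * cnj (to_line g u) = exp u *\<^sub>R (f (exp u) * cnj (g (exp u)))" for u
  proof -
    let ?E = "complex_of_real (exp (u / 2))"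
    have "to_line f u * cnj (to_line g u) = (?E * ?E) * (f (exp u) * cnj (g (exp u)))"
      by (simp add: to_line_def del: of_real_exp)
    also have "?E * ?E = of_real (exp u)"
      by (simp flip: of_real_mult exp_add)
    finally show ?thesis
      by (simp only: scaleR_conv_of_real)
  qed
  then show ?thesis
    unfolding L2_inner_def using integral_halfline[of "\<lambda>x. f x * cnj (g x)"] by simp
qed

lemma to_line_diff: "to_line (\<lambda>x. f x - g x) = (\<lambda>u. to_line f u - to_line g u)"
  by (simp add: to_line_def fun_eq_iff right_diff_distrib)

section \<open>The Laplace transform as a convolution\<close>

definition laplace_kernel :: "real \<Rightarrow> complex" where
  "laplace_kernel u = of_real (exp (u / 2 - exp u))"

text \<open>
  The operator \<open>V L V\<^sup>-\<^sup>1\<close>, as \<open>to_line_laplace\<close> shows.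
\<close>

definition laplace_line :: "(real \<Rightarrow> complex) \<Rightarrow> real \<Rightarrow> complex" where
  "laplace_line v = convolution laplace_kernel (\<lambda>t. v (- t))"

lemma borel_measurable_laplace_kernel [measurable]: "laplace_kernel \<in> borel_measurable borel"
  unfolding laplace_kernel_def[abs_def] by measurable

text \<open>
  With \<open>z = exp u\<close> and \<open>\<tau> = exp (-r)\<close> the exponent \<open>z \<tau>\<close> becomes \<open>exp (u - r)\<close>; the Jacobian and the two
  factors from \<open>V\<close> are distributed so that the kernel again depends on \<open>u - r\<close> only.
\<close>

lemma to_line_laplace:
  assumes [measurable]: "f \<in> borel_measurable halfline"
  shows "to_line (laplace f) = laplace_line (to_line f)"
proof
  fix u
  have "laplace f (exp u) = (LINT s|lborel. exp s *\<^sub>R (of_real (exp (- exp u * exp s)) * f (exp s)))"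
    unfolding laplace_def
  proof (rule integral_halfline)
    have "(\<lambda>\<tau>. complex_of_real (exp (- exp u * \<tau>))) \<in> borel_measurable halfline"
      by (rule measurable_restrict_space1) measurable
    then show "(\<lambda>\<tau>. complex_of_real (exp (- exp u * \<tau>)) * f \<tau>) \<in> borel_measurable halfline"
      using assms by (rule borel_measurable_times)
  qed
  also have "\<dots> = (LINT r|lborel. exp (- r) *\<^sub>R (of_real (exp (- exp u * exp (- r))) * f (exp (- r))))"
    by (subst lborel_integral_real_affine[of "-1" _ 0]) simp_all
  finally have "to_line (laplace f) u = (LINT r|lborel. of_real (exp (u / 2)) *
      (exp (- r) *\<^sub>R (of_real (exp (- exp u * exp (- r))) * f (exp (- r)))))"
    unfolding to_line_def by (simp only: integral_mult_right_zero)
  also have "\<dots> = (LINT r|lborel. laplace_kernel (u - r) * to_line f (- r))"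
  proof (intro Bochner_Integration.integral_cong refl)
    fix r
    have "exp (u / 2) * exp (- r) * exp (- exp u * exp (- r)) = exp ((u - r) / 2 - exp (u - r)) * exp (- r / 2)"
    proof -
      have e: "exp u * exp (- r) = exp (u - r)" by (simp flip: exp_add)
      show ?thesis
        unfolding exp_add[symmetric] minus_mult_left[symmetric] e by (simp add: field_simps)
    qed
    then have "complex_of_real (exp (u / 2)) * of_real (exp (- r)) * of_real (exp (- exp u * exp (- r)))
        = of_real (exp ((u - r) / 2 - exp (u - r))) * of_real (exp (- r / 2))"
      by (simp only: of_real_mult[symmetric])
    then show "of_real (exp (u / 2)) * (exp (- r) *\<^sub>R (of_real (exp (- exp u * exp (- r))) * f (exp (- r))))
        = laplace_kernel (u - r) * to_line f (- r)"
      unfolding laplace_kernel_def to_line_def scaleR_conv_of_real by (simp only: mult.assoc[symmetric])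
  qed
  finally show "to_line (laplace f) u = laplace_line (to_line f) u"
    by (simp add: laplace_line_def convolution_def)
qed

lemma Gamma_integral_halfline:
  assumes z: "Re z > 0"
  shows "integrable halfline (\<lambda>t. complex_of_real t powr (z - 1) / of_real (exp t))"
    and "(LINT t|halfline. complex_of_real t powr (z - 1) / of_real (exp t)) = Gamma z"
proof -
  let ?f = "\<lambda>t. complex_of_real t powr (z - 1) / of_real (exp t)"
  let ?g = "\<lambda>t. indicator {0<..} t *\<^sub>R ?f t"
  have m: "?g \<in> borel_measurable lborel"
  proof -
    have "continuous_on {0<..} ?f"
      by (intro continuous_intros) auto
    then have "?g \<in> borel_measurable borel"
      by (intro borel_measurable_continuous_on_indicator) auto
    then show ?thesis by simp
  qed
  have ai: "set_integrable lebesgue {0<..} ?f"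
    by (rule absolutely_integrable_Gamma_integral'[OF z])
  then have "integrable lebesgue ?g" by (simp add: set_integrable_def)
  then have "integrable lborel ?g" by (simp only: integrable_completion[OF m])
  then show "integrable halfline ?f" by (simp add: integrable_restrict_space)
  have "(LINT t|halfline. ?f t) = (LINT t|lborel. ?g t)" by (simp add: integral_restrict_space)
  also have "\<dots> = (LINT t:{0<..}|lebesgue. ?f t)"
    unfolding set_lebesgue_integral_def by (simp only: integral_completion[OF m])
  also have "\<dots> = Gamma z"
    using set_lebesgue_integral_eq_integral(2)[OF ai] integral_unique[OF Gamma_integral_complex'[OF z]] by simp
  finally show "(LINT t|halfline. ?f t) = Gamma z" .
qed

text \<open>
  In exponential coordinates Euler's integral for the Gamma function is the Fourier integral of the
  kernel.  The case \<open>\<xi> = 0\<close> gives its integrability.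
\<close>

lemma
  shows integrable_laplace_kernel: "integrable lborel laplace_kernel"
    and fourier_laplace_kernel: "of_real (sqrt (2 * pi)) * fourier laplace_kernel \<xi> = Gamma (1 / 2 - \<i> * of_real \<xi>)"
proof -
  let ?z = "\<lambda>\<xi>. 1 / 2 - \<i> * complex_of_real \<xi>"
  let ?F = "\<lambda>\<xi> t. complex_of_real t powr (?z \<xi> - 1) / of_real (exp t)"
  have Re: "Re (?z \<xi>) > 0" for \<xi> by simp
  have eq: "(\<lambda>u. exp u *\<^sub>R ?F \<xi> (exp u)) = (\<lambda>u. wave \<xi> u * laplace_kernel u)" for \<xi>
  proof
    fix u
    have "complex_of_real (exp u) powr (?z \<xi> - 1) = exp ((?z \<xi> - 1) * of_real u)"
      by (simp add: powr_def Ln_of_real del: of_real_exp)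
    then have "exp u *\<^sub>R ?F \<xi> (exp u) = exp (of_real u) * exp ((?z \<xi> - 1) * of_real u) * exp (- of_real (exp u))"
      by (simp add: scaleR_conv_of_real exp_of_real exp_minus field_simps)
    also have "\<dots> = wave \<xi> u * exp (of_real (u / 2 - exp u))"
      unfolding exp_add[symmetric] by (simp add: algebra_simps)
    finally show "exp u *\<^sub>R ?F \<xi> (exp u) = wave \<xi> u * laplace_kernel u"
      by (simp only: laplace_kernel_def exp_of_real)
  qed
  note F = Gamma_integral_halfline[OF Re]
  note m = borel_measurable_integrable[OF F(1)]
  have "integrable lborel (\<lambda>u. exp u *\<^sub>R ?F 0 (exp u))"
    using F(1)[of 0] integrable_halfline_iff[OF m[of 0]] by simp
  then have "integrable lborel (\<lambda>u. wave 0 u * laplace_kernel u)"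
    by (simp only: eq)
  then show "integrable lborel laplace_kernel" by simp
  have "(LINT u|lborel. wave \<xi> u * laplace_kernel u) = Gamma (?z \<xi>)"
    using F(2)[of \<xi>] integral_halfline[OF m[of \<xi>]] by (simp only: eq)
  then show "of_real (sqrt (2 * pi)) * fourier laplace_kernel \<xi> = Gamma (?z \<xi>)"
    by (simp add: fourier_def)
qed

text \<open>
  The Mellin multiplier of \<open>L\<^sup>* L\<close>, by Euler's reflection formula on the critical line.
\<close>

lemma cmod_Gamma_critical_line:
  "(cmod (Gamma (1 / 2 - \<i> * of_real \<xi>)))\<^sup>2 = pi / cosh (pi * \<xi>)"
proof -
  let ?z = "1 / 2 - \<i> * complex_of_real \<xi>"
  have "complex_of_real ((cmod (Gamma ?z))\<^sup>2) = Gamma ?z * cnj (Gamma ?z)"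
    by (rule complex_norm_square)
  also have "cnj (Gamma ?z) = Gamma (1 - ?z)"
    by (simp add: cnj_Gamma)
  also have "Gamma ?z * Gamma (1 - ?z) = of_real pi / sin (of_real pi * ?z)"
    by (rule Gamma_reflection_complex)
  also have "sin (of_real pi * ?z) = cos (of_real (pi * \<xi>) * \<i>)"
    by (simp add: sin_cos_eq algebra_simps)
  also have "\<dots> = of_real (cosh (pi * \<xi>))"
    unfolding mult.commute[of _ \<i>] cosh_conv_cos[symmetric] cosh_def of_real_minus[symmetric] exp_of_real
    by (simp add: scaleR_conv_of_real)
  finally show ?thesis
    by (simp only: of_real_eq_iff flip: of_real_divide)
qed

lemma L2_reflect:
  assumes v: "v \<in> L2 lborel"
  shows "(\<lambda>t::real. v (- t)) \<in> L2 lborel" and "L2_norm lborel (\<lambda>t. v (- t)) = L2_norm lborel v"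
proof -
  have [measurable]: "v \<in> borel_measurable borel" using L2_measurable[OF v] by simp
  show "(\<lambda>t. v (- t)) \<in> L2 lborel"
    using lborel_integrable_real_affine[OF L2_integrable_sq[OF v], of "-1" 0] by (simp add: L2_def)
  show "L2_norm lborel (\<lambda>t. v (- t)) = L2_norm lborel v"
    unfolding L2_norm_def using lborel_integral_real_affine[of "-1" "\<lambda>x. (cmod (v x))\<^sup>2" 0] by simp
qed

lemma AE_lborel_reflect:
  fixes P :: "real \<Rightarrow> bool"
  assumes "AE x in lborel. P x"
  shows "AE x in lborel. P (- x)"
proof (rule AE_distrD[of uminus lborel borel])
  show "AE x in distr lborel borel uminus. P x"
    unfolding lborel_distr_uminus by (rule assms)
qed simp

lemma L2_inner_reflect: "L2_inner lborel (\<lambda>t::real. v (- t)) w = L2_inner lborel v (\<lambda>t. w (- t))"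
  unfolding L2_inner_def using lborel_integral_real_affine[of "-1" "\<lambda>x. v (- x) * cnj (w x)" 0] by simp

text \<open>
  By Young's inequality the \<open>L\<^sup>1\<close> norm of the kernel bounds the operator norm.
\<close>

definition laplace_line_bound :: real where
  "laplace_line_bound = (LINT t|lborel. cmod (laplace_kernel t))"

lemma laplace_line_bound_nonneg: "0 \<le> laplace_line_bound"
  by (simp add: laplace_line_bound_def)

lemma laplace_line_L2:
  assumes "v \<in> L2 lborel"
  shows "laplace_line v \<in> L2 lborel"
    and "L2_norm lborel (laplace_line v) \<le> laplace_line_bound * L2_norm lborel v"
  using convolution_L2[OF integrable_laplace_kernel L2_reflect(1)[OF assms]]
    L2_norm_convolution[OF integrable_laplace_kernel L2_reflect(1)[OF assms]] L2_reflect(2)[OF assms]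
  by (simp_all add: laplace_line_def laplace_line_bound_def)

lemma laplace_line_diff:
  assumes "v \<in> L2 lborel" "w \<in> L2 lborel"
  shows "AE t in lborel. laplace_line (\<lambda>x. v x - w x) t = laplace_line v t - laplace_line w t"
  unfolding laplace_line_def
  by (rule convolution_diff[OF integrable_laplace_kernel L2_reflect(1)[OF assms(1)] L2_reflect(1)[OF assms(2)]])

lemma laplace_line_scale: "laplace_line (\<lambda>x. c * v x) = (\<lambda>t. c * laplace_line v t)"
  unfolding laplace_line_def by (rule convolution_scale)

lemma laplace_line_cong_AE:
  assumes ae: "AE x in lborel. v x = w x" and [measurable]: "v \<in> borel_measurable borel" "w \<in> borel_measurable borel"
  shows "laplace_line v = laplace_line w"
  unfolding laplace_line_def by (rule convolution_cong_AE[OF AE_lborel_reflect[OF ae]]) measurable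

text \<open>
  Convolution with the real kernel \<open>\<ell>\<close> has convolution with the reflected kernel as its adjoint; the
  reflection built into \<open>laplace_line\<close> cancels this.
\<close>

lemma laplace_line_symmetric:
  assumes v: "v \<in> L2 lborel" and w: "w \<in> L2 lborel"
  shows "L2_inner lborel (laplace_line v) w = L2_inner lborel v (laplace_line w)"
proof -
  have "L2_inner lborel (laplace_line v) w
      = L2_inner lborel (\<lambda>t. v (- t)) (convolution (\<lambda>t. cnj (laplace_kernel (- t))) w)"
    unfolding laplace_line_def by (rule convolution_adjoint[OF integrable_laplace_kernel L2_reflect(1)[OF v] w])
  also have "\<dots> = L2_inner lborel v (\<lambda>t. convolution (\<lambda>t. cnj (laplace_kernel (- t))) w (- t))"
    by (rule L2_inner_reflect)
  also have "(\<lambda>t. convolution (\<lambda>t. cnj (laplace_kernel (- t))) w (- t)) = laplace_line w"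
  proof
    fix t
    show "convolution (\<lambda>t. cnj (laplace_kernel (- t))) w (- t) = laplace_line w t"
      unfolding convolution_def laplace_line_def
      using lborel_integral_real_affine[of "-1" "\<lambda>r. laplace_kernel (r + t) * w r" 0]
      by (simp add: laplace_kernel_def)
  qed
  finally show ?thesis .
qed

lemma laplace_line_integrable: "integrable lborel v \<Longrightarrow> integrable lborel (laplace_line v)"
  unfolding laplace_line_def
  using integrable_convolution[OF integrable_laplace_kernel] lborel_integrable_real_affine[of v "-1" 0] by simp

lemma fourier_laplace_line:
  assumes "integrable lborel v"
  shows "fourier (laplace_line v) \<xi> = Gamma (1 / 2 - \<i> * of_real \<xi>) * fourier v (- \<xi>)"
proof -
  have "integrable lborel (\<lambda>t. v (- t))"
    using lborel_integrable_real_affine[OF assms, of "-1" 0] by simp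
  then show ?thesis
    unfolding laplace_line_def fourier_convolution[OF integrable_laplace_kernel \<open>integrable lborel (\<lambda>t. v (- t))\<close>]
      fourier_laplace_kernel fourier_reflect by simp
qed

section \<open>The normal equation\<close>

context
  fixes k :: "real \<Rightarrow> complex"
  assumes k: "integrable lborel k"
begin

text \<open>
  For a dilated mollifier \<open>k\<close> this is \<open>I - C\<close> applied to \<open>v\<close>, with \<open>C\<close> the convolution by \<open>k\<close>.
\<close>

definition defect :: "(real \<Rightarrow> complex) \<Rightarrow> real \<Rightarrow> complex" where
  "defect v = (\<lambda>t. v t - convolution k v t)"

definition defect_adjoint :: "(real \<Rightarrow> complex) \<Rightarrow> real \<Rightarrow> complex" where
  "defect_adjoint v = (\<lambda>t. v t - convolution (\<lambda>t. cnj (k (- t))) v t)"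

definition defect_bound :: real where
  "defect_bound = 1 + (LINT t|lborel. cmod (k t))"

lemma defect_bound_nonneg: "0 \<le> defect_bound"
  by (simp add: defect_bound_def)

lemma integrable_adjoint_kernel: "integrable lborel (\<lambda>t. cnj (k (- t)))"
  using lborel_integrable_real_affine[OF k, of "-1" 0] by (simp add: integrable_cnj)

lemma defect_L2:
  assumes "v \<in> L2 lborel"
  shows "defect v \<in> L2 lborel" and "L2_norm lborel (defect v) \<le> defect_bound * L2_norm lborel v"
    and "defect_adjoint v \<in> L2 lborel" and "L2_norm lborel (defect_adjoint v) \<le> defect_bound * L2_norm lborel v"
proof -
  note c = convolution_L2[OF k assms] convolution_L2[OF integrable_adjoint_kernel assms]
  show "defect v \<in> L2 lborel" "defect_adjoint v \<in> L2 lborel"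
    unfolding defect_def defect_adjoint_def by (intro L2_diff assms c)+
  have "(LINT t|lborel. cmod (cnj (k (- t)))) = (LINT t|lborel. cmod (k t))"
    using lborel_integral_real_affine[of "-1" "\<lambda>t. cmod (k t)" 0] by simp
  then show "L2_norm lborel (defect v) \<le> defect_bound * L2_norm lborel v"
    "L2_norm lborel (defect_adjoint v) \<le> defect_bound * L2_norm lborel v"
    using L2_norm_triangle_diff[OF assms c(1)] L2_norm_triangle_diff[OF assms c(2)]
      L2_norm_convolution[OF k assms] L2_norm_convolution[OF integrable_adjoint_kernel assms]
    by (simp_all add: defect_def defect_adjoint_def defect_bound_def distrib_right)
qed

lemma defect_diff:
  assumes "v \<in> L2 lborel" "w \<in> L2 lborel"
  shows "AE t in lborel. defect (\<lambda>x. v x - w x) t = defect v t - defect w t"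
    and "AE t in lborel. defect_adjoint (\<lambda>x. v x - w x) t = defect_adjoint v t - defect_adjoint w t"
  unfolding defect_def defect_adjoint_def
  using convolution_diff[OF k assms] convolution_diff[OF integrable_adjoint_kernel assms] by auto

lemma defect_scale: "defect (\<lambda>x. c * v x) = (\<lambda>t. c * defect v t)"
  unfolding defect_def convolution_scale by (simp add: right_diff_distrib)

lemma defect_adjoint_cong_AE:
  assumes ae: "AE x in lborel. v x = w x" and "v \<in> borel_measurable borel" "w \<in> borel_measurable borel"
  shows "AE t in lborel. defect_adjoint v t = defect_adjoint w t"
  using ae convolution_cong_AE[OF assms borel_measurable_integrable[OF integrable_adjoint_kernel, simplified]]
  by (auto simp: defect_adjoint_def)

lemma defect_inner:
  assumes v: "v \<in> L2 lborel" and w: "w \<in> L2 lborel"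
  shows "L2_inner lborel w (defect v) = L2_inner lborel (defect_adjoint w) v"
proof -
  note c = convolution_L2[OF k v] convolution_L2[OF integrable_adjoint_kernel w]
  have "L2_inner lborel w (convolution k v) = L2_inner lborel (convolution (\<lambda>t. cnj (k (- t))) w) v"
    using convolution_adjoint[OF k v w] by (metis L2_inner_commute)
  then show ?thesis
    unfolding defect_def defect_adjoint_def
    by (simp add: L2_inner_diff_right[OF v c(1) w] L2_inner_diff_left[OF w c(2) v])
qed

text \<open>
  For \<open>e\<close> the error on the line, \<open>u\<close> the exact solution and \<open>\<eta>\<close> the data noise, \<open>residual e u \<eta>\<close> is half
  the gradient of the objective at \<open>u + e\<close>.
\<close>

definition residual :: "(real \<Rightarrow> complex) \<Rightarrow> (real \<Rightarrow> complex) \<Rightarrow> (real \<Rightarrow> complex) \<Rightarrow> real \<Rightarrow> complex" where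
  "residual e u \<eta> = (\<lambda>t. laplace_line (\<lambda>t. laplace_line e t - \<eta> t) t + defect_adjoint (defect (\<lambda>t. e t + u t)) t)"

lemma residual_L2:
  assumes e: "e \<in> L2 lborel" and u: "u \<in> L2 lborel" and \<eta>: "\<eta> \<in> L2 lborel"
  shows "residual e u \<eta> \<in> L2 lborel"
    and "L2_norm lborel (residual e u \<eta>) \<le>
      laplace_line_bound * (laplace_line_bound * L2_norm lborel e + L2_norm lborel \<eta>) +
      defect_bound * (defect_bound * (L2_norm lborel e + L2_norm lborel u))"
proof -
  note le = laplace_line_L2[OF e]
  note d = L2_diff[OF le(1) \<eta>]
  note l = laplace_line_L2[OF d]
  note s = L2_add[OF e u]
  note a = defect_L2(3,4)[OF defect_L2(1)[OF s]]
  show "residual e u \<eta> \<in> L2 lborel"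
    unfolding residual_def by (intro L2_add l(1) a(1))
  have "L2_norm lborel (residual e u \<eta>) \<le> L2_norm lborel (laplace_line (\<lambda>t. laplace_line e t - \<eta> t))
      + L2_norm lborel (defect_adjoint (defect (\<lambda>t. e t + u t)))"
    unfolding residual_def by (rule L2_norm_triangle[OF l(1) a(1)])
  also have "\<dots> \<le> laplace_line_bound * (laplace_line_bound * L2_norm lborel e + L2_norm lborel \<eta>) +
      defect_bound * (defect_bound * (L2_norm lborel e + L2_norm lborel u))"
  proof (rule add_mono)
    show "L2_norm lborel (laplace_line (\<lambda>t. laplace_line e t - \<eta> t))
        \<le> laplace_line_bound * (laplace_line_bound * L2_norm lborel e + L2_norm lborel \<eta>)"
      using L2_norm_triangle_diff[OF le(1) \<eta>] le(2)
      by (intro order_trans[OF l(2)] mult_left_mono laplace_line_bound_nonneg) simp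
    have "L2_norm lborel (defect (\<lambda>t. e t + u t)) \<le> defect_bound * (L2_norm lborel e + L2_norm lborel u)"
      by (intro order_trans[OF defect_L2(2)[OF s]] mult_left_mono defect_bound_nonneg L2_norm_triangle e u)
    then show "L2_norm lborel (defect_adjoint (defect (\<lambda>t. e t + u t)))
        \<le> defect_bound * (defect_bound * (L2_norm lborel e + L2_norm lborel u))"
      by (intro order_trans[OF a(2)] mult_left_mono defect_bound_nonneg)
  qed
  finally show "L2_norm lborel (residual e u \<eta>) \<le>
      laplace_line_bound * (laplace_line_bound * L2_norm lborel e + L2_norm lborel \<eta>) +
      defect_bound * (defect_bound * (L2_norm lborel e + L2_norm lborel u))" .
qed

lemma residual_diff:
  assumes e: "e \<in> L2 lborel" "e' \<in> L2 lborel" and u: "u \<in> L2 lborel" "u' \<in> L2 lborel"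
    and \<eta>: "\<eta> \<in> L2 lborel" "\<eta>' \<in> L2 lborel"
  shows "AE t in lborel. residual (\<lambda>x. e x - e' x) (\<lambda>x. u x - u' x) (\<lambda>x. \<eta> x - \<eta>' x) t
      = residual e u \<eta> t - residual e' u' \<eta>' t"
proof -
  note le = laplace_line_L2(1)[OF e(1)] laplace_line_L2(1)[OF e(2)]
  note led = laplace_line_L2(1)[OF L2_diff[OF e]]
  note s = L2_add[OF e(1) u(1)] L2_add[OF e(2) u(2)]
  note ds = defect_L2(1)[OF s(1)] defect_L2(1)[OF s(2)]
  have "laplace_line (\<lambda>t. laplace_line (\<lambda>x. e x - e' x) t - (\<eta> t - \<eta>' t))
      = laplace_line (\<lambda>t. (laplace_line e t - \<eta> t) - (laplace_line e' t - \<eta>' t))"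
  proof (rule laplace_line_cong_AE)
    show "AE t in lborel. laplace_line (\<lambda>x. e x - e' x) t - (\<eta> t - \<eta>' t)
        = (laplace_line e t - \<eta> t) - (laplace_line e' t - \<eta>' t)"
      using laplace_line_diff[OF e] by eventually_elim simp
    show "(\<lambda>t. laplace_line (\<lambda>x. e x - e' x) t - (\<eta> t - \<eta>' t)) \<in> borel_measurable borel"
      using L2_measurable[OF L2_diff[OF led L2_diff[OF \<eta>]]] by simp
    show "(\<lambda>t. (laplace_line e t - \<eta> t) - (laplace_line e' t - \<eta>' t)) \<in> borel_measurable borel"
      using L2_measurable[OF L2_diff[OF L2_diff[OF le(1) \<eta>(1)] L2_diff[OF le(2) \<eta>(2)]]] by simp
  qed
  moreover have "AE t in lborel. laplace_line (\<lambda>t. (laplace_line e t - \<eta> t) - (laplace_line e' t - \<eta>' t)) t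
      = laplace_line (\<lambda>t. laplace_line e t - \<eta> t) t - laplace_line (\<lambda>t. laplace_line e' t - \<eta>' t) t"
    by (rule laplace_line_diff[OF L2_diff[OF le(1) \<eta>(1)] L2_diff[OF le(2) \<eta>(2)]])
  moreover have "AE t in lborel. defect_adjoint (defect (\<lambda>t. (e t - e' t) + (u t - u' t))) t
      = defect_adjoint (\<lambda>t. defect (\<lambda>t. e t + u t) t - defect (\<lambda>t. e' t + u' t) t) t"
  proof (rule defect_adjoint_cong_AE)
    have "(\<lambda>t. (e t - e' t) + (u t - u' t)) = (\<lambda>t. (e t + u t) - (e' t + u' t))" by auto
    then show "AE t in lborel. defect (\<lambda>t. (e t - e' t) + (u t - u' t)) t
        = defect (\<lambda>t. e t + u t) t - defect (\<lambda>t. e' t + u' t) t"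
      using defect_diff(1)[OF s] by simp
    show "defect (\<lambda>t. (e t - e' t) + (u t - u' t)) \<in> borel_measurable borel"
      using L2_measurable[OF defect_L2(1)[OF L2_add[OF L2_diff[OF e] L2_diff[OF u]]]] by simp
    show "(\<lambda>t. defect (\<lambda>t. e t + u t) t - defect (\<lambda>t. e' t + u' t) t) \<in> borel_measurable borel"
      using L2_measurable[OF L2_diff[OF ds]] by simp
  qed
  moreover note defect_diff(2)[OF ds]
  ultimately show ?thesis
    unfolding residual_def by (auto elim: eventually_elim2)
qed

text \<open>
  Along the ray from a minimizer \<open>v\<close> in the direction of its negative gradient \<open>G\<close> the functional
  changes by \<open>-2 t \<parallel>G\<parallel>\<^sup>2 + t\<^sup>2 Q\<close>, which would be negative for small \<open>t > 0\<close> if \<open>G\<close> did not vanish.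
\<close>

lemma minimizer_gradient_zero:
  assumes v: "v \<in> L2 lborel" and y: "y \<in> L2 lborel"
    and min: "\<And>w. w \<in> L2 lborel \<Longrightarrow>
      (L2_norm lborel (\<lambda>t. y t - laplace_line v t))\<^sup>2 + (L2_norm lborel (defect v))\<^sup>2
      \<le> (L2_norm lborel (\<lambda>t. y t - laplace_line w t))\<^sup>2 + (L2_norm lborel (defect w))\<^sup>2"
  shows "L2_norm lborel (\<lambda>t. laplace_line (\<lambda>t. laplace_line v t - y t) t + defect_adjoint (defect v) t) = 0"
proof -
  define a where "a = (\<lambda>t. laplace_line v t - y t)"
  define G where "G = (\<lambda>t. laplace_line a t + defect_adjoint (defect v) t)"
  have a: "a \<in> L2 lborel" unfolding a_def by (intro L2_diff laplace_line_L2 v y)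
  note la = laplace_line_L2(1)[OF a]
  note dv = defect_L2(1)[OF v]
  note ddv = defect_L2(3)[OF dv]
  have G: "G \<in> L2 lborel" unfolding G_def by (intro L2_add la ddv)
  note lG = laplace_line_L2(1)[OF G]
  note dG = defect_L2(1)[OF G]
  define Q where "Q = (L2_norm lborel (laplace_line G))\<^sup>2 + (L2_norm lborel (defect G))\<^sup>2"
  define N where "N = (L2_norm lborel G)\<^sup>2"
  have Q: "Q \<ge> 0" by (simp add: Q_def)
  have ineq: "0 \<le> - 2 * t * N + t\<^sup>2 * Q" for t :: real
  proof -
    note tG = L2_scale[OF G, of "of_real t"]
    define w where "w = (\<lambda>x. v x - of_real t * G x)"
    have w: "w \<in> L2 lborel" unfolding w_def by (rule L2_diff[OF v tG])
    have 1: "L2_norm lborel (\<lambda>x. y x - laplace_line w x) = L2_norm lborel (\<lambda>x. a x - of_real t * laplace_line G x)"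
    proof -
      have "AE x in lborel. laplace_line w x - y x = a x - of_real t * laplace_line G x"
        using laplace_line_diff[OF v tG] unfolding w_def laplace_line_scale a_def by eventually_elim simp
      then have "L2_norm lborel (\<lambda>x. laplace_line w x - y x) = L2_norm lborel (\<lambda>x. a x - of_real t * laplace_line G x)"
        by (intro L2_cong_AE(2) L2_diff a L2_scale lG L2_measurable laplace_line_L2(1) w y)
      then show ?thesis by (simp add: L2_norm_minus_commute[of _ y])
    qed
    have 2: "L2_norm lborel (defect w) = L2_norm lborel (\<lambda>x. defect v x - of_real t * defect G x)"
    proof (rule L2_cong_AE(2))
      show "AE x in lborel. defect w x = defect v x - of_real t * defect G x"
        using defect_diff(1)[OF v tG] unfolding w_def defect_scale .
      show "(\<lambda>x. defect v x - of_real t * defect G x) \<in> L2 lborel"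
        by (rule L2_diff[OF dv L2_scale[OF dG]])
      show "defect w \<in> borel_measurable lborel" by (rule L2_measurable[OF defect_L2(1)[OF w]])
    qed
    have 3: "L2_norm lborel (\<lambda>t. y t - laplace_line v t) = L2_norm lborel a"
      unfolding a_def by (rule L2_norm_minus_commute)
    have "L2_inner lborel a (laplace_line G) + L2_inner lborel (defect v) (defect G)
        = L2_inner lborel (laplace_line a) G + L2_inner lborel (defect_adjoint (defect v)) G"
      by (simp add: laplace_line_symmetric[OF a G] defect_inner[OF G dv])
    also have "\<dots> = of_real N"
      unfolding L2_inner_add_left[OF la ddv G, symmetric] N_def L2_inner_self[symmetric] by (simp add: G_def)
    finally have "Re (L2_inner lborel a (laplace_line G)) + Re (L2_inner lborel (defect v) (defect G)) = N"
      by (metis Re_complex_of_real plus_complex.sel(1))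
    then have "- 2 * t * N + t\<^sup>2 * Q
        = (- 2 * t * Re (L2_inner lborel a (laplace_line G)) + t\<^sup>2 * (L2_norm lborel (laplace_line G))\<^sup>2)
          + (- 2 * t * Re (L2_inner lborel (defect v) (defect G)) + t\<^sup>2 * (L2_norm lborel (defect G))\<^sup>2)"
      by (simp only: Q_def distrib_left add_ac flip: \<open>_ = N\<close>)
    then show ?thesis
      using min[OF w] unfolding 1 2 3 L2_norm_diff_scale[OF a lG] L2_norm_diff_scale[OF dv dG]
      by linarith
  qed
  have N0: "N \<ge> 0" by (simp add: N_def)
  have "N = 0"
  proof (rule ccontr)
    assume "N \<noteq> 0"
    then have N: "N > 0" using N0 by simp
    \<comment> \<open>small enough for the linear term to dominate, and defined also for \<open>Q = 0\<close>\<close>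
    define t where "t = N / (Q + 1)"
    have t: "t > 0" using N Q by (simp add: t_def)
    have "t * Q \<le> N"
      using N Q by (simp add: t_def field_simps)
    then have "- 2 * N + t * Q < 0" using N by simp
    then have "t * (- 2 * N + t * Q) < 0" using t by (simp add: mult_pos_neg)
    then show False using ineq[of t] by (simp add: algebra_simps power2_eq_square)
  qed
  then show ?thesis
    by (simp add: N_def G_def a_def)
qed

section \<open>The error estimate in Fourier variables\<close>

text \<open>
  The Fourier multiplier of convolution by \<open>k\<close>.
\<close>

definition mollifier_symbol :: "real \<Rightarrow> complex" where
  "mollifier_symbol \<xi> = of_real (sqrt (2 * pi)) * fourier k \<xi>"

definition penalty :: "real \<Rightarrow> real" where
  "penalty \<xi> = (cmod (1 - mollifier_symbol \<xi>))\<^sup>2"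

lemma penalty_nonneg: "0 \<le> penalty \<xi>"
  by (simp add: penalty_def)

lemma borel_measurable_penalty [measurable]: "penalty \<in> borel_measurable borel"
proof -
  have [measurable]: "k \<in> borel_measurable borel" using borel_measurable_integrable[OF k] by simp
  show ?thesis unfolding penalty_def[abs_def] mollifier_symbol_def by measurable
qed

lemma defect_integrable:
  assumes "integrable lborel v"
  shows "integrable lborel (defect v)" and "integrable lborel (defect_adjoint v)"
  unfolding defect_def defect_adjoint_def
  using integrable_convolution[OF k assms] integrable_convolution[OF integrable_adjoint_kernel assms] assms
  by auto

lemma fourier_defect:
  assumes "integrable lborel v"
  shows "fourier (defect v) \<xi> = (1 - mollifier_symbol \<xi>) * fourier v \<xi>"
    and "fourier (defect_adjoint v) \<xi> = cnj (1 - mollifier_symbol \<xi>) * fourier v \<xi>"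
  unfolding defect_def defect_adjoint_def
    fourier_diff[OF assms integrable_convolution[OF k assms]]
    fourier_diff[OF assms integrable_convolution[OF integrable_adjoint_kernel assms]]
    fourier_convolution[OF k assms] fourier_convolution[OF integrable_adjoint_kernel assms] fourier_cnj_reflect
  by (simp_all add: mollifier_symbol_def algebra_simps)

text \<open>
  \<open>laplace_line\<close> maps frequency \<open>\<xi>\<close> to \<open>-\<xi>\<close>, so applying it twice restores \<open>\<xi>\<close> and multiplies by
  \<open>\<Gamma>(1/2 - i\<xi>) \<Gamma>(1/2 + i\<xi>)\<close>, whereas the noise, to which it is applied once, appears at \<open>-\<xi>\<close>.
\<close>

lemma fourier_residual:
  assumes e: "integrable lborel e" and u: "integrable lborel u" and \<eta>: "integrable lborel \<eta>"
  shows "fourier (residual e u \<eta>) \<xi> =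
      of_real (pi / cosh (pi * \<xi>) + penalty \<xi>) * fourier e \<xi> + of_real (penalty \<xi>) * fourier u \<xi>
      - Gamma (1 / 2 - \<i> * of_real \<xi>) * fourier \<eta> (- \<xi>)"
proof -
  note le = laplace_line_integrable[OF e]
  have d: "integrable lborel (\<lambda>t. laplace_line e t - \<eta> t)" using le \<eta> by simp
  have s: "integrable lborel (\<lambda>t. e t + u t)" using e u by simp
  let ?G = "Gamma (1 / 2 - \<i> * complex_of_real \<xi>)"
  have GG: "?G * Gamma (1 / 2 - \<i> * complex_of_real (- \<xi>)) = of_real (pi / cosh (pi * \<xi>))"
  proof -
    have "Gamma (1 / 2 - \<i> * complex_of_real (- \<xi>)) = cnj ?G" by (simp add: cnj_Gamma)
    then show ?thesis
      unfolding cmod_Gamma_critical_line[symmetric] by (simp only: complex_norm_square)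
  qed
  have pp: "cnj (1 - mollifier_symbol \<xi>) * (1 - mollifier_symbol \<xi>) = of_real (penalty \<xi>)"
    unfolding penalty_def complex_norm_square by (rule mult.commute)
  have "fourier (residual e u \<eta>) \<xi> = ?G * (Gamma (1 / 2 - \<i> * complex_of_real (- \<xi>)) * fourier e \<xi> - fourier \<eta> (- \<xi>))
      + cnj (1 - mollifier_symbol \<xi>) * ((1 - mollifier_symbol \<xi>) * (fourier e \<xi> + fourier u \<xi>))"
    unfolding residual_def
      fourier_add[OF laplace_line_integrable[OF d] defect_integrable(2)[OF defect_integrable(1)[OF s]]]
      fourier_laplace_line[OF d] fourier_diff[OF le \<eta>] fourier_laplace_line[OF e]
      fourier_defect(2)[OF defect_integrable(1)[OF s]] fourier_defect(1)[OF s] fourier_add[OF e u] by simp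
  also have "\<dots> = (?G * Gamma (1 / 2 - \<i> * complex_of_real (- \<xi>))) * fourier e \<xi> - ?G * fourier \<eta> (- \<xi>)
      + (cnj (1 - mollifier_symbol \<xi>) * (1 - mollifier_symbol \<xi>)) * (fourier e \<xi> + fourier u \<xi>)"
    by (simp only: right_diff_distrib[of ?G] mult.assoc)
  finally show ?thesis
    unfolding GG pp by (simp add: algebra_simps)
qed

end

section \<open>The stability estimate\<close>

definition truncate :: "nat \<Rightarrow> (real \<Rightarrow> complex) \<Rightarrow> real \<Rightarrow> complex" where
  "truncate n v = (\<lambda>t. indicator {- real n..real n} t * v t)"

lemma truncate_L2:
  assumes v: "v \<in> L2 lborel"
  shows "truncate n v \<in> L2 lborel" and "integrable lborel (truncate n v)"
    and "(\<lambda>n. L2_norm lborel (\<lambda>t. v t - truncate n v t)) \<longlonglongrightarrow> 0"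
proof -
  have [measurable]: "v \<in> borel_measurable borel" using L2_measurable[OF v] by simp
  show "truncate n v \<in> L2 lborel"
    unfolding truncate_def by (rule L2_dominated1(1)[OF v]) (auto split: split_indicator)
  have "(\<lambda>t. indicator {- real n..real n} t :: complex) \<in> L2 lborel"
  proof -
    have "(\<lambda>t. (cmod (indicator {- real n..real n} t))\<^sup>2) = (indicator {- real n..real n} :: real \<Rightarrow> real)"
      by (auto split: split_indicator)
    then show ?thesis by (simp add: L2_def integrable_indicator_iff)
  qed
  from L2_prod_integrable(2)[OF this v] show "integrable lborel (truncate n v)"
    unfolding truncate_def .
  have "(\<lambda>n. LINT t|lborel. (cmod (v t - truncate n v t))\<^sup>2) \<longlonglongrightarrow> (LINT t|(lborel :: real measure). 0::real)"
  proof (rule integral_dominated_convergence)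
    show "integrable lborel (\<lambda>t. (cmod (v t))\<^sup>2)" by (rule L2_integrable_sq[OF v])
    have "(\<lambda>n. (cmod (v t - truncate n v t))\<^sup>2) \<longlonglongrightarrow> 0" for t
    proof (rule tendsto_eventually)
      show "\<forall>\<^sub>F n in sequentially. (cmod (v t - truncate n v t))\<^sup>2 = 0"
        using eventually_ge_at_top[of "nat \<lceil>\<bar>t\<bar>\<rceil>"]
      proof eventually_elim
        case (elim n)
        then have "\<bar>t\<bar> \<le> real n" by linarith
        then show ?case by (auto simp: truncate_def split: split_indicator)
      qed
    qed
    then show "AE t in lborel. (\<lambda>n. (cmod (v t - truncate n v t))\<^sup>2) \<longlonglongrightarrow> 0" by simp
    show "AE t in lborel. norm ((cmod (v t - truncate n v t))\<^sup>2) \<le> (cmod (v t))\<^sup>2" for n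
      by (intro AE_I2) (auto simp: truncate_def split: split_indicator)
  qed (unfold truncate_def, measurable)
  then show "(\<lambda>n. L2_norm lborel (\<lambda>t. v t - truncate n v t)) \<longlonglongrightarrow> 0"
    unfolding L2_norm_def using tendsto_real_sqrt by fastforce
qed

context
  fixes k :: "real \<Rightarrow> complex"
  assumes k: "integrable lborel k"
begin

abbreviation spectral_sum :: "real \<Rightarrow> real" where
  "spectral_sum \<xi> \<equiv> pi / cosh (pi * \<xi>) + penalty k \<xi>"

definition bias_factor :: "real \<Rightarrow> real" where
  "bias_factor \<xi> = penalty k \<xi> / spectral_sum \<xi>"

lemma spectral_sum_pos: "0 < spectral_sum \<xi>"
  using penalty_nonneg[OF k, of \<xi>] by (intro add_pos_nonneg) auto

lemma borel_measurable_spectral_sum [measurable]: "spectral_sum \<in> borel_measurable borel"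
proof -
  have [measurable]: "(\<lambda>\<xi>. cosh (pi * \<xi>)) \<in> borel_measurable borel"
    by (intro borel_measurable_continuous_onI continuous_intros)
  note [measurable] = borel_measurable_penalty[OF k]
  show ?thesis by measurable
qed

lemma bias_factor_bounds: "0 \<le> bias_factor \<xi>" "bias_factor \<xi> \<le> 1"
  using penalty_nonneg[OF k, of \<xi>] spectral_sum_pos[of \<xi>] by (auto simp: bias_factor_def)

lemma borel_measurable_bias_factor [measurable]: "bias_factor \<in> borel_measurable borel"
proof -
  note [measurable] = borel_measurable_penalty[OF k]
  show ?thesis unfolding bias_factor_def[abs_def] by measurable
qed

lemma bias_factor_L2:
  assumes "v \<in> L2 lborel"
  shows "(\<lambda>\<xi>. of_real (bias_factor \<xi>) * v \<xi>) \<in> L2 lborel"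
    and "L2_norm lborel (\<lambda>\<xi>. of_real (bias_factor \<xi>) * v \<xi>) \<le> L2_norm lborel v"
proof -
  have [measurable]: "v \<in> borel_measurable borel" using L2_measurable[OF assms] by simp
  have le: "cmod (of_real (bias_factor \<xi>) * v \<xi>) \<le> cmod (v \<xi>)" for \<xi>
    using bias_factor_bounds[of \<xi>] by (simp add: norm_mult mult_left_le_one_le)
  show "(\<lambda>\<xi>. of_real (bias_factor \<xi>) * v \<xi>) \<in> L2 lborel"
    "L2_norm lborel (\<lambda>\<xi>. of_real (bias_factor \<xi>) * v \<xi>) \<le> L2_norm lborel v"
    by (rule L2_dominated1[OF assms]; use le in simp)+
qed

text \<open>
  Solving \<open>fourier_residual\<close> for \<open>fourier e\<close> splits the error into a noise, a bias and a remainder term,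
  each of which is bounded by multiplication with a bounded symbol.
\<close>

lemma error_estimate_integrable:
  assumes e: "integrable lborel e" "e \<in> L2 lborel" and u: "integrable lborel u" "u \<in> L2 lborel"
    and \<eta>: "integrable lborel \<eta>" "\<eta> \<in> L2 lborel"
    and N: "N \<ge> 0" "\<And>\<xi>. cmod (Gamma (1 / 2 - \<i> * of_real \<xi>)) \<le> N * spectral_sum \<xi>"
    and \<kappa>: "\<kappa> > 0" "\<And>\<xi>. \<kappa> \<le> spectral_sum \<xi>"
  shows "L2_norm lborel e \<le> N * L2_norm lborel \<eta>
      + L2_norm lborel (\<lambda>\<xi>. of_real (bias_factor \<xi>) * fourier u \<xi>) + L2_norm lborel (residual k e u \<eta>) / \<kappa>"
proof -
  have res: "integrable lborel (residual k e u \<eta>)"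
    unfolding residual_def[OF k]
    by (intro Bochner_Integration.integrable_add Bochner_Integration.integrable_diff laplace_line_integrable
        defect_integrable[OF k] e u \<eta>)
  have res2: "residual k e u \<eta> \<in> L2 lborel" by (rule residual_L2(1)[OF k e(2) u(2) \<eta>(2)])
  let ?S = "\<lambda>\<xi>. complex_of_real (spectral_sum \<xi>)"
  let ?G = "\<lambda>\<xi>. Gamma (1 / 2 - \<i> * complex_of_real \<xi>)"
  let ?R = "\<lambda>\<xi>. fourier (residual k e u \<eta>) \<xi>"
  have [measurable]: "e \<in> borel_measurable borel" "u \<in> borel_measurable borel" "\<eta> \<in> borel_measurable borel"
    "residual k e u \<eta> \<in> borel_measurable borel"
    using L2_measurable[OF e(2)] L2_measurable[OF u(2)] L2_measurable[OF \<eta>(2)] L2_measurable[OF res2] by simp_all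
  note [measurable] = borel_measurable_penalty[OF k]
  have [measurable]: "?G \<in> borel_measurable borel"
    unfolding fourier_laplace_kernel[symmetric] by measurable
  have S: "?S \<xi> \<noteq> 0" for \<xi> using spectral_sum_pos[of \<xi>] by (metis less_irrefl of_real_eq_0_iff)
  have split: "fourier e \<xi> = (?G \<xi> * fourier \<eta> (- \<xi>) / ?S \<xi> - of_real (bias_factor \<xi>) * fourier u \<xi>) + ?R \<xi> / ?S \<xi>" for \<xi>
  proof -
    have "?S \<xi> * fourier e \<xi> = (?G \<xi> * fourier \<eta> (- \<xi>) - of_real (penalty k \<xi>) * fourier u \<xi>) + ?R \<xi>"
      using fourier_residual[OF k e(1) u(1) \<eta>(1), of \<xi>] by simp
    then have "fourier e \<xi> = ((?G \<xi> * fourier \<eta> (- \<xi>) - of_real (penalty k \<xi>) * fourier u \<xi>) + ?R \<xi>) / ?S \<xi>"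
      using S[of \<xi>] by (metis nonzero_mult_div_cancel_left)
    then show ?thesis
      unfolding bias_factor_def add_divide_distrib diff_divide_distrib of_real_divide by simp
  qed
  have Fe: "(\<lambda>\<xi>. fourier \<eta> (- \<xi>)) \<in> L2 lborel" "L2_norm lborel (\<lambda>\<xi>. fourier \<eta> (- \<xi>)) = L2_norm lborel \<eta>"
    using L2_reflect[OF Plancherel(1)[OF \<eta>]] Plancherel(2)[OF \<eta>] by simp_all
  have noise_le: "cmod (?G \<xi> * fourier \<eta> (- \<xi>) / ?S \<xi>) \<le> N * cmod (fourier \<eta> (- \<xi>))" for \<xi>
  proof -
    have "cmod (?G \<xi>) / spectral_sum \<xi> \<le> N"
      using N(2)[of \<xi>] spectral_sum_pos[of \<xi>] by (simp add: pos_divide_le_eq)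
    then have "cmod (?G \<xi>) / spectral_sum \<xi> * cmod (fourier \<eta> (- \<xi>)) \<le> N * cmod (fourier \<eta> (- \<xi>))"
      by (rule mult_right_mono) simp
    moreover have "cmod (?S \<xi>) = spectral_sum \<xi>"
      using spectral_sum_pos[of \<xi>] by (metis abs_of_pos norm_of_real)
    ultimately show ?thesis by (simp add: norm_mult norm_divide)
  qed
  have rem_le: "cmod (?R \<xi> / ?S \<xi>) \<le> 1 / \<kappa> * cmod (?R \<xi>)" for \<xi>
  proof -
    have "cmod (?S \<xi>) = spectral_sum \<xi>"
      using spectral_sum_pos[of \<xi>] by (metis abs_of_pos norm_of_real)
    then show ?thesis
      using \<kappa>(1) \<kappa>(2)[of \<xi>] by (simp add: norm_divide frac_le)
  qed
  have noise: "(\<lambda>\<xi>. ?G \<xi> * fourier \<eta> (- \<xi>) / ?S \<xi>) \<in> L2 lborel"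
    "L2_norm lborel (\<lambda>\<xi>. ?G \<xi> * fourier \<eta> (- \<xi>) / ?S \<xi>) \<le> N * L2_norm lborel \<eta>"
  proof -
    have m: "(\<lambda>\<xi>. ?G \<xi> * fourier \<eta> (- \<xi>) / ?S \<xi>) \<in> borel_measurable lborel"
      by measurable
    note d = L2_dominated[OF Fe(1) m N(1) AE_I2[OF noise_le]]
    show "(\<lambda>\<xi>. ?G \<xi> * fourier \<eta> (- \<xi>) / ?S \<xi>) \<in> L2 lborel"
      "L2_norm lborel (\<lambda>\<xi>. ?G \<xi> * fourier \<eta> (- \<xi>) / ?S \<xi>) \<le> N * L2_norm lborel \<eta>"
      using d unfolding Fe(2) .
  qed
  have rem: "(\<lambda>\<xi>. ?R \<xi> / ?S \<xi>) \<in> L2 lborel"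
    "L2_norm lborel (\<lambda>\<xi>. ?R \<xi> / ?S \<xi>) \<le> 1 / \<kappa> * L2_norm lborel (residual k e u \<eta>)"
  proof -
    have m: "(\<lambda>\<xi>. ?R \<xi> / ?S \<xi>) \<in> borel_measurable lborel"
      by measurable
    have "0 \<le> 1 / \<kappa>" using \<kappa>(1) by simp
    note d = L2_dominated[OF Plancherel(1)[OF res res2] m this AE_I2[OF rem_le]]
    show "(\<lambda>\<xi>. ?R \<xi> / ?S \<xi>) \<in> L2 lborel"
      "L2_norm lborel (\<lambda>\<xi>. ?R \<xi> / ?S \<xi>) \<le> 1 / \<kappa> * L2_norm lborel (residual k e u \<eta>)"
      using d unfolding Plancherel(2)[OF res res2] .
  qed
  note bias = bias_factor_L2(1)[OF Plancherel(1)[OF u]]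
  have "L2_norm lborel e = L2_norm lborel (fourier e)"
    by (rule Plancherel(2)[OF e, symmetric])
  also have "\<dots> = L2_norm lborel (\<lambda>\<xi>. (?G \<xi> * fourier \<eta> (- \<xi>) / ?S \<xi> - of_real (bias_factor \<xi>) * fourier u \<xi>) + ?R \<xi> / ?S \<xi>)"
    by (rule L2_norm_cong) (simp only: split)
  also have "\<dots> \<le> (L2_norm lborel (\<lambda>\<xi>. ?G \<xi> * fourier \<eta> (- \<xi>) / ?S \<xi>)
      + L2_norm lborel (\<lambda>\<xi>. of_real (bias_factor \<xi>) * fourier u \<xi>)) + L2_norm lborel (\<lambda>\<xi>. ?R \<xi> / ?S \<xi>)"
    by (intro order_trans[OF L2_norm_triangle[OF L2_diff[OF noise(1) bias] rem(1)]] add_right_mono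
        L2_norm_triangle_diff noise(1) bias)
  finally show ?thesis using noise(2) rem(2) by simp
qed

text \<open>
  Truncation to \<open>[-n,n]\<close> extends the estimate to all square-integrable functions.  The residual is
  continuous in \<open>L\<^sup>2\<close>, so the remainder term disappears in the limit when the residual vanishes.
\<close>

lemma error_estimate:
  assumes e: "e \<in> L2 lborel" and \<eta>: "\<eta> \<in> L2 lborel" and u: "has_L2_fourier u vh"
    and zero: "L2_norm lborel (residual k e u \<eta>) = 0"
    and N: "N \<ge> 0" "\<And>\<xi>. cmod (Gamma (1 / 2 - \<i> * of_real \<xi>)) \<le> N * spectral_sum \<xi>"
    and \<kappa>: "\<kappa> > 0" "\<And>\<xi>. \<kappa> \<le> spectral_sum \<xi>"
  shows "L2_norm lborel e \<le> N * L2_norm lborel \<eta> + L2_norm lborel (\<lambda>\<xi>. of_real (bias_factor \<xi>) * vh \<xi>)"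
proof -
  have u2: "u \<in> L2 lborel" and vh: "vh \<in> L2 lborel"
    and lim: "(\<lambda>n. L2_norm lborel (\<lambda>\<xi>. fourier (truncate n u) \<xi> - vh \<xi>)) \<longlonglongrightarrow> 0"
    using u by (auto simp: has_L2_fourier_def truncate_def)
  let ?r = "\<lambda>n. residual k (truncate n e) (truncate n u) (truncate n \<eta>)"
  have est: "L2_norm lborel (truncate n e) \<le> N * L2_norm lborel (truncate n \<eta>)
      + L2_norm lborel (\<lambda>\<xi>. of_real (bias_factor \<xi>) * fourier (truncate n u) \<xi>)
      + L2_norm lborel (?r n) / \<kappa>" for n
    by (rule error_estimate_integrable[OF _ _ _ _ _ _ N \<kappa>]; intro truncate_L2 e u2 \<eta>)
  have conv: "(\<lambda>n. L2_norm lborel (truncate n v)) \<longlonglongrightarrow> L2_norm lborel v" if v: "v \<in> L2 lborel" for v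
    using truncate_L2(3)[OF v]
    by (intro L2_norm_tendsto[OF truncate_L2(1)[OF v] v]) (simp add: L2_norm_minus_commute[of _ v])
  have Fu: "fourier (truncate n u) \<in> L2 lborel" for n
    by (rule Plancherel(1)[OF truncate_L2(2)[OF u2] truncate_L2(1)[OF u2]])
  have bias: "(\<lambda>n. L2_norm lborel (\<lambda>\<xi>. of_real (bias_factor \<xi>) * fourier (truncate n u) \<xi>))
      \<longlonglongrightarrow> L2_norm lborel (\<lambda>\<xi>. of_real (bias_factor \<xi>) * vh \<xi>)"
  proof (rule L2_norm_tendsto)
    show "(\<lambda>n. L2_norm lborel (\<lambda>\<xi>. of_real (bias_factor \<xi>) * fourier (truncate n u) \<xi> - of_real (bias_factor \<xi>) * vh \<xi>)) \<longlonglongrightarrow> 0"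
      using bias_factor_L2(2)[OF L2_diff[OF Fu vh]]
      by (intro Lim_null_comparison[OF _ lim]) (simp add: right_diff_distrib)
  qed (intro bias_factor_L2 Fu vh)+
  have rem: "(\<lambda>n. L2_norm lborel (?r n)) \<longlonglongrightarrow> 0"
  proof (rule Lim_null_comparison)
    let ?d = "\<lambda>n v. L2_norm lborel (\<lambda>t. v t - truncate n v t)"
    let ?B = "\<lambda>n. laplace_line_bound * (laplace_line_bound * ?d n e + ?d n \<eta>) + defect_bound k * (defect_bound k * (?d n e + ?d n u))"
    have "L2_norm lborel (?r n) \<le> ?B n" for n
    proof -
      note t = truncate_L2(1)[OF e, of n] truncate_L2(1)[OF u2, of n] truncate_L2(1)[OF \<eta>, of n]
      note d = L2_diff[OF e t(1)] L2_diff[OF u2 t(2)] L2_diff[OF \<eta> t(3)]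
      note r = residual_L2(1)[OF k e u2 \<eta>] residual_L2(1)[OF k t]
      have "L2_norm lborel (?r n) \<le> L2_norm lborel (residual k e u \<eta>) + L2_norm lborel (\<lambda>t. residual k e u \<eta> t - ?r n t)"
        using L2_norm_reverse_triangle[OF r] by simp
      also have "L2_norm lborel (\<lambda>t. residual k e u \<eta> t - ?r n t) = L2_norm lborel
          (residual k (\<lambda>t. e t - truncate n e t) (\<lambda>t. u t - truncate n u t) (\<lambda>t. \<eta> t - truncate n \<eta> t))"
        by (rule L2_cong_AE(2)[symmetric, OF L2_diff[OF r] L2_measurable[OF residual_L2(1)[OF k d]]
            residual_diff[OF k e t(1) u2 t(2) \<eta> t(3)]])
      finally show ?thesis using residual_L2(2)[OF k d] zero by simp
    qed
    then show "\<forall>\<^sub>F n in sequentially. norm (L2_norm lborel (?r n)) \<le> ?B n" by simp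
    have "?B \<longlonglongrightarrow> laplace_line_bound * (laplace_line_bound * 0 + 0) + defect_bound k * (defect_bound k * (0 + 0))"
      by (intro tendsto_intros truncate_L2(3) e u2 \<eta>)
    then show "?B \<longlonglongrightarrow> 0" by simp
  qed
  have "(\<lambda>n. N * L2_norm lborel (truncate n \<eta>)
        + L2_norm lborel (\<lambda>\<xi>. of_real (bias_factor \<xi>) * fourier (truncate n u) \<xi>)
        + L2_norm lborel (?r n) / \<kappa>)
      \<longlonglongrightarrow> N * L2_norm lborel \<eta> + L2_norm lborel (\<lambda>\<xi>. of_real (bias_factor \<xi>) * vh \<xi>) + 0 / \<kappa>"
    by (intro tendsto_intros conv \<eta> bias rem) (use \<kappa>(1) in simp)
  then have "L2_norm lborel e \<le> N * L2_norm lborel \<eta> + L2_norm lborel (\<lambda>\<xi>. of_real (bias_factor \<xi>) * vh \<xi>) + 0 / \<kappa>"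
    by (rule LIMSEQ_le[OF conv[OF e]]) (use est in auto)
  then show ?thesis by simp
qed

end

section \<open>Transfer of the variational problem to the line\<close>

lemma from_line_to_line: "x > 0 \<Longrightarrow> from_line (to_line f) x = f x"
proof -
  assume x: "x > 0"
  have "complex_of_real (exp (- ln x / 2)) * of_real (exp (ln x / 2)) = 1"
    by (simp flip: of_real_mult exp_add)
  then show ?thesis
    using x by (simp add: to_line_def from_line_def flip: mult.assoc)
qed

lemma laplace_L2:
  assumes "h \<in> L2 halfline"
  shows "laplace h \<in> L2 halfline"
proof -
  have *: "to_line (laplace h) = laplace_line (to_line h)"
    by (rule to_line_laplace[OF L2_measurable[OF assms]])
  have l: "laplace_line (to_line h) \<in> L2 lborel"
    by (rule laplace_line_L2(1)[OF to_line_L2[OF assms]])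
  have "from_line (laplace_line (to_line h)) \<in> borel_measurable halfline"
    using L2_measurable[OF l] by (intro borel_measurable_from_line) simp
  also have "?this \<longleftrightarrow> laplace h \<in> borel_measurable halfline"
    by (rule measurable_cong) (simp add: from_line_to_line space_restrict_space flip: *)
  finally show ?thesis
    using to_line_L2_iff[of "laplace h"] l * by simp
qed

lemma objective_line:
  assumes k: "integrable lborel (dilate \<phi> \<beta>)" and g: "g \<in> L2 halfline" and h: "h \<in> L2 halfline"
  shows "objective \<phi> \<beta> g h = (L2_norm lborel (\<lambda>t. to_line g t - laplace_line (to_line h) t))\<^sup>2
      + (L2_norm lborel (defect (dilate \<phi> \<beta>) (to_line h)))\<^sup>2"
  unfolding objective_def mollify_def defect_def[OF k]
  using L2_norm_halfline[OF L2_measurable[OF L2_diff[OF g laplace_L2[OF h]]]]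
  by (simp add: to_line_diff to_line_laplace[OF L2_measurable[OF h]])

text \<open>
  Since \<open>V\<close> is onto, the minimality over \<open>L\<^sup>2(0,\<infinity>)\<close> is minimality over \<open>L\<^sup>2(\<real>)\<close>, and the gradient that
  vanishes at the minimizer is the residual of the error.
\<close>

lemma regularization_error:
  assumes k: "integrable lborel (dilate \<phi> \<beta>)"
    and f: "f \<in> L2 halfline" and g: "g \<in> L2 halfline" and gf: "AE z in halfline. g z = laplace f z"
    and g': "g' \<in> L2 halfline"
    and min: "is_arg_min (objective \<phi> \<beta> g') (\<lambda>h. h \<in> L2 halfline) h"
    and vh: "has_L2_fourier (to_line f) vh"
    and N: "N \<ge> 0" "\<And>\<xi>. cmod (Gamma (1 / 2 - \<i> * of_real \<xi>)) \<le> N * (pi / cosh (pi * \<xi>) + penalty (dilate \<phi> \<beta>) \<xi>)"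
    and \<kappa>: "\<kappa> > 0" "\<And>\<xi>. \<kappa> \<le> pi / cosh (pi * \<xi>) + penalty (dilate \<phi> \<beta>) \<xi>"
  shows "L2_norm halfline (\<lambda>x. f x - h x) \<le> N * L2_norm halfline (\<lambda>z. g z - g' z)
      + L2_norm lborel (\<lambda>\<xi>. of_real (bias_factor (dilate \<phi> \<beta>) \<xi>) * vh \<xi>)"
proof -
  have h: "h \<in> L2 halfline" and le: "\<And>h'. h' \<in> L2 halfline \<Longrightarrow> objective \<phi> \<beta> g' h \<le> objective \<phi> \<beta> g' h'"
    using min by (auto simp: is_arg_min_def not_less)
  let ?k = "dilate \<phi> \<beta>"
  define v u y where "v = to_line h" and "u = to_line f" and "y = to_line g'"
  define e where "e = (\<lambda>t. v t - u t)"
  define \<eta> where "\<eta> = (\<lambda>t. y t - to_line g t)"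
  have v: "v \<in> L2 lborel" and u: "u \<in> L2 lborel" and y: "y \<in> L2 lborel" and tg: "to_line g \<in> L2 lborel"
    unfolding v_def u_def y_def by (intro to_line_L2 h f g' g)+
  have e: "e \<in> L2 lborel" and \<eta>: "\<eta> \<in> L2 lborel"
    unfolding e_def \<eta>_def by (intro L2_diff v u y tg)+
  have grad: "L2_norm lborel (\<lambda>t. laplace_line (\<lambda>t. laplace_line v t - y t) t + defect_adjoint ?k (defect ?k v) t) = 0"
  proof (rule minimizer_gradient_zero[OF k v y])
    fix w :: "real \<Rightarrow> complex" assume w: "w \<in> L2 lborel"
    have "objective \<phi> \<beta> g' h \<le> objective \<phi> \<beta> g' (from_line w)"
      by (rule le[OF from_line_L2[OF w]])
    then show "(L2_norm lborel (\<lambda>t. y t - laplace_line v t))\<^sup>2 + (L2_norm lborel (defect ?k v))\<^sup>2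
        \<le> (L2_norm lborel (\<lambda>t. y t - laplace_line w t))\<^sup>2 + (L2_norm lborel (defect ?k w))\<^sup>2"
      unfolding objective_line[OF k g' h] objective_line[OF k g' from_line_L2[OF w]]
      by (simp add: v_def y_def)
  qed
  have gu: "AE t in lborel. to_line g t = laplace_line u t"
    using AE_halfline_exp[OF gf]
    unfolding u_def to_line_laplace[OF L2_measurable[OF f], symmetric] to_line_def by eventually_elim simp
  have "laplace_line (\<lambda>t. laplace_line e t - \<eta> t) = laplace_line (\<lambda>t. laplace_line v t - y t)"
  proof (rule laplace_line_cong_AE)
    show "AE t in lborel. laplace_line e t - \<eta> t = laplace_line v t - y t"
      using gu laplace_line_diff[OF v u] unfolding e_def \<eta>_def by eventually_elim simp
    show "(\<lambda>t. laplace_line e t - \<eta> t) \<in> borel_measurable borel"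
      using L2_measurable[OF L2_diff[OF laplace_line_L2(1)[OF e] \<eta>]] by simp
    show "(\<lambda>t. laplace_line v t - y t) \<in> borel_measurable borel"
      using L2_measurable[OF L2_diff[OF laplace_line_L2(1)[OF v] y]] by simp
  qed
  moreover have "(\<lambda>t. e t + u t) = v" by (simp add: e_def)
  ultimately have zero: "L2_norm lborel (residual ?k e u \<eta>) = 0"
    using grad unfolding residual_def[OF k] by simp
  have "L2_norm halfline (\<lambda>x. f x - h x) = L2_norm lborel e"
    unfolding L2_norm_halfline[OF L2_measurable[OF L2_diff[OF f h]]] to_line_diff e_def u_def v_def
    by (rule L2_norm_minus_commute)
  moreover have "L2_norm halfline (\<lambda>z. g z - g' z) = L2_norm lborel \<eta>"
    unfolding L2_norm_halfline[OF L2_measurable[OF L2_diff[OF g g']]] to_line_diff \<eta>_def y_def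
    by (rule L2_norm_minus_commute)
  ultimately show ?thesis
    using error_estimate[OF k e \<eta> vh[folded u_def] zero N \<kappa>] by simp
qed

section \<open>Symbols of the mollifiers\<close>

text \<open>
  One minus the multiplier of the mollifier, for a real-valued transform.
\<close>

definition symbol_gap :: "(real \<Rightarrow> complex) \<Rightarrow> real \<Rightarrow> real" where
  "symbol_gap \<phi> \<xi> = 1 - sqrt (2 * pi) * Re (fourier \<phi> \<xi>)"

lemma dilate_integrable:
  assumes "integrable lborel \<phi>" "\<beta> > 0"
  shows "integrable lborel (dilate \<phi> \<beta>)"
  using lborel_integrable_real_affine[OF assms(1), of "1 / \<beta>" 0] assms(2)
  by (simp add: dilate_def[abs_def])

lemma fourier_dilate:
  assumes "\<beta> > 0"
  shows "fourier (dilate \<phi> \<beta>) \<xi> = fourier \<phi> (\<beta> * \<xi>)"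
proof -
  have "(LINT t|lborel. wave \<xi> t * dilate \<phi> \<beta> t) = \<bar>\<beta>\<bar> *\<^sub>R (LINT t|lborel. wave \<xi> (0 + \<beta> * t) * dilate \<phi> \<beta> (0 + \<beta> * t))"
    by (rule lborel_integral_real_affine) (use assms in simp)
  also have "(\<lambda>t. wave \<xi> (0 + \<beta> * t) * dilate \<phi> \<beta> (0 + \<beta> * t)) = (\<lambda>t. (wave (\<beta> * \<xi>) t * \<phi> t) / of_real \<beta>)"
    using assms by (simp add: dilate_def mult_ac)
  also have "\<bar>\<beta>\<bar> *\<^sub>R (LINT t|lborel. (wave (\<beta> * \<xi>) t * \<phi> t) / of_real \<beta>) = (LINT t|lborel. wave (\<beta> * \<xi>) t * \<phi> t)"
    using assms by (simp add: scaleR_conv_of_real)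
  finally show ?thesis by (simp add: fourier_def)
qed

lemma penalty_dilate:
  assumes \<phi>: "integrable lborel \<phi>" and real: "\<forall>\<xi>. fourier \<phi> \<xi> \<in> \<real>" and \<beta>: "\<beta> > 0"
  shows "penalty (dilate \<phi> \<beta>) \<xi> = (symbol_gap \<phi> (\<beta> * \<xi>))\<^sup>2"
proof -
  have "fourier \<phi> (\<beta> * \<xi>) = of_real (Re (fourier \<phi> (\<beta> * \<xi>)))"
    using real by (metis of_real_Re)
  then have "1 - mollifier_symbol (dilate \<phi> \<beta>) \<xi> = of_real (symbol_gap \<phi> (\<beta> * \<xi>))"
    unfolding mollifier_symbol_def[OF dilate_integrable[OF \<phi> \<beta>]] symbol_gap_def fourier_dilate[OF \<beta>]
    by (metis of_real_1 of_real_diff of_real_mult)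
  then show ?thesis
    unfolding penalty_def[OF dilate_integrable[OF \<phi> \<beta>]] by simp
qed

text \<open>
  The unit integral means that the gap vanishes at 0; monotonicity then makes it nonnegative.
  The factors \<open>1/2\<close> and \<open>2\<close> leave room around the asymptotic constant 1.
\<close>

lemma symbol_gap_properties:
  assumes M2: "cond_M2 s \<phi>" and one: "(LINT t|lborel. \<phi> t) = 1"
  shows "\<bar>\<xi>\<bar> \<le> \<bar>\<zeta>\<bar> \<Longrightarrow> symbol_gap \<phi> \<xi> \<le> symbol_gap \<phi> \<zeta>"
    and "0 \<le> symbol_gap \<phi> \<xi>"
    and "\<exists>r0>0. \<forall>x. 0 < x \<and> x < r0 \<longrightarrow> x powr s / 2 \<le> symbol_gap \<phi> x \<and> symbol_gap \<phi> x \<le> 2 * x powr s"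
proof -
  show mono: "symbol_gap \<phi> \<xi> \<le> symbol_gap \<phi> \<zeta>" if "\<bar>\<xi>\<bar> \<le> \<bar>\<zeta>\<bar>" for \<xi> \<zeta>
    using M2 that unfolding cond_M2_def symbol_gap_def by (auto intro!: mult_left_mono)
  have "fourier \<phi> 0 = of_real (1 / sqrt (2 * pi))"
    using one by (simp add: fourier_def)
  then have "symbol_gap \<phi> 0 = 0"
    by (simp add: symbol_gap_def)
  then show nonneg: "0 \<le> symbol_gap \<phi> \<xi>" for \<xi>
    using mono[of 0 \<xi>] by simp
  have "(\<lambda>\<xi>. \<bar>symbol_gap \<phi> \<xi>\<bar>) \<sim>[at 0] (\<lambda>\<xi>. \<bar>\<xi>\<bar> powr s)"
    using M2 by (simp add: cond_M2_def symbol_gap_def)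
  then have "((\<lambda>\<xi>. if \<bar>symbol_gap \<phi> \<xi>\<bar> = 0 \<and> \<bar>\<xi>\<bar> powr s = 0 then 1 else \<bar>symbol_gap \<phi> \<xi>\<bar> / \<bar>\<xi>\<bar> powr s) \<longlongrightarrow> 1) (at 0)"
    unfolding asymp_equiv_def by simp
  then have "\<forall>\<^sub>F \<xi> in at 0. dist (if \<bar>symbol_gap \<phi> \<xi>\<bar> = 0 \<and> \<bar>\<xi>\<bar> powr s = 0 then 1 else \<bar>symbol_gap \<phi> \<xi>\<bar> / \<bar>\<xi>\<bar> powr s) 1 < 1 / 2"
    by (rule tendstoD) simp
  then obtain d where d: "d > 0" and close: "\<And>x. x \<noteq> 0 \<Longrightarrow> dist x 0 < d \<Longrightarrow>
      dist (if \<bar>symbol_gap \<phi> x\<bar> = 0 \<and> \<bar>x\<bar> powr s = 0 then 1 else \<bar>symbol_gap \<phi> x\<bar> / \<bar>x\<bar> powr s) 1 < 1 / 2"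
    unfolding eventually_at by blast
  show "\<exists>r0>0. \<forall>x. 0 < x \<and> x < r0 \<longrightarrow> x powr s / 2 \<le> symbol_gap \<phi> x \<and> symbol_gap \<phi> x \<le> 2 * x powr s"
  proof (intro exI[of _ d] conjI allI impI d)
    fix x assume x: "0 < x \<and> x < d"
    then have pos: "x powr s > 0" by simp
    have "\<bar>symbol_gap \<phi> x / x powr s - 1\<bar> < 1 / 2"
      using close[of x] x pos nonneg[of x] by (simp add: dist_real_def)
    then have "1 / 2 < symbol_gap \<phi> x / x powr s" "symbol_gap \<phi> x / x powr s < 3 / 2"
      by linarith+
    then show "x powr s / 2 \<le> symbol_gap \<phi> x" "symbol_gap \<phi> x \<le> 2 * x powr s"
      using pos by (simp_all add: field_simps)
  qed
qed

lemma cosh_le_exp_abs: "cosh (x::real) \<le> exp \<bar>x\<bar>"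
proof -
  have "exp x + exp (- x) \<le> exp \<bar>x\<bar> + exp \<bar>x\<bar>"
    by (intro add_mono) simp_all
  then show ?thesis by (simp add: cosh_def)
qed

lemma cosh_mono_abs: "\<bar>x\<bar> \<le> \<bar>y\<bar> \<Longrightarrow> cosh (x::real) \<le> cosh y"
  using cosh_real_nonneg_le_iff[of "\<bar>x\<bar>" "\<bar>y\<bar>"] by (simp add: cosh_real_abs)

context
  fixes \<phi> :: "real \<Rightarrow> complex" and s r0 :: real
  assumes \<phi>: "integrable lborel \<phi>" and real: "\<forall>\<xi>. fourier \<phi> \<xi> \<in> \<real>"
    and mono: "\<And>\<xi> \<zeta>. \<bar>\<xi>\<bar> \<le> \<bar>\<zeta>\<bar> \<Longrightarrow> symbol_gap \<phi> \<xi> \<le> symbol_gap \<phi> \<zeta>"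
    and nonneg: "\<And>\<xi>. 0 \<le> symbol_gap \<phi> \<xi>"
    and near0: "\<And>x. 0 < x \<Longrightarrow> x < r0 \<Longrightarrow> x powr s / 2 \<le> symbol_gap \<phi> x \<and> symbol_gap \<phi> x \<le> 2 * x powr s"
begin

text \<open>
  By monotonicity the gap at \<open>\<beta>\<xi>\<close> is at least its value at \<open>\<beta>\<close>, where the asymptotics at 0 apply.
\<close>

lemma penalty_lower:
  assumes \<beta>: "0 < \<beta>" "\<beta> < r0" and \<xi>: "\<bar>\<xi>\<bar> \<ge> 1"
  shows "(\<beta> powr s / 2)\<^sup>2 \<le> penalty (dilate \<phi> \<beta>) \<xi>"
proof -
  have "\<bar>\<beta>\<bar> \<le> \<bar>\<beta> * \<xi>\<bar>" using \<beta> \<xi> by (simp add: abs_mult)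
  then have "\<beta> powr s / 2 \<le> symbol_gap \<phi> (\<beta> * \<xi>)"
    using mono[of \<beta> "\<beta> * \<xi>"] near0[of \<beta>] \<beta> by auto
  then show ?thesis
    unfolding penalty_dilate[OF \<phi> real \<beta>(1)] by (intro power_mono) auto
qed

text \<open>
  Low frequencies are controlled by the lower bound of \<open>m = |\<Gamma>|\<^sup>2\<close> on \<open>[-1,1]\<close>.  High frequencies use
  \<open>2 b |\<Gamma>| \<le> |\<Gamma>|\<^sup>2 + b\<^sup>2\<close> with \<open>b\<^sup>2\<close> the lower bound of the penalty.
\<close>

lemma noise_symbol_bound:
  assumes \<beta>: "0 < \<beta>" "\<beta> < r0"
  shows "cmod (Gamma (1 / 2 - \<i> * of_real \<xi>)) \<le>
     (sqrt (cosh pi / pi) + \<beta> powr (- s)) * (pi / cosh (pi * \<xi>) + penalty (dilate \<phi> \<beta>) \<xi>)"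
proof -
  let ?G = "cmod (Gamma (1 / 2 - \<i> * of_real \<xi>))"
  let ?p = "penalty (dilate \<phi> \<beta>) \<xi>"
  have G2: "?G\<^sup>2 = pi / cosh (pi * \<xi>)" by (rule cmod_Gamma_critical_line)
  have p0: "?p \<ge> 0" by (rule penalty_nonneg[OF dilate_integrable[OF \<phi> \<beta>(1)]])
  show ?thesis
  proof (cases "\<bar>\<xi>\<bar> \<le> 1")
    case True
    have "pi / cosh pi \<le> ?G\<^sup>2"
      unfolding G2 using True by (intro divide_left_mono cosh_mono_abs) (auto simp: abs_mult)
    then have "1 \<le> (cosh pi / pi) * ?G\<^sup>2"
      by (simp add: field_simps)
    then have "sqrt 1 \<le> sqrt ((cosh pi / pi) * ?G\<^sup>2)" by (rule real_sqrt_le_mono)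
    then have "1 \<le> sqrt (cosh pi / pi) * ?G" by (simp add: real_sqrt_mult real_sqrt_divide)
    then have "?G * 1 \<le> ?G * (sqrt (cosh pi / pi) * ?G)" by (intro mult_left_mono) auto
    then have "?G \<le> sqrt (cosh pi / pi) * ?G\<^sup>2" by (simp add: power2_eq_square mult_ac)
    also have "\<dots> \<le> (sqrt (cosh pi / pi) + \<beta> powr (- s)) * (?G\<^sup>2 + ?p)"
      using p0 by (intro mult_mono) auto
    finally show ?thesis unfolding G2 .
  next
    case False
    define b where "b = \<beta> powr s / 2"
    have b: "b > 0" using \<beta> by (simp add: b_def)
    have "2 * b * ?G \<le> ?G\<^sup>2 + b\<^sup>2" using sum_squares_bound[of b ?G] by (simp add: mult_ac)
    also have "\<dots> \<le> ?G\<^sup>2 + ?p" using penalty_lower[OF \<beta>, of \<xi>] False by (simp add: b_def)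
    finally have "?G \<le> (?G\<^sup>2 + ?p) / (2 * b)" using b by (simp add: field_simps)
    also have "\<dots> = \<beta> powr (- s) * (?G\<^sup>2 + ?p)"
      using \<beta> by (simp add: b_def powr_minus field_simps)
    also have "\<dots> \<le> (sqrt (cosh pi / pi) + \<beta> powr (- s)) * (?G\<^sup>2 + ?p)"
      using p0 by (intro mult_right_mono) auto
    finally show ?thesis unfolding G2 .
  qed
qed

lemma spectral_lower_bound:
  assumes \<beta>: "0 < \<beta>" "\<beta> < r0"
  shows "min (pi / cosh pi) ((\<beta> powr s / 2)\<^sup>2) \<le> pi / cosh (pi * \<xi>) + penalty (dilate \<phi> \<beta>) \<xi>"
proof (cases "\<bar>\<xi>\<bar> \<le> 1")
  case True
  have "pi / cosh pi \<le> pi / cosh (pi * \<xi>)"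
    using True by (intro divide_left_mono cosh_mono_abs) (auto simp: abs_mult)
  then show ?thesis
    using penalty_nonneg[OF dilate_integrable[OF \<phi> \<beta>(1)], of \<xi>] by linarith
next
  case False
  have "0 \<le> pi / cosh (pi * \<xi>)" by simp
  then show ?thesis
    using penalty_lower[OF \<beta>, of \<xi>] False by linarith
qed

text \<open>
  The hypothesis on \<open>R\<close> is what the frequencies below \<open>R\<close> require: there the penalty is at most
  \<open>4 (\<beta>R)\<^sup>2\<^sup>s\<close> and \<open>m\<close> is at least \<open>\<pi> exp (-\<pi>R)\<close>.
\<close>

lemma bias_symbol_bound:
  assumes \<beta>: "0 < \<beta>" and R: "R > 0" "\<beta> * R < r0" and p: "p > 0"
    and small: "4 / pi * (\<beta> * R) powr (2 * s) * exp (pi * R) \<le> R powr (- p)"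
  shows "bias_factor (dilate \<phi> \<beta>) \<xi> \<le> R powr (- p) * (1 + \<bar>\<xi>\<bar>\<^sup>2) powr (p / 2)"
proof -
  note k = dilate_integrable[OF \<phi> \<beta>]
  let ?p = "penalty (dilate \<phi> \<beta>) \<xi>"
  have p0: "?p \<ge> 0" by (rule penalty_nonneg[OF k])
  show ?thesis
  proof (cases "\<bar>\<xi>\<bar> \<le> R")
    case True
    have "\<bar>\<beta> * \<xi>\<bar> \<le> \<bar>\<beta> * R\<bar>" using True \<beta> R by (simp add: abs_mult)
    then have "symbol_gap \<phi> (\<beta> * \<xi>) \<le> 2 * (\<beta> * R) powr s"
      using mono[of "\<beta> * \<xi>" "\<beta> * R"] near0[of "\<beta> * R"] \<beta> R by force
    then have "?p \<le> (2 * (\<beta> * R) powr s)\<^sup>2"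
      unfolding penalty_dilate[OF \<phi> real \<beta>] by (intro power_mono nonneg)
    also have "\<dots> = 4 * (\<beta> * R) powr (2 * s)"
      using \<beta> R by (simp add: power_mult_distrib power2_eq_square flip: powr_add)
    finally have pen: "?p \<le> 4 * (\<beta> * R) powr (2 * s)" .
    have "cosh (pi * \<xi>) \<le> exp \<bar>pi * \<xi>\<bar>" by (rule cosh_le_exp_abs)
    also have "\<dots> \<le> exp (pi * R)" using True by (simp add: abs_mult)
    finally have ch: "cosh (pi * \<xi>) \<le> exp (pi * R)" .
    have "bias_factor (dilate \<phi> \<beta>) \<xi> \<le> ?p / (pi / cosh (pi * \<xi>))"
      unfolding bias_factor_def[OF k]
    proof (rule divide_left_mono[OF _ p0])
      show "pi / cosh (pi * \<xi>) \<le> spectral_sum (dilate \<phi> \<beta>) \<xi>" using p0 by simp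
      show "0 < spectral_sum (dilate \<phi> \<beta>) \<xi> * (pi / cosh (pi * \<xi>))"
        by (intro mult_pos_pos spectral_sum_pos[OF k]) simp
    qed
    also have "\<dots> = ?p * cosh (pi * \<xi>) / pi" by simp
    also have "\<dots> \<le> 4 * (\<beta> * R) powr (2 * s) * exp (pi * R) / pi"
      using pen ch p0 by (intro divide_right_mono mult_mono) auto
    also have "\<dots> \<le> R powr (- p) * 1" using small by simp
    also have "\<dots> \<le> R powr (- p) * (1 + \<bar>\<xi>\<bar>\<^sup>2) powr (p / 2)"
      using p by (intro mult_left_mono ge_one_powr_ge_zero) auto
    finally show ?thesis .
  next
    case False
    then have \<xi>: "R < \<bar>\<xi>\<bar>" by simp
    have "bias_factor (dilate \<phi> \<beta>) \<xi> \<le> 1" by (rule bias_factor_bounds(2)[OF k])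
    also have "1 = R powr (- p) * R powr p"
      using R by (simp flip: powr_add)
    also have "\<dots> \<le> R powr (- p) * (1 + \<bar>\<xi>\<bar>\<^sup>2) powr (p / 2)"
    proof (rule mult_left_mono)
      have "R powr p \<le> \<bar>\<xi>\<bar> powr p"
        using \<xi> R p by (intro powr_mono2) auto
      also have "\<bar>\<xi>\<bar> powr p = (\<bar>\<xi>\<bar> powr 2) powr (p / 2)"
        by (simp only: powr_powr) simp
      also have "\<bar>\<xi>\<bar> powr 2 = \<bar>\<xi>\<bar>\<^sup>2"
        using \<xi> R by simp
      also have "(\<bar>\<xi>\<bar>\<^sup>2) powr (p / 2) \<le> (1 + \<bar>\<xi>\<bar>\<^sup>2) powr (p / 2)"
        using p by (intro powr_mono2) auto
      finally show "R powr p \<le> (1 + \<bar>\<xi>\<bar>\<^sup>2) powr (p / 2)" .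
    qed simp
    finally show ?thesis .
  qed
qed

end

section \<open>A vanishing source element\<close>

lemma laplace_bar_L2:
  assumes "h \<in> L2 halfline"
  shows "laplace_bar h \<in> L2 halfline"
proof -
  have *: "laplace_bar h = (\<lambda>z. (1 / of_real (sqrt (pi * exp 1))) * laplace h z)"
    by (simp add: laplace_bar_def[abs_def])
  show ?thesis unfolding * by (rule L2_scale[OF laplace_L2[OF assms]])
qed

lemma laplace_bar_symmetric:
  assumes f: "f \<in> L2 halfline" and h: "h \<in> L2 halfline"
  shows "L2_inner halfline (laplace_bar f) h = L2_inner halfline f (laplace_bar h)"
proof -
  note m = L2_measurable[OF f] L2_measurable[OF h] L2_measurable[OF laplace_L2[OF f]] L2_measurable[OF laplace_L2[OF h]]
  have "L2_inner halfline (laplace f) h = L2_inner halfline f (laplace h)"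
    unfolding L2_inner_halfline[OF m(3,2)] L2_inner_halfline[OF m(1,4)] to_line_laplace[OF m(1)] to_line_laplace[OF m(2)]
    by (rule laplace_line_symmetric[OF to_line_L2[OF f] to_line_L2[OF h]])
  then show ?thesis
    by (simp add: L2_inner_def laplace_bar_def)
qed

text \<open>
  The adjoint is a choice among the functions with the adjoint property, so its value at 0 is only
  known to be orthogonal to every element of \<open>L\<^sup>2\<close>, hence to itself.  That the property can be satisfied
  follows from the symmetry of \<open>laplace_bar\<close>.
\<close>

lemma laplace_normal_null:
  assumes "AE x in halfline. w x = 0"
  shows "laplace_normal w \<in> L2 halfline" and "AE x in halfline. laplace_normal w x = 0"
proof -
  define S where "S = L2_adjoint halfline halfline laplace_bar"
  have "(\<forall>h\<in>L2 halfline. S h \<in> L2 halfline) \<and>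
      (\<forall>f\<in>L2 halfline. \<forall>h\<in>L2 halfline. L2_inner halfline (laplace_bar f) h = L2_inner halfline f (S h))"
    unfolding S_def L2_adjoint_def
    by (rule someI[of _ laplace_bar]) (use laplace_bar_L2 laplace_bar_symmetric in blast)
  then have S: "S h \<in> L2 halfline" "f \<in> L2 halfline \<Longrightarrow> L2_inner halfline (laplace_bar f) h = L2_inner halfline f (S h)"
    if "h \<in> L2 halfline" for f h
    using that by blast+
  have "laplace w z = 0" for z
    unfolding laplace_def by (rule integral_eq_zero_AE) (use assms in auto)
  then have "laplace_bar w = (\<lambda>z. 0)"
    by (simp add: laplace_bar_def fun_eq_iff)
  then have N: "laplace_normal w = S (\<lambda>z. 0)"
    by (simp add: laplace_normal_def S_def)
  show mem: "laplace_normal w \<in> L2 halfline"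
    unfolding N by (rule S(1)) simp
  have "L2_inner halfline (laplace_normal w) (laplace_normal w) = L2_inner halfline (laplace_bar (laplace_normal w)) (\<lambda>z. 0)"
    using S(2)[OF L2_zero mem] by (simp add: N)
  also have "\<dots> = 0" by (simp add: L2_inner_def)
  finally have "L2_norm halfline (laplace_normal w) = 0"
    unfolding L2_inner_self by simp
  then show "AE x in halfline. laplace_normal w x = 0"
    by (rule L2_norm_eq_0[OF mem])
qed

lemma fun_calc_null:
  assumes calc: "is_fun_calc halfline laplace_normal b F w f" and w: "AE x in halfline. w x = 0"
  shows "AE x in halfline. f x = 0"
proof -
  have w2: "w \<in> L2 halfline" and f: "f \<in> L2 halfline" using calc by (auto simp: is_fun_calc_def)
  obtain q where lim: "(\<lambda>n. L2_norm halfline (\<lambda>x. poly_op (q n) laplace_normal w x - f x)) \<longlonglongrightarrow> 0"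
    using calc by (auto simp: is_fun_calc_def)
  have pow: "(laplace_normal ^^ i) w \<in> L2 halfline \<and> (AE x in halfline. (laplace_normal ^^ i) w x = 0)" for i
    by (induction i) (use w w2 laplace_normal_null in auto)
  have "L2_norm halfline (\<lambda>x. poly_op Q laplace_normal w x - f x) = L2_norm halfline f" for Q
  proof -
    have "AE x in halfline. \<forall>i. (laplace_normal ^^ i) w x = 0"
      unfolding AE_all_countable using pow by blast
    then have "AE x in halfline. poly_op Q laplace_normal w x - f x = - 1 * f x"
      by eventually_elim (simp add: poly_op_def)
    moreover have "(\<lambda>x. poly_op Q laplace_normal w x - f x) \<in> borel_measurable halfline"
      unfolding poly_op_def
      by (intro borel_measurable_diff borel_measurable_sum borel_measurable_times measurable_const)
         (use pow L2_measurable[OF f] L2_measurable in auto)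
    ultimately have "L2_norm halfline (\<lambda>x. poly_op Q laplace_normal w x - f x) = L2_norm halfline (\<lambda>x. - 1 * f x)"
      by (intro L2_cong_AE(2)[OF L2_scale[OF f]])
    then show ?thesis unfolding L2_norm_scale by simp
  qed
  then have "(\<lambda>n::nat. L2_norm halfline f) \<longlonglongrightarrow> 0"
    using lim by simp
  then have "L2_norm halfline f = 0"
    by (simp add: LIMSEQ_const_iff)
  then show ?thesis by (rule L2_norm_eq_0[OF f])
qed

lemma has_L2_fourier_null:
  assumes v: "v \<in> L2 lborel" and ae: "AE x in lborel. v x = 0"
  shows "has_L2_fourier v (\<lambda>_. 0)"
proof -
  have "(LINT t|lborel. wave \<xi> t * (indicator {- real n..real n} t * v t)) = 0" for \<xi> n
    by (rule integral_eq_zero_AE) (use ae in auto)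
  then have "fourier (\<lambda>t. indicator {- real n..real n} t * v t) = (\<lambda>_. 0)" for n
    by (simp add: fourier_def fun_eq_iff)
  then show ?thesis
    using v by (simp add: has_L2_fourier_def)
qed

section \<open>The convergence rate\<close>

text \<open>
  A logarithm is bounded by a small power; with \<open>d c = a/2\<close> half of the exponent \<open>a\<close> remains.
\<close>

lemma powr_times_log_tendsto_0:
  assumes a: "a > 0"
  shows "((\<lambda>x. x powr a * (- ln x) powr b) \<longlongrightarrow> 0) (at_right (0::real))"
proof -
  \<comment> \<open>a positive exponent that dominates \<open>b\<close>, which may be negative\<close>
  define c where "c = max b 1"
  have c: "c > 0" "b \<le> c" by (auto simp: c_def)
  define d where "d = a / (2 * c)"
  have d: "d > 0" using a c by (simp add: d_def)
  have "((\<lambda>x. x powr (a / 2)) \<longlongrightarrow> 0 powr (a / 2)) (at_right (0::real))"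
    by (intro tendsto_powr2 tendsto_const tendsto_ident_at) (use a in \<open>auto simp: eventually_at_right_less intro: eventually_mono[OF eventually_at_right_less]\<close>)
  then have "((\<lambda>x. x powr (a / 2) / d powr c) \<longlongrightarrow> 0) (at_right (0::real))"
    using tendsto_divide[OF _ tendsto_const, of "\<lambda>x. x powr (a / 2)" 0 "at_right 0" "d powr c"] d by simp
  moreover have "\<forall>\<^sub>F x in at_right (0::real). norm (x powr a * (- ln x) powr b) \<le> x powr (a / 2) / d powr c"
    using eventually_at_right_real[of 0 "exp (- 1)", OF exp_gt_zero]
  proof eventually_elim
    case (elim x)
    then have x: "0 < x" "x < exp (- 1)" by auto
    have "ln x \<le> ln (exp (- 1))" using x by (subst ln_le_cancel_iff) auto
    then have l: "- ln x \<ge> 1" by simp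
    have "ln (1 / x) \<le> (1 / x) powr d / d"
      using x d less_trans[OF x(2), of 1] by (intro ln_powr_bound) auto
    then have "- ln x \<le> x powr (- d) / d"
      using x by (simp add: ln_div powr_minus powr_divide field_simps)
    then have "(- ln x) powr c \<le> (x powr (- d) / d) powr c"
      using l c by (intro powr_mono2) auto
    also have "\<dots> = x powr (- d * c) / d powr c"
      by (simp only: powr_divide powr_powr)
    also have "- d * c = - (a / 2)"
      using c by (simp add: d_def)
    finally have le: "(- ln x) powr c \<le> x powr (- (a / 2)) / d powr c" .
    have "(- ln x) powr b \<le> (- ln x) powr c"
      using l c by (intro powr_mono) auto
    then have "x powr a * (- ln x) powr b \<le> x powr a * (x powr (- (a / 2)) / d powr c)"
      using le by (intro mult_left_mono) auto
    also have "\<dots> = x powr (a / 2) / d powr c"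
      by (simp flip: powr_add)
    finally show ?case by simp
  qed
  ultimately show ?thesis
    by (rule Lim_null_comparison[rotated])
qed

lemma log_source_powr:
  assumes "0 < \<delta>" "\<delta> < 1" "a > 0"
  shows "log_source p (\<delta> powr a) = a powr (- p) * (- ln \<delta>) powr (- p)"
proof -
  have *: "- ln (\<delta> powr a) = a * (- ln \<delta>)" using assms by (simp add: ln_powr)
  have "\<delta> powr a \<noteq> 0" using assms by simp
  then show ?thesis
    by (simp only: log_source_def if_False * powr_mult)
qed

lemma log_rate_bigo:
  assumes p: "p > 0" and \<theta>: "0 < \<theta>" "\<theta> < 1"
  shows "(\<lambda>\<delta>. A * log_source p (\<delta> powr (2 * \<theta>)) * (1 + 0) + C * \<delta> powr (1 - \<theta>))
    \<in> O[at_right 0](\<lambda>\<delta>. log_source p (\<delta>\<^sup>2))"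
proof -
  have ev: "\<forall>\<^sub>F \<delta> in at_right (0::real). 0 < \<delta> \<and> \<delta> < 1"
    using eventually_at_right_real[of 0 1] by (auto elim: eventually_mono)
  have "((\<lambda>\<delta>. \<delta> powr (1 - \<theta>) * (- ln \<delta>) powr p) \<longlongrightarrow> 0) (at_right 0)"
    by (rule powr_times_log_tendsto_0) (use \<theta> in simp)
  then have ev1: "\<forall>\<^sub>F \<delta> in at_right (0::real). \<delta> powr (1 - \<theta>) * (- ln \<delta>) powr p < 1"
    by (rule order_tendstoD(2)) simp
  show ?thesis
  proof (rule bigoI[of _ "(\<bar>A\<bar> * (2 * \<theta>) powr (- p) + \<bar>C\<bar>) * 2 powr p"])
    show "\<forall>\<^sub>F \<delta> in at_right 0. norm (A * log_source p (\<delta> powr (2 * \<theta>)) * (1 + 0) + C * \<delta> powr (1 - \<theta>))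
        \<le> (\<bar>A\<bar> * (2 * \<theta>) powr (- p) + \<bar>C\<bar>) * 2 powr p * norm (log_source p (\<delta>\<^sup>2))"
      using ev ev1
    proof eventually_elim
      case (elim \<delta>)
      define L where "L = (- ln \<delta>) powr (- p)"
      have ln: "- ln \<delta> > 0" using elim by simp
      have L: "L > 0" using ln by (simp add: L_def)
      have "\<delta>\<^sup>2 = \<delta> powr 2" using elim by simp
      then have sq: "log_source p (\<delta>\<^sup>2) = 2 powr (- p) * L"
        using log_source_powr[of \<delta> 2 p] elim by (simp add: L_def)
      have th: "log_source p (\<delta> powr (2 * \<theta>)) = (2 * \<theta>) powr (- p) * L"
        using log_source_powr[of \<delta> "2 * \<theta>" p] elim \<theta> by (simp add: L_def)
      have "(- ln \<delta>) powr p * L = 1"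
        using ln by (simp add: L_def flip: powr_add)
      moreover have "\<delta> powr (1 - \<theta>) * (- ln \<delta>) powr p * L \<le> 1 * L"
        using elim L by (intro mult_right_mono) auto
      ultimately have dl: "\<delta> powr (1 - \<theta>) \<le> L" by (simp add: mult.assoc)
      have "norm (A * log_source p (\<delta> powr (2 * \<theta>)) * (1 + 0) + C * \<delta> powr (1 - \<theta>))
          \<le> norm (A * log_source p (\<delta> powr (2 * \<theta>)) * (1 + 0)) + norm (C * \<delta> powr (1 - \<theta>))"
        by (rule norm_triangle_ineq)
      also have "\<dots> = \<bar>A\<bar> * ((2 * \<theta>) powr (- p) * L) + \<bar>C\<bar> * \<delta> powr (1 - \<theta>)"
        unfolding th using L by (simp add: abs_mult)
      also have "\<dots> \<le> \<bar>A\<bar> * ((2 * \<theta>) powr (- p) * L) + \<bar>C\<bar> * L"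
        using dl by (intro add_left_mono mult_left_mono) auto
      also have "\<dots> = (\<bar>A\<bar> * (2 * \<theta>) powr (- p) + \<bar>C\<bar>) * L"
        by (simp add: algebra_simps)
      also have "L = 2 powr p * norm (log_source p (\<delta>\<^sup>2))"
      proof -
        have "2 powr p * 2 powr (- p) = (1::real)" by (simp flip: powr_add)
        then show ?thesis unfolding sq using L by (simp add: abs_mult flip: mult.assoc)
      qed
      finally show ?case by (simp only: mult.assoc)
    qed
  qed
qed

text \<open>
  The weighted norm of \<open>vh\<close> is the Sobolev norm of \<open>V f\<close>.  It may be 0, a case that the theorem needs
  when the source element vanishes.
\<close>

lemma regularization_rate:
  fixes p s c \<theta> :: real
  assumes p: "p > 0" and s: "s > 0" and \<phi>: "integrable lborel \<phi>" and one: "(LINT t|lborel. \<phi> t) = 1"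
    and real: "\<forall>\<xi>. fourier \<phi> \<xi> \<in> \<real>" and M2: "cond_M2 s \<phi>"
    and f: "f \<in> L2 halfline" and g: "g \<in> L2 halfline" and gf: "AE z in halfline. g z = laplace f z"
    and g\<delta>: "\<And>\<delta>. \<delta> > 0 \<Longrightarrow> g\<delta> \<delta> \<in> L2 halfline \<and> L2_norm halfline (\<lambda>z. g z - g\<delta> \<delta> z) \<le> \<delta>"
    and min: "\<And>\<delta> \<beta>. \<delta> > 0 \<Longrightarrow> \<beta> > 0 \<Longrightarrow> is_arg_min (objective \<phi> \<beta> (g\<delta> \<delta>)) (\<lambda>h. h \<in> L2 halfline) (freg \<beta> \<delta>)"
    and c: "c > 0" and \<theta>: "0 < \<theta>" "\<theta> < 1"
    and vh: "has_L2_fourier (to_line f) vh"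
    and sob: "(\<lambda>\<xi>. of_real ((1 + \<bar>\<xi>\<bar>\<^sup>2) powr (p / 2)) * vh \<xi>) \<in> L2 lborel"
  shows "\<forall>\<^sub>F \<delta> in at_right 0. L2_norm halfline (\<lambda>x. f x - freg (c * \<delta> powr (\<theta> / s)) \<delta> x)
      \<le> (2 * pi) powr p * L2_norm lborel (\<lambda>\<xi>. of_real ((1 + \<bar>\<xi>\<bar>\<^sup>2) powr (p / 2)) * vh \<xi>) * log_source p (\<delta> powr (2 * \<theta>))
        + (sqrt (cosh pi / pi) + c powr (- s)) * \<delta> powr (1 - \<theta>)"
proof -
  note gap = symbol_gap_properties[OF M2 one]
  obtain r0 where r0: "r0 > 0" and near0: "\<And>x. 0 < x \<Longrightarrow> x < r0 \<Longrightarrow> x powr s / 2 \<le> symbol_gap \<phi> x \<and> symbol_gap \<phi> x \<le> 2 * x powr s"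
    using gap(3) by blast
  note bounds = \<phi> real gap(1,2) near0
  let ?\<beta> = "\<lambda>\<delta>. c * \<delta> powr (\<theta> / s)"
  \<comment> \<open>\<open>exp (pi R)\<close> is \<open>1/\<delta>\<close> to the power \<open>\<theta>\<close>, which uses up one of the two factors \<open>\<delta>\<close> to the power \<open>\<theta>\<close>
    provided by the penalty\<close>
  let ?R = "\<lambda>\<delta>. (\<theta> / pi) * (- ln \<delta>)"
  have ev: "\<forall>\<^sub>F \<delta> in at_right (0::real). 0 < \<delta> \<and> \<delta> < 1"
    using eventually_at_right_real[of 0 1] by (auto elim: eventually_mono)
  have "((\<lambda>\<delta>. c * (\<delta> powr (\<theta> / s) * (- ln \<delta>) powr 0)) \<longlongrightarrow> c * 0) (at_right 0)"
    by (intro tendsto_mult tendsto_const powr_times_log_tendsto_0) (use \<theta> s in simp)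
  then have "\<forall>\<^sub>F \<delta> in at_right 0. c * (\<delta> powr (\<theta> / s) * (- ln \<delta>) powr 0) < r0"
    by (intro order_tendstoD(2)) (use r0 in simp_all)
  moreover have "((\<lambda>\<delta>. c * (\<theta> / pi) * (\<delta> powr (\<theta> / s) * (- ln \<delta>) powr 1)) \<longlongrightarrow> c * (\<theta> / pi) * 0) (at_right 0)"
    by (intro tendsto_mult tendsto_const powr_times_log_tendsto_0) (use \<theta> s in simp)
  then have "\<forall>\<^sub>F \<delta> in at_right 0. c * (\<theta> / pi) * (\<delta> powr (\<theta> / s) * (- ln \<delta>) powr 1) < r0"
    by (intro order_tendstoD(2)) (use r0 in simp_all)
  moreover have "((\<lambda>\<delta>. 4 / pi * c powr (2 * s) * (\<theta> / pi) powr (2 * s + p) * (\<delta> powr \<theta> * (- ln \<delta>) powr (2 * s + p)))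
      \<longlongrightarrow> 4 / pi * c powr (2 * s) * (\<theta> / pi) powr (2 * s + p) * 0) (at_right 0)"
    by (intro tendsto_mult tendsto_const powr_times_log_tendsto_0 \<theta>)
  then have "\<forall>\<^sub>F \<delta> in at_right 0. 4 / pi * c powr (2 * s) * (\<theta> / pi) powr (2 * s + p) * (\<delta> powr \<theta> * (- ln \<delta>) powr (2 * s + p)) < 1"
    by (rule order_tendstoD(2)) simp
  ultimately show ?thesis
    using ev
  proof eventually_elim
    case (elim \<delta>)
    then have \<delta>: "0 < \<delta>" "\<delta> < 1" by auto
    define \<beta> where "\<beta> = ?\<beta> \<delta>"
    define R where "R = ?R \<delta>"
    have ln: "- ln \<delta> > 0" using \<delta> by simp
    have \<beta>: "0 < \<beta>" "\<beta> < r0" using elim(1) c \<delta> ln by (simp_all add: \<beta>_def)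
    have R: "R > 0"
      unfolding R_def using \<theta> ln by (intro mult_pos_pos) auto
    have \<beta>R: "\<beta> * R < r0"
      using elim(2) ln by (simp add: R_def \<beta>_def mult_ac)
    note k = dilate_integrable[OF \<phi> \<beta>(1)]
    have small: "4 / pi * (\<beta> * R) powr (2 * s) * exp (pi * R) \<le> R powr (- p)"
    proof -
      have "exp (pi * R) = \<delta> powr (- \<theta>)"
        using \<delta> by (simp add: R_def powr_def)
      moreover have "\<beta> powr (2 * s) = c powr (2 * s) * \<delta> powr (2 * \<theta>)"
        using c \<delta> s by (simp add: \<beta>_def powr_mult powr_powr mult.commute)
      moreover have "\<delta> powr (2 * \<theta>) * \<delta> powr (- \<theta>) = \<delta> powr \<theta>"
        by (simp flip: powr_add)
      ultimately have "(\<beta> * R) powr (2 * s) * exp (pi * R) = c powr (2 * s) * \<delta> powr \<theta> * R powr (2 * s)"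
        using \<beta> R by (simp add: powr_mult mult_ac)
      also have "R powr (2 * s) = R powr (2 * s + p) * R powr (- p)"
        by (simp flip: powr_add)
      also have "R powr (2 * s + p) = (\<theta> / pi) powr (2 * s + p) * (- ln \<delta>) powr (2 * s + p)"
        unfolding R_def by (rule powr_mult)
      finally have "4 / pi * (\<beta> * R) powr (2 * s) * exp (pi * R)
          = (4 / pi * c powr (2 * s) * (\<theta> / pi) powr (2 * s + p) * (\<delta> powr \<theta> * (- ln \<delta>) powr (2 * s + p))) * R powr (- p)"
        by (simp add: mult_ac)
      also have "\<dots> \<le> 1 * R powr (- p)"
        using elim(3) by (intro mult_right_mono) auto
      finally show ?thesis by simp
    qed
    let ?N = "sqrt (cosh pi / pi) + \<beta> powr (- s)"
    have N: "?N \<ge> 0" by simp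
    have \<kappa>: "min (pi / cosh pi) ((\<beta> powr s / 2)\<^sup>2) > 0" using \<beta> by simp
    have "L2_norm halfline (\<lambda>x. f x - freg \<beta> \<delta> x) \<le> ?N * L2_norm halfline (\<lambda>z. g z - g\<delta> \<delta> z)
        + L2_norm lborel (\<lambda>\<xi>. of_real (bias_factor (dilate \<phi> \<beta>) \<xi>) * vh \<xi>)"
      by (rule regularization_error[OF k f g gf conjunct1[OF g\<delta>[OF \<delta>(1)]] min[OF \<delta>(1) \<beta>(1)] vh N
            noise_symbol_bound[OF bounds \<beta>] \<kappa> spectral_lower_bound[OF bounds \<beta>]])
    also have "\<dots> \<le> ?N * \<delta> + R powr (- p) * L2_norm lborel (\<lambda>\<xi>. of_real ((1 + \<bar>\<xi>\<bar>\<^sup>2) powr (p / 2)) * vh \<xi>)"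
    proof (rule add_mono)
      show "?N * L2_norm halfline (\<lambda>z. g z - g\<delta> \<delta> z) \<le> ?N * \<delta>"
        using g\<delta>[OF \<delta>(1)] N by (intro mult_left_mono) auto
      have vh2: "vh \<in> L2 lborel" using vh by (simp add: has_L2_fourier_def)
      show "L2_norm lborel (\<lambda>\<xi>. of_real (bias_factor (dilate \<phi> \<beta>) \<xi>) * vh \<xi>)
          \<le> R powr (- p) * L2_norm lborel (\<lambda>\<xi>. of_real ((1 + \<bar>\<xi>\<bar>\<^sup>2) powr (p / 2)) * vh \<xi>)"
      proof (rule L2_dominated(2)[OF sob L2_measurable[OF bias_factor_L2(1)[OF k vh2]] _ AE_I2])
        fix \<xi>
        have "bias_factor (dilate \<phi> \<beta>) \<xi> * cmod (vh \<xi>) \<le> R powr (- p) * (1 + \<bar>\<xi>\<bar>\<^sup>2) powr (p / 2) * cmod (vh \<xi>)"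
          by (intro mult_right_mono bias_symbol_bound[OF bounds \<beta>(1) R \<beta>R p small]) auto
        then show "cmod (of_real (bias_factor (dilate \<phi> \<beta>) \<xi>) * vh \<xi>)
            \<le> R powr (- p) * cmod (of_real ((1 + \<bar>\<xi>\<bar>\<^sup>2) powr (p / 2)) * vh \<xi>)"
          using bias_factor_bounds(1)[OF k, of \<xi>] by (simp add: norm_mult mult.assoc)
      qed simp
    qed
    also have "R powr (- p) = (2 * pi) powr p * log_source p (\<delta> powr (2 * \<theta>))"
    proof -
      have "R powr (- p) = (1 / (2 * pi) * (2 * \<theta>)) powr (- p) * (- ln \<delta>) powr (- p)"
        unfolding R_def using \<theta> ln by (subst powr_mult) auto
      also have "(1 / (2 * pi) * (2 * \<theta>)) powr (- p) = (1 / (2 * pi)) powr (- p) * (2 * \<theta>) powr (- p)"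
        by (rule powr_mult)
      also have "(1 / (2 * pi)) powr (- p) = (2 * pi) powr p"
        by (simp add: powr_minus powr_divide field_simps)
      finally show ?thesis
        using log_source_powr[OF \<delta>, of "2 * \<theta>" p] \<theta> by simp
    qed
    also have "?N * \<delta> \<le> (sqrt (cosh pi / pi) + c powr (- s)) * \<delta> powr (1 - \<theta>)"
    proof -
      have "\<delta> powr 1 \<le> \<delta> powr (1 - \<theta>)"
        using \<delta> \<theta> by (intro powr_mono') auto
      then have 1: "\<delta> \<le> \<delta> powr (1 - \<theta>)" using \<delta> by simp
      have "\<beta> powr (- s) = c powr (- s) * \<delta> powr (- \<theta>)"
        using c \<delta> s by (simp add: \<beta>_def powr_mult powr_powr)
      moreover have "\<delta> powr (- \<theta>) * \<delta> = \<delta> powr (1 - \<theta>)"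
        using \<delta> by (metis add.commute diff_conv_add_uminus powr_add powr_one less_imp_le)
      ultimately have 2: "\<beta> powr (- s) * \<delta> = c powr (- s) * \<delta> powr (1 - \<theta>)" by (simp add: mult.assoc)
      have "?N * \<delta> = sqrt (cosh pi / pi) * \<delta> + c powr (- s) * \<delta> powr (1 - \<theta>)"
        unfolding distrib_right 2 ..
      also have "\<dots> \<le> sqrt (cosh pi / pi) * \<delta> powr (1 - \<theta>) + c powr (- s) * \<delta> powr (1 - \<theta>)"
        using 1 by (intro add_right_mono mult_left_mono) auto
      finally show ?thesis by (simp only: distrib_right)
    qed
    finally show ?case
      by (simp add: \<beta>_def mult_ac add_ac)
  qed
qed

theorem corollary4p1:
  fixes p s c \<theta> \<rho> :: real
    and \<phi> f g w :: "real \<Rightarrow> complex"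
    and g\<delta> :: "real \<Rightarrow> real \<Rightarrow> complex"
    and freg :: "real \<Rightarrow> real \<Rightarrow> real \<Rightarrow> complex"
  assumes "p > 0" and "s > 0"
    and "integrable lborel \<phi>" and "(LINT t|lborel. \<phi> t) = 1"
    and "\<forall>\<xi>. fourier \<phi> \<xi> \<in> \<real>" and "cond_M1 \<phi>" and "cond_M2 s \<phi>"
    and "f \<in> L2 halfline" and "g \<in> L2 halfline"
    and "AE z in halfline. g z = laplace f z"
    and "to_line f \<in> sobolev p"
    and "w \<in> L2 halfline"
    and "is_fun_calc halfline laplace_normal (exp (- 1)) (log_source p) w f"
    and "\<rho> = L2_norm halfline w"
    and "\<forall>\<delta>>0. g\<delta> \<delta> \<in> L2 halfline \<and> L2_norm halfline (\<lambda>z. g z - g\<delta> \<delta> z) \<le> \<delta>"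
    and "\<forall>\<delta>>0. \<forall>\<beta>>0. is_arg_min (objective \<phi> \<beta> (g\<delta> \<delta>)) (\<lambda>h. h \<in> L2 halfline) (freg \<beta> \<delta>)"
    and "c > 0" and "0 < \<theta>" and "\<theta> < 1"
  shows "\<exists>K>0. \<exists>C>0. \<exists>r :: real \<Rightarrow> real.
      r \<in> o[at_right 0](\<lambda>_. 1) \<and>
      (\<forall>\<^sub>F \<delta> in at_right 0.
         L2_norm halfline (\<lambda>x. f x - freg (c * \<delta> powr (\<theta> / s)) \<delta> x)
           \<le> K * \<rho> * log_source p (\<delta> powr (2 * \<theta>)) * (1 + r \<delta>) + C * \<delta> powr (1 - \<theta>)) \<and>
      (\<lambda>\<delta>. K * \<rho> * log_source p (\<delta> powr (2 * \<theta>)) * (1 + r \<delta>) + C * \<delta> powr (1 - \<theta>))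
        \<in> O[at_right 0](\<lambda>\<delta>. log_source p (\<delta>\<^sup>2))"
proof -
  define C where "C = sqrt (cosh pi / pi) + c powr (- s)"
  have C: "C > 0" using \<open>c > 0\<close> by (auto simp: C_def intro!: add_nonneg_pos)
  have \<rho>: "\<rho> \<ge> 0" using assms(14) by simp
  have ls: "log_source p x \<ge> 0" for x by (simp add: log_source_def)
  have rate: "\<forall>\<^sub>F \<delta> in at_right 0. L2_norm halfline (\<lambda>x. f x - freg (c * \<delta> powr (\<theta> / s)) \<delta> x)
      \<le> (2 * pi) powr p * L2_norm lborel (\<lambda>\<xi>. of_real ((1 + \<bar>\<xi>\<bar>\<^sup>2) powr (p / 2)) * vh \<xi>) * log_source p (\<delta> powr (2 * \<theta>))
        + C * \<delta> powr (1 - \<theta>)"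
    if "has_L2_fourier (to_line f) vh" "(\<lambda>\<xi>. of_real ((1 + \<bar>\<xi>\<bar>\<^sup>2) powr (p / 2)) * vh \<xi>) \<in> L2 lborel" for vh
    unfolding C_def using assms that by (intro regularization_rate[where g = g and g\<delta> = g\<delta> and \<phi> = \<phi>]) auto
  obtain K where K: "K > 0" and main: "\<forall>\<^sub>F \<delta> in at_right 0. L2_norm halfline (\<lambda>x. f x - freg (c * \<delta> powr (\<theta> / s)) \<delta> x)
      \<le> K * \<rho> * log_source p (\<delta> powr (2 * \<theta>)) + C * \<delta> powr (1 - \<theta>)"
  proof (cases "\<rho> = 0")
    case True
    then have "AE x in halfline. w x = 0"
      using L2_norm_eq_0[OF assms(12)] assms(14) by simp
    then have "AE x in halfline. f x = 0"
      by (rule fun_calc_null[OF assms(13)])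
    then have "AE u in lborel. to_line f u = 0"
      using AE_halfline_exp[of "\<lambda>x. f x = 0"] by (auto simp: to_line_def elim: eventually_mono)
    then have "has_L2_fourier (to_line f) (\<lambda>_. 0)"
      by (rule has_L2_fourier_null[OF to_line_L2[OF assms(8)]])
    from rate[OF this] show ?thesis
      using that[of 1] True by simp
  next
    case False
    obtain vh where vh: "has_L2_fourier (to_line f) vh"
      and int: "integrable lborel (\<lambda>\<xi>. (1 + \<bar>\<xi>\<bar>\<^sup>2) powr p * (cmod (vh \<xi>))\<^sup>2)"
      using assms(11) by (auto simp: sobolev_def)
    define H where "H = L2_norm lborel (\<lambda>\<xi>. of_real ((1 + \<bar>\<xi>\<bar>\<^sup>2) powr (p / 2)) * vh \<xi>)"
    have sq: "((1 + \<bar>\<xi>\<bar>\<^sup>2) powr (p / 2))\<^sup>2 = (1 + \<bar>\<xi>\<bar>\<^sup>2) powr p" for \<xi> :: real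
      by (simp add: power2_eq_square flip: powr_add)
    have "vh \<in> borel_measurable borel"
      using vh L2_measurable[of vh lborel] by (simp add: has_L2_fourier_def)
    note [measurable] = this
    have "(\<lambda>\<xi>. of_real ((1 + \<bar>\<xi>\<bar>\<^sup>2) powr (p / 2)) * vh \<xi>) \<in> borel_measurable lborel"
      by measurable
    moreover have "(\<lambda>\<xi>. (cmod (of_real ((1 + \<bar>\<xi>\<bar>\<^sup>2) powr (p / 2)) * vh \<xi>))\<^sup>2)
        = (\<lambda>\<xi>. (1 + \<bar>\<xi>\<bar>\<^sup>2) powr p * (cmod (vh \<xi>))\<^sup>2)"
      by (simp add: norm_mult power_mult_distrib sq[simplified])
    ultimately have sob: "(\<lambda>\<xi>. of_real ((1 + \<bar>\<xi>\<bar>\<^sup>2) powr (p / 2)) * vh \<xi>) \<in> L2 lborel"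
      using int by (simp only: L2_def mem_Collect_eq)
    \<comment> \<open>the added 1 keeps \<open>K\<close> positive when \<open>H = 0\<close>\<close>
    define K where "K = ((2 * pi) powr p * H + 1) / \<rho>"
    have H: "H \<ge> 0" by (simp add: H_def)
    have pos: "\<rho> > 0" using False \<rho> by simp
    have "0 \<le> (2 * pi) powr p * H" using H by simp
    then have K: "K > 0" using pos by (simp add: K_def)
    have "K * \<rho> = (2 * pi) powr p * H + 1" using pos by (simp add: K_def)
    then have le: "(2 * pi) powr p * H * log_source p x \<le> K * \<rho> * log_source p x" for x
      using ls[of x] by (intro mult_right_mono) auto
    show ?thesis
    proof (rule that[OF K])
      show "\<forall>\<^sub>F \<delta> in at_right 0. L2_norm halfline (\<lambda>x. f x - freg (c * \<delta> powr (\<theta> / s)) \<delta> x)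
          \<le> K * \<rho> * log_source p (\<delta> powr (2 * \<theta>)) + C * \<delta> powr (1 - \<theta>)"
        using rate[OF vh sob] unfolding H_def[symmetric]
      proof eventually_elim
        case (elim \<delta>)
        then show ?case using le[of "\<delta> powr (2 * \<theta>)"] by linarith
      qed
    qed
  qed
  show ?thesis
  proof (rule exI[of _ K], intro conjI K, rule exI[of _ C], intro conjI C, rule exI[of _ "\<lambda>_. 0"], intro conjI)
    show "\<forall>\<^sub>F \<delta> in at_right 0. L2_norm halfline (\<lambda>x. f x - freg (c * \<delta> powr (\<theta> / s)) \<delta> x)
        \<le> K * \<rho> * log_source p (\<delta> powr (2 * \<theta>)) * (1 + 0) + C * \<delta> powr (1 - \<theta>)"
      using main by simp
    show "(\<lambda>\<delta>. K * \<rho> * log_source p (\<delta> powr (2 * \<theta>)) * (1 + 0) + C * \<delta> powr (1 - \<theta>))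
        \<in> O[at_right 0](\<lambda>\<delta>. log_source p (\<delta>\<^sup>2))"
      by (rule log_rate_bigo[OF assms(1,18,19)])
  qed simp
qed

end
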